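(* Fix a number $\vartheta\in(0,1/3)$. Let $\lambda\ge\lambda_1$ and $\gamma\in[2e^{-\lambda\beta\widetilde T},1)$, and let $V_{\min,\lambda,\gamma}$ be the unique minimizer of the functional $J_{\lambda,\gamma}$ on the set $\overline{B(M,q_0,q_1)}$. Assume that $$V_{\min,\lambda,\gamma}\in B(\vartheta M,q_0,q_1).$$ Let $V^{(0)}\in B(\vartheta M,q_0,q_1)$ be an arbitrary point and, for $\varkappa\in(0,1)$, consider the gradient descent sequence $$V^{(n)}=V^{(n-1)}-\varkappa J_{\lambda,\gamma}'\left(V^{(n-1)}\right),\quad n=1,2,\ldots$$ Then there exists a sufficiently small number $\varkappa_0\in(0,1)$ such that $\{V^{(n)}\}_{n=0}^\infty\subset B(M,q_0,q_1)$ for each $\varkappa\in(0,\varkappa_0)$. Furthermore, for each $\varkappa\in(0,\varkappa_0)$ there exists a number $\theta=\theta(\varkappa)\in(0,1)$ such that $$\left\Vert V_{\min,\lambda,\gamma}-V^{(n)}\right\Vert_{H^4(R)}\le\theta^n\left\Vert V_{\min,\lambda,\gamma}-V^{(0)}\right\Vert_{H^4(R)},\quad n=1,2,\ldots$$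
   Context: Parameters: $\overline c>1$, $b\ge\sqrt{\overline c}$, $\beta\in(0,1/2)$, $\mu\in(0,2\beta b)$, $\widetilde T\ge 2b$, and $M>0$ is arbitrary. Set $R=\{(y,t):y\in(0,b),\,t\in(0,\widetilde T)\}$ and $R_{\beta,\mu,b}=\{(y,t): y+\beta t<2\beta b-\mu,\ y,t>0\}\subset R$. All functions are real-valued. Spaces: $H_0^2(R)=\{u\in H^2(R):u(0,t)=u_y(0,t)=0,\ u_y(b,t)=0\}$ and $H_0^4(R)=H^4(R)\cap H_0^2(R)$. Given data: functions $q_0(t),q_1(t)$, $t\in(0,\widetilde T)$. For any number $r>0$, $$B(r,q_0,q_1)=\{u\in H^4(R):u(0,t)=q_0(t),\ u_y(0,t)=q_1(t),\ u_y(b,t)=0,\ \Vert u\Vert_{H^4(R)}<r\},$$ and $\overline{B(r,q_0,q_1)}$ is its closure in $H^4(R)$. Functional: $\psi_\lambda(y,t)=e^{-2\lambda(y+\beta t)}$, $\mathcal S(V)=V_{yy}-2V_{yt}+4V_y(y,0)V$, and $$J_{\lambda,\gamma}(V)=\int_R[\mathcal S(V)]^2\psi_\lambda\,dy\,dt+\gamma\Vert V\Vert_{H^4(R)}^2.$$ Its Fréchet derivative at $V\in\overline{B(M,q_0,q_1)}$ is denoted by $J'_{\lambda,\gamma}(V)$ and is identified, through the inner product of $H^4(R)$, with an element of $H_0^4(R)$: $J'_{\lambda,\gamma}(V)(h)=(J'_{\lambda,\gamma}(V),h)_{H^4(R)}$ for $h\in H_0^4(R)$. The number $\lambda_1=\lambda_1(R,M,\beta)\ge\lambda_0\ge1$,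 where $\lambda_0=\lambda_0(\beta,R)$ is such that for some $C=C(\beta,R)>0$ the Carleman estimate $$\int_R(u_{yy}-2u_{yt})^2\psi_\lambda\,dydt\ge C\int_R(\lambda(u_y^2+u_t^2)+\lambda^3u^2)\psi_\lambda\,dydt+C\int_0^b(\lambda u_y^2+\lambda^3u^2)(y,0)e^{-2\lambda y}dy-Ce^{-2\lambda\widetilde T}\int_0^b(\lambda u_y^2+\lambda^3u^2)(y,\widetilde T)dy$$ holds for all $u\in H_0^2(R)$ and $\lambda\ge\lambda_0$, is a sufficiently large number depending only on $R,M,\beta$ such that for all $\lambda\ge\lambda_1$ and all $\gamma\in[2e^{-\lambda\beta\widetilde T},1)$ the functional $J_{\lambda,\gamma}$ is strictly convex on $\overline{B(M,q_0,q_1)}$ in the sense that for all $V_1,V_2\in\overline{B(M,q_0,q_1)}$ $$J_{\lambda,\gamma}(V_2)-J_{\lambda,\gamma}(V_1)-J'_{\lambda,\gamma}(V_1)(V_2-V_1)\ge Ke^{-2\lambda(2\beta b-\mu)}\left(\Vert V_2-V_1\Vert^2_{H^1(R_{\beta,\mu,b})}+\Vert V_2(y,0)-V_1(y,0)\Vert^2_{H^1(0,2\beta b-\mu)}\right)+\frac{\gamma}{2}\Vert V_2-V_1\Vert^2_{H^4(R)},$$ with a constant $K=K(\beta,\mu,b,M)>0$. For such $\lambda,\gamma$ the minimizer of $J_{\lambda,\gamma}$ on $\overline{B(M,q_0,q_1)}$ exists and is unique. *)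

theory Defs
  imports "HOL-Analysis.Analysis"
begin

section \<open>Sobolev spaces\<close>

text \<open>
  A multi-index is a function from vectors to natural numbers of which only the values on
  \<open>Basis\<close> matter. A smooth function is handled together with the family \<open>D\<close> of all its
  partial derivatives: \<open>D \<alpha>\<close> is the derivative of order \<open>\<alpha>\<close> of \<open>D (\<lambda>_. 0)\<close>.
\<close>

definition smooth_jet :: "(('a::euclidean_space \<Rightarrow> nat) \<Rightarrow> 'a \<Rightarrow> real) \<Rightarrow> bool" where
  "smooth_jet D \<longleftrightarrow>
     (\<forall>\<alpha> x. (D \<alpha> has_derivative (\<lambda>h. \<Sum>e\<in>Basis. (h \<bullet> e) * D (\<alpha>(e := Suc (\<alpha> e))) x)) (at x))"

definition test_jet :: "'a::euclidean_space set \<Rightarrow> (('a \<Rightarrow> nat) \<Rightarrow> 'a \<Rightarrow> real) \<Rightarrow> bool" where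
  "test_jet \<Omega> D \<longleftrightarrow> smooth_jet D \<and>
     compact (closure {x. D (\<lambda>_. 0) x \<noteq> 0}) \<and> closure {x. D (\<lambda>_. 0) x \<noteq> 0} \<subseteq> \<Omega>"

definition locally_integrable :: "'a::euclidean_space set \<Rightarrow> ('a \<Rightarrow> real) \<Rightarrow> bool" where
  "locally_integrable \<Omega> u \<longleftrightarrow> (\<forall>K. compact K \<and> K \<subseteq> \<Omega> \<longrightarrow> set_integrable lborel K u)"

definition square_integrable :: "'a::euclidean_space set \<Rightarrow> ('a \<Rightarrow> real) \<Rightarrow> bool" where
  "square_integrable \<Omega> u \<longleftrightarrow>
     set_borel_measurable lborel \<Omega> u \<and> set_integrable lborel \<Omega> (\<lambda>x. (u x)\<^sup>2)"

definition has_weak_deriv ::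
    "'a::euclidean_space set \<Rightarrow> ('a \<Rightarrow> nat) \<Rightarrow> ('a \<Rightarrow> real) \<Rightarrow> ('a \<Rightarrow> real) \<Rightarrow> bool" where
  "has_weak_deriv \<Omega> \<alpha> u v \<longleftrightarrow> locally_integrable \<Omega> u \<and> locally_integrable \<Omega> v \<and>
     (\<forall>D. test_jet \<Omega> D \<longrightarrow>
        (LINT x:\<Omega>|lborel. u x * D \<alpha> x) =
        (-1) ^ (\<Sum>e\<in>Basis. \<alpha> e) * (LINT x:\<Omega>|lborel. v x * D (\<lambda>_. 0) x))"

text \<open>
  Elements of Sobolev spaces are represented by functions. Weak derivatives, traces and
  gradients are determined only almost everywhere; the Hilbert choices below pick
  representatives, and values outside \<open>\<Omega>\<close> play no role.
\<close>

definition weak_deriv ::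
    "'a::euclidean_space set \<Rightarrow> ('a \<Rightarrow> nat) \<Rightarrow> ('a \<Rightarrow> real) \<Rightarrow> 'a \<Rightarrow> real" where
  "weak_deriv \<Omega> \<alpha> u = (SOME v. has_weak_deriv \<Omega> \<alpha> u v)"

definition multi_indices :: "nat \<Rightarrow> ('a::euclidean_space \<Rightarrow> nat) set" where
  "multi_indices k = {\<alpha>. (\<forall>e. e \<notin> Basis \<longrightarrow> \<alpha> e = 0) \<and> (\<Sum>e\<in>Basis. \<alpha> e) \<le> k}"

definition sobolev :: "nat \<Rightarrow> 'a::euclidean_space set \<Rightarrow> ('a \<Rightarrow> real) set" where
  "sobolev k \<Omega> =
     {u. \<forall>\<alpha>\<in>multi_indices k. \<exists>v. has_weak_deriv \<Omega> \<alpha> u v \<and> square_integrable \<Omega> v}"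

definition sobolev_inner ::
    "nat \<Rightarrow> 'a::euclidean_space set \<Rightarrow> ('a \<Rightarrow> real) \<Rightarrow> ('a \<Rightarrow> real) \<Rightarrow> real" where
  "sobolev_inner k \<Omega> u v =
     (\<Sum>\<alpha>\<in>multi_indices k. LINT x:\<Omega>|lborel. weak_deriv \<Omega> \<alpha> u x * weak_deriv \<Omega> \<alpha> v x)"

definition sobolev_norm :: "nat \<Rightarrow> 'a::euclidean_space set \<Rightarrow> ('a \<Rightarrow> real) \<Rightarrow> real" where
  "sobolev_norm k \<Omega> u = sqrt (sobolev_inner k \<Omega> u u)"

definition sobolev_closure ::
    "nat \<Rightarrow> 'a::euclidean_space set \<Rightarrow> ('a \<Rightarrow> real) set \<Rightarrow> ('a \<Rightarrow> real) set" where
  "sobolev_closure k \<Omega> A =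
     {u \<in> sobolev k \<Omega>. \<forall>\<epsilon>>0. \<exists>v\<in>A. sobolev_norm k \<Omega> (\<lambda>x. u x - v x) < \<epsilon>}"

text \<open>
  The trace operator is the continuous extension to \<open>H\<^sup>1(\<Omega>)\<close> of the restriction of functions in
  \<open>H\<^sup>1(\<Omega>)\<close> that are continuous up to the boundary. Here the piece of the boundary is
  parametrised by \<open>p\<close> on the interval \<open>I\<close>.
\<close>

definition has_trace ::
    "'a::euclidean_space set \<Rightarrow> real set \<Rightarrow> (real \<Rightarrow> 'a) \<Rightarrow> ('a \<Rightarrow> real) \<Rightarrow> (real \<Rightarrow> real) \<Rightarrow> bool" where
  "has_trace \<Omega> I p u g \<longleftrightarrow> u \<in> sobolev 1 \<Omega> \<and> square_integrable I g \<and>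
     (\<exists>\<phi>::nat \<Rightarrow> 'a \<Rightarrow> real.
        (\<forall>n. \<phi> n \<in> sobolev 1 \<Omega> \<and> continuous_on (closure \<Omega>) (\<phi> n)) \<and>
        (\<lambda>n. sobolev_norm 1 \<Omega> (\<lambda>x. u x - \<phi> n x)) \<longlonglongrightarrow> 0 \<and>
        (\<lambda>n. LINT s:I|lborel. (\<phi> n (p s) - g s)\<^sup>2) \<longlonglongrightarrow> 0)"

definition trace ::
    "'a::euclidean_space set \<Rightarrow> real set \<Rightarrow> (real \<Rightarrow> 'a) \<Rightarrow> ('a \<Rightarrow> real) \<Rightarrow> real \<Rightarrow> real" where
  "trace \<Omega> I p u = (SOME g. has_trace \<Omega> I p u g)"


section \<open>The rectangle and the function spaces on it\<close>

definition rect :: "real \<Rightarrow> real \<Rightarrow> (real \<times> real) set" where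
  "rect b T = {0<..<b} \<times> {0<..<T}"

definition subdomain :: "real \<Rightarrow> real \<Rightarrow> real \<Rightarrow> (real \<times> real) set" where
  "subdomain \<beta> \<mu> b = {(y, t). y + \<beta> * t < 2 * \<beta> * b - \<mu> \<and> y > 0 \<and> t > 0}"

definition pderiv :: "real \<Rightarrow> real \<Rightarrow> nat \<Rightarrow> nat \<Rightarrow> (real \<times> real \<Rightarrow> real) \<Rightarrow> real \<times> real \<Rightarrow> real" where
  "pderiv b T i j = weak_deriv (rect b T) ((\<lambda>_. 0)((1, 0) := i, (0, 1) := j))"

abbreviation (input) y_deriv where
  "y_deriv b T \<equiv> pderiv b T 1 0"

definition trace_y :: "real \<Rightarrow> real \<Rightarrow> real \<Rightarrow> (real \<times> real \<Rightarrow> real) \<Rightarrow> (real \<Rightarrow> real) \<Rightarrow> bool" where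
  "trace_y b T a u g \<longleftrightarrow> has_trace (rect b T) {0<..<T} (\<lambda>t. (a, t)) u g"

definition initial_trace :: "real \<Rightarrow> real \<Rightarrow> (real \<times> real \<Rightarrow> real) \<Rightarrow> real \<Rightarrow> real" where
  "initial_trace b T u = trace (rect b T) {0<..<b} (\<lambda>y. (y, 0)) u"

definition H02 :: "real \<Rightarrow> real \<Rightarrow> (real \<times> real \<Rightarrow> real) set" where
  "H02 b T = {u \<in> sobolev 2 (rect b T).
     trace_y b T 0 u (\<lambda>_. 0) \<and> trace_y b T 0 (y_deriv b T u) (\<lambda>_. 0) \<and>
     trace_y b T b (y_deriv b T u) (\<lambda>_. 0)}"

definition H04 :: "real \<Rightarrow> real \<Rightarrow> (real \<times> real \<Rightarrow> real) set" where
  "H04 b T = sobolev 4 (rect b T) \<inter> H02 b T"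

abbreviation H4_inner where
  "H4_inner b T \<equiv> sobolev_inner 4 (rect b T)"

abbreviation H4_norm where
  "H4_norm b T \<equiv> sobolev_norm 4 (rect b T)"

definition data_ball ::
    "real \<Rightarrow> real \<Rightarrow> real \<Rightarrow> (real \<Rightarrow> real) \<Rightarrow> (real \<Rightarrow> real) \<Rightarrow> (real \<times> real \<Rightarrow> real) set" where
  "data_ball b T r q0 q1 = {u \<in> sobolev 4 (rect b T).
     trace_y b T 0 u q0 \<and> trace_y b T 0 (y_deriv b T u) q1 \<and>
     trace_y b T b (y_deriv b T u) (\<lambda>_. 0) \<and> H4_norm b T u < r}"

definition closed_data_ball ::
    "real \<Rightarrow> real \<Rightarrow> real \<Rightarrow> (real \<Rightarrow> real) \<Rightarrow> (real \<Rightarrow> real) \<Rightarrow> (real \<times> real \<Rightarrow> real) set" where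
  "closed_data_ball b T r q0 q1 = sobolev_closure 4 (rect b T) (data_ball b T r q0 q1)"


section \<open>The functional, its gradient, and gradient descent\<close>

definition carleman_weight :: "real \<Rightarrow> real \<Rightarrow> real \<times> real \<Rightarrow> real" where
  "carleman_weight \<beta> lam = (\<lambda>(y, t). exp (- 2 * lam * (y + \<beta> * t)))"

definition S_op :: "real \<Rightarrow> real \<Rightarrow> (real \<times> real \<Rightarrow> real) \<Rightarrow> real \<times> real \<Rightarrow> real" where
  "S_op b T V = (\<lambda>(y, t). pderiv b T 2 0 V (y, t) - 2 * pderiv b T 1 1 V (y, t)
     + 4 * initial_trace b T (y_deriv b T V) y * V (y, t))"

definition J_fun ::
    "real \<Rightarrow> real \<Rightarrow> real \<Rightarrow> real \<Rightarrow> real \<Rightarrow> (real \<times> real \<Rightarrow> real) \<Rightarrow> real" where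
  "J_fun b T \<beta> lam \<gamma> V =
     (LINT x:rect b T|lborel. (S_op b T V x)\<^sup>2 * carleman_weight \<beta> lam x)
     + \<gamma> * (H4_norm b T V)\<^sup>2"

text \<open>
  The Frechet derivative is taken along the directions in \<open>H\<^sub>0\<^sup>4(R)\<close> and is represented by an
  element of that space through the inner product of \<open>H\<^sup>4(R)\<close>.
\<close>

definition has_J_gradient ::
    "real \<Rightarrow> real \<Rightarrow> real \<Rightarrow> real \<Rightarrow> real \<Rightarrow> (real \<times> real \<Rightarrow> real) \<Rightarrow> (real \<times> real \<Rightarrow> real) \<Rightarrow> bool" where
  "has_J_gradient b T \<beta> lam \<gamma> V g \<longleftrightarrow> g \<in> H04 b T \<and>
     (\<forall>\<epsilon>>0. \<exists>\<delta>>0. \<forall>h\<in>H04 b T. H4_norm b T h < \<delta> \<longrightarrow>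
        \<bar>J_fun b T \<beta> lam \<gamma> (\<lambda>x. V x + h x) - J_fun b T \<beta> lam \<gamma> V - H4_inner b T g h\<bar>
          \<le> \<epsilon> * H4_norm b T h)"

definition J_gradient ::
    "real \<Rightarrow> real \<Rightarrow> real \<Rightarrow> real \<Rightarrow> real \<Rightarrow> (real \<times> real \<Rightarrow> real) \<Rightarrow> real \<times> real \<Rightarrow> real" where
  "J_gradient b T \<beta> lam \<gamma> V = (SOME g. has_J_gradient b T \<beta> lam \<gamma> V g)"

primrec descent ::
    "real \<Rightarrow> real \<Rightarrow> real \<Rightarrow> real \<Rightarrow> real \<Rightarrow> real \<Rightarrow> (real \<times> real \<Rightarrow> real) \<Rightarrow> nat \<Rightarrow> real \<times> real \<Rightarrow> real"
  where
  "descent b T \<beta> lam \<gamma> \<kappa> V0 0 = V0"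
| "descent b T \<beta> lam \<gamma> \<kappa> V0 (Suc n) =
     (\<lambda>x. descent b T \<beta> lam \<gamma> \<kappa> V0 n x - \<kappa> * J_gradient b T \<beta> lam \<gamma> (descent b T \<beta> lam \<gamma> \<kappa> V0 n) x)"

text \<open>
  The minimizer is unique as an element of \<open>H\<^sup>4(R)\<close>, hence almost everywhere.
\<close>

definition unique_minimizer ::
    "real \<Rightarrow> real \<Rightarrow> real \<Rightarrow> real \<Rightarrow> real \<Rightarrow> real \<Rightarrow> (real \<Rightarrow> real) \<Rightarrow> (real \<Rightarrow> real)
     \<Rightarrow> (real \<times> real \<Rightarrow> real) \<Rightarrow> bool" where
  "unique_minimizer b T \<beta> M lam \<gamma> q0 q1 V \<longleftrightarrow>
     is_arg_min (J_fun b T \<beta> lam \<gamma>) (\<lambda>W. W \<in> closed_data_ball b T M q0 q1) V \<and>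
     (\<forall>W. is_arg_min (J_fun b T \<beta> lam \<gamma>) (\<lambda>W. W \<in> closed_data_ball b T M q0 q1) W \<longrightarrow>
        (AE x in lborel. x \<in> rect b T \<longrightarrow> W x = V x))"

text \<open>
  The property that \<open>\<lambda>\<^sub>1\<close> has by its choice: strict convexity of the functionals for all
  \<open>\<lambda> \<ge> \<lambda>\<^sub>1\<close>, uniformly in the data \<open>q\<^sub>0, q\<^sub>1\<close>. The threshold \<open>\<lambda>\<^sub>0\<close> of the Carleman estimate
  enters only through \<open>\<lambda>\<^sub>1 \<ge> \<lambda>\<^sub>0 \<ge> 1\<close>; the estimate itself is not made part of the property.
\<close>

definition convexity_threshold :: "real \<Rightarrow> real \<Rightarrow> real \<Rightarrow> real \<Rightarrow> real \<Rightarrow> real \<Rightarrow> bool" where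
  "convexity_threshold b T \<beta> \<mu> M lam1 \<longleftrightarrow> 1 \<le> lam1 \<and>
     (\<exists>K>0. \<forall>q0 q1 lam \<gamma>. lam1 \<le> lam \<and> 2 * exp (- lam * \<beta> * T) \<le> \<gamma> \<and> \<gamma> < 1 \<longrightarrow>
       (\<forall>V1 \<in> closed_data_ball b T M q0 q1. \<forall>V2 \<in> closed_data_ball b T M q0 q1.
          J_fun b T \<beta> lam \<gamma> V2 - J_fun b T \<beta> lam \<gamma> V1
            - H4_inner b T (J_gradient b T \<beta> lam \<gamma> V1) (\<lambda>x. V2 x - V1 x)
          \<ge> K * exp (- 2 * lam * (2 * \<beta> * b - \<mu>)) *
              ((sobolev_norm 1 (subdomain \<beta> \<mu> b) (\<lambda>x. V2 x - V1 x))\<^sup>2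
               + (sobolev_norm 1 {0<..<2 * \<beta> * b - \<mu>}
                    (\<lambda>y. initial_trace b T V2 y - initial_trace b T V1 y))\<^sup>2)
            + \<gamma> / 2 * (H4_norm b T (\<lambda>x. V2 x - V1 x))\<^sup>2))"

end

theory Submission
  imports Defs
begin

text \<open>
  In terms of the Hilbert space structure of \<open>H\<^sup>4(R)\<close> the theorem is the usual convergence proof of
  gradient descent. The strict convexity of \<open>J\<close> on the ball makes its gradient strongly monotone
  with constant \<open>\<gamma>\<close>, the gradient is Lipschitz continuous on bounded sets with some constant \<open>L\<close>,
  and it vanishes at the minimiser because this lies in the interior of the ball. Hence a step
  multiplies the squared distance to the minimiser by at most
  \<open>1 - 2 \<kappa> \<gamma> + \<kappa>\<^sup>2 L\<^sup>2 \<le> 1 - \<kappa> \<gamma>\<close> when \<open>\<kappa> L\<^sup>2 \<le> \<gamma>\<close>. As the distances decrease and three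
  radii \<open>\<theta>0 M\<close> are less than \<open>M\<close>, no iterate leaves the ball. The conditions on the boundary data
  are preserved since the gradients lie in \<open>H\<^sub>0\<^sup>4(R)\<close>. This is carried out in \<open>descent_step\<close> and
  \<open>descent_converges\<close>.

  The work lies in showing that the gradient exists, represents the formal derivative of \<open>J\<close>, and is
  Lipschitz continuous. Here \<open>J\<close> is the energy of a residual that is the sum of a linear and a
  bilinear map on \<open>H\<^sup>4(R)\<close> with values in a weighted \<open>L\<^sup>2(R)\<close>; for such energies all this holds once
  the two maps are bounded and the space of perturbations is complete (the locale
  \<open>quadratic_residual\<close> and the representation theorem \<open>Riesz\<close>). Three analytic facts have to be
  supplied.

  Weak derivatives are unique almost everywhere, by testing with products of smooth bumps
  (\<open>AE_zero_if_test_integrals_zero\<close>). Sobolev spaces and the subspaces cut out by zero traces are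
  complete (\<open>sobolev_complete\<close>, \<open>H04_complete\<close>).

  The bilinear map contains the factor \<open>V\<^sub>y(y, 0)\<close>, a trace. A function in \<open>H\<^sup>2(R)\<close> coincides almost
  everywhere with an integral of its derivatives against bounded kernels, which is continuous and
  bounded by a multiple of the norm (\<open>representative_AE\<close>, \<open>representative_bound\<close>). Its boundary values are a
  trace, and they are the only one because the integral of a trace over any segment of the edge is
  determined by the function in the interior (\<open>trace_formula\<close>). Both facts come from integration by
  parts against piecewise linear tents, which are limits of test functions (\<open>test_limit_tent\<close>).
\<close>

section \<open>Smooth functions of one variable and limits of test functions\<close>

text \<open>
  With this recursion on the order of differentiation, closure under sums, products and affine
  substitutions is a direct induction on the order.
\<close>

primrec differentiable_times :: "nat \<Rightarrow> (real \<Rightarrow> real) \<Rightarrow> bool" where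
  "differentiable_times 0 f = True"
| "differentiable_times (Suc n) f =
     (\<exists>f'. (\<forall>x. (f has_real_derivative f' x) (at x)) \<and> differentiable_times n f')"

definition smooth :: "(real \<Rightarrow> real) \<Rightarrow> bool" where
  "smooth f \<longleftrightarrow> (\<forall>n. differentiable_times n f)"

lemma differentiable_times_Suc_D: "differentiable_times (Suc n) f \<Longrightarrow> differentiable_times n f"
proof (induction n arbitrary: f)
  case (Suc n)
  then obtain f' where "\<forall>x. (f has_real_derivative f' x) (at x)" "differentiable_times (Suc n) f'"
    by auto
  then show ?case using Suc.IH by (auto simp del: differentiable_times.simps(2)
    intro!: differentiable_times.simps(2)[THEN iffD2] exI[of _ f'])
qed simp

lemma differentiable_times_const: "differentiable_times n (\<lambda>_. c)"
  by (induction n arbitrary: c) (auto intro!: exI[of _ "\<lambda>_. 0"])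

lemma differentiable_times_add:
  "differentiable_times n f \<Longrightarrow> differentiable_times n g \<Longrightarrow> differentiable_times n (\<lambda>x. f x + g x)"
proof (induction n arbitrary: f g)
  case (Suc n)
  then obtain f' g' where "\<forall>x. (f has_real_derivative f' x) (at x)" "differentiable_times n f'"
     "\<forall>x. (g has_real_derivative g' x) (at x)" "differentiable_times n g'" by auto
  then show ?case using Suc.IH by (auto intro!: exI[of _ "\<lambda>x. f' x + g' x"] derivative_eq_intros)
qed simp

lemma differentiable_times_mult:
  "differentiable_times n f \<Longrightarrow> differentiable_times n g \<Longrightarrow> differentiable_times n (\<lambda>x. f x * g x)"
proof (induction n arbitrary: f g)
  case (Suc n)
  then obtain f' g' where fg: "\<forall>x. (f has_real_derivative f' x) (at x)" "differentiable_times n f'"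
     "\<forall>x. (g has_real_derivative g' x) (at x)" "differentiable_times n g'" by auto
  have "differentiable_times n (\<lambda>x. f' x * g x + f x * g' x)"
    using Suc.prems fg by (intro differentiable_times_add Suc.IH) (auto dest: differentiable_times_Suc_D
       simp del: differentiable_times.simps(2))
  then show ?case using fg
    by (auto intro!: exI[of _ "\<lambda>x. f' x * g x + f x * g' x"] derivative_eq_intros)
qed simp

lemma differentiable_times_affine:
  "differentiable_times n f \<Longrightarrow> differentiable_times n (\<lambda>x. f (a * x + c))"
proof (induction n arbitrary: f)
  case (Suc n)
  then obtain f' where f: "\<forall>x. (f has_real_derivative f' x) (at x)" "differentiable_times n f'" by auto
  have "((\<lambda>x. f (a * x + c)) has_real_derivative f' (a * x + c) * a) (at x)" for x
    by (rule DERIV_chain2[OF f(1)[rule_format]]) (auto intro!: derivative_eq_intros)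
  moreover have "differentiable_times n (\<lambda>x. f' (a * x + c) * a)"
    by (intro differentiable_times_mult differentiable_times_const Suc.IH f)
  ultimately show ?case
    unfolding differentiable_times.simps by (intro exI[of _ "\<lambda>x. f' (a * x + c) * a"]) auto
qed simp

lemma smooth_const: "smooth (\<lambda>_. c)"
  and smooth_add: "smooth f \<Longrightarrow> smooth g \<Longrightarrow> smooth (\<lambda>x. f x + g x)"
  and smooth_mult: "smooth f \<Longrightarrow> smooth g \<Longrightarrow> smooth (\<lambda>x. f x * g x)"
  and smooth_affine: "smooth f \<Longrightarrow> smooth (\<lambda>x. f (a * x + c))"
  unfolding smooth_def
  by (auto intro: differentiable_times_const differentiable_times_add differentiable_times_mult
      differentiable_times_affine)

lemma smooth_diff: "smooth f \<Longrightarrow> smooth g \<Longrightarrow> smooth (\<lambda>x. f x - g x)"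
  using smooth_add[OF _ smooth_mult[OF smooth_const[of "-1"]], of f g] by simp

lemma smooth_has_deriv: "smooth f \<Longrightarrow> (f has_real_derivative deriv f x) (at x)"
  unfolding smooth_def by (drule spec[of _ "Suc 0"]) (auto simp: DERIV_deriv_iff_real_differentiable real_differentiable_def)

lemma smooth_deriv: assumes "smooth f" shows "smooth (deriv f)"
  unfolding smooth_def
proof
  fix n
  from assms obtain f' where "\<forall>x. (f has_real_derivative f' x) (at x)" "differentiable_times n f'"
    unfolding smooth_def using differentiable_times.simps(2) by blast
  moreover from this have "deriv f = f'" by (auto simp: DERIV_imp_deriv)
  ultimately show "differentiable_times n (deriv f)" by simp
qed

lemma smooth_iterate_deriv: "smooth f \<Longrightarrow> smooth ((deriv ^^ k) f)"
  by (induction k) (auto intro: smooth_deriv)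

lemma smooth_primitive:
  assumes "\<And>x. (F has_real_derivative f x) (at x)" "smooth f"
  shows "smooth F"
  unfolding smooth_def
proof
  fix n show "differentiable_times n F"
    using assms by (cases n) (auto simp: smooth_def)
qed

lemma smooth_continuous: "smooth f \<Longrightarrow> continuous_on A f"
  using smooth_has_deriv by (meson DERIV_continuous_on has_field_derivative_at_within)

text \<open>
  This limit makes the right difference quotients at \<open>0\<close> of all functions of the next family vanish.
\<close>

lemma exp_inverse_flat: "((\<lambda>x::real. exp (- 1 / x) / x ^ k) \<longlongrightarrow> 0) (at_right 0)"
proof -
  have "((\<lambda>x. inverse x ^ k / exp (inverse x)) \<longlongrightarrow> (0::real)) (at_right 0)"
    by (rule filterlim_compose[OF tendsto_power_div_exp_0 filterlim_inverse_at_top_right])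
  then show ?thesis by (simp add: field_simps exp_minus)
qed

text \<open>
  The derivative of \<open>exp (- 1 / x) / x ^ k\<close> is a linear combination of two functions of the same
  form, so the whole family is smooth by a single induction.
\<close>

definition flat_exp :: "nat \<Rightarrow> real \<Rightarrow> real" where
  "flat_exp k x = (if x > 0 then exp (- 1 / x) / x ^ k else 0)"

lemma flat_exp_deriv:
  "(flat_exp k has_real_derivative flat_exp (k + 2) x - real k * flat_exp (k + 1) x) (at x)"
proof (cases x "0::real" rule: linorder_cases)
  case less
  have "((\<lambda>_. 0) has_real_derivative 0) (at x)" by simp
  then have "(flat_exp k has_real_derivative 0) (at x)"
    by (rule has_field_derivative_transform_within_open[where S = "{..<0}"])
      (use less in \<open>auto simp: flat_exp_def\<close>)
  then show ?thesis using less by (simp add: flat_exp_def)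
next
  case greater
  have "((\<lambda>x. exp (- 1 / x) / x ^ k) has_real_derivative
     (exp (- 1 / x) * (1 / x ^ 2) * x ^ k - exp (- 1 / x) * (real k * x ^ (k - 1))) / (x ^ k * x ^ k)) (at x)"
    using greater by (auto intro!: derivative_eq_intros simp: power2_eq_square)
  moreover have "(exp (- 1 / x) * (1 / x ^ 2) * x ^ k - exp (- 1 / x) * (real k * x ^ (k - 1))) / (x ^ k * x ^ k)
     = flat_exp (k + 2) x - real k * flat_exp (k + 1) x"
    using greater by (cases k) (auto simp: flat_exp_def field_simps power2_eq_square)
  ultimately have "((\<lambda>x. exp (- 1 / x) / x ^ k) has_real_derivative
     flat_exp (k + 2) x - real k * flat_exp (k + 1) x) (at x)" by simp
  then show ?thesis
    by (rule has_field_derivative_transform_within_open[where S = "{0<..}"])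
      (use greater in \<open>auto simp: flat_exp_def\<close>)
next
  case equal
  have "((\<lambda>h. (flat_exp k h - flat_exp k 0) / h) \<longlongrightarrow> 0) (at_right 0)"
    using exp_inverse_flat[of "Suc k"]
    by (rule Lim_transform_eventually)
      (auto simp: flat_exp_def eventually_at_right_less eventually_at_filter field_simps)
  moreover have "((\<lambda>h. (flat_exp k h - flat_exp k 0) / h) \<longlongrightarrow> 0) (at_left 0)"
    by (rule Lim_transform_eventually[OF tendsto_const])
      (auto simp: flat_exp_def eventually_at_filter)
  ultimately have "((\<lambda>h. (flat_exp k h - flat_exp k 0) / h) \<longlongrightarrow> 0) (at 0)"
    by (simp add: filterlim_split_at)
  then show ?thesis using equal
    by (simp add: has_field_derivative_iff flat_exp_def)
qed

lemma smooth_flat_exp: "smooth (flat_exp k)"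
proof -
  have "\<forall>k. differentiable_times n (flat_exp k)" for n
  proof (induction n)
    case (Suc n)
    have "differentiable_times n (\<lambda>x. flat_exp (k + 2) x + (- real k) * flat_exp (k + 1) x)" for k
      using Suc by (intro differentiable_times_add differentiable_times_mult differentiable_times_const) auto
    then show ?case using flat_exp_deriv by (auto intro!: exI)
  qed simp
  then show ?thesis by (simp add: smooth_def)
qed

text \<open>
  The factor \<open>n\<close> steepens both flanks, so that the bumps tend to the indicator function of the
  interval; the summand \<open>-1\<close> keeps their supports away from its end points. For small \<open>n\<close> the
  bump is identically zero.
\<close>

definition bump :: "real \<Rightarrow> real \<Rightarrow> nat \<Rightarrow> real \<Rightarrow> real" where
  "bump a b n x = flat_exp 0 (real n * (x - a) - 1) * flat_exp 0 (real n * (b - x) - 1)"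

lemma smooth_bump: "smooth (bump a b n)"
proof -
  have "bump a b n = (\<lambda>x. flat_exp 0 (real n * x + (- real n * a - 1)) * flat_exp 0 ((- real n) * x + (real n * b - 1)))"
    by (auto simp: bump_def algebra_simps)
  then show ?thesis by (simp only:) (intro smooth_mult smooth_affine smooth_flat_exp)
qed

lemma flat_exp_0_bounds: "0 \<le> flat_exp 0 x" "flat_exp 0 x \<le> 1"
  by (auto simp: flat_exp_def)

lemma bump_bounds: "0 \<le> bump a b n x" "bump a b n x \<le> 1"
  using flat_exp_0_bounds by (auto simp: bump_def intro!: mult_le_one mult_nonneg_nonneg)

lemma bump_support:
  assumes "bump a b n x \<noteq> 0"
  shows "n > 0" "a + 1 / real n < x" "x < b - 1 / real n"
proof -
  have *: "real n * (x - a) - 1 > 0" "real n * (b - x) - 1 > 0"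
    using assms by (auto simp: bump_def flat_exp_def split: if_splits)
  then show n: "n > 0" by (cases n) auto
  show "a + 1 / real n < x" "x < b - 1 / real n" using * n by (auto simp: field_simps)
qed

lemma flat_exp_0_at_top: "(flat_exp 0 \<longlongrightarrow> 1) at_top"
proof -
  have "((\<lambda>x::real. exp (- (inverse x))) \<longlongrightarrow> exp (- 0)) at_top"
    by (intro tendsto_intros tendsto_inverse_0_at_top filterlim_ident)
  moreover have "\<forall>\<^sub>F x in at_top. exp (- (inverse x)) = flat_exp 0 x"
    using eventually_gt_at_top[of 0] by eventually_elim (simp add: flat_exp_def field_simps)
  ultimately show ?thesis by (auto intro: Lim_transform_eventually)
qed

lemma bump_tendsto: "(\<lambda>n. bump a b n x) \<longlonglongrightarrow> indicator {a<..<b} x"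
proof (cases "a < x \<and> x < b")
  case True
  have lim: "(\<lambda>n. flat_exp 0 (real n * d - 1)) \<longlonglongrightarrow> 1" if "d > 0" for d :: real
  proof -
    have "filterlim (\<lambda>n. -1 + d * real n) at_top sequentially"
      by (rule filterlim_tendsto_add_at_top[OF tendsto_const])
        (rule filterlim_tendsto_pos_mult_at_top[OF tendsto_const that filterlim_real_sequentially])
    then have "filterlim (\<lambda>n. real n * d - 1) at_top sequentially"
      by (simp add: mult.commute)
    then show ?thesis by (rule filterlim_compose[OF flat_exp_0_at_top])
  qed
  have "(\<lambda>n. bump a b n x) \<longlonglongrightarrow> 1 * 1"
    unfolding bump_def using True by (intro tendsto_mult lim) auto
  then show ?thesis using True by simp
next
  case False
  have "bump a b n x = 0" for n
  proof (rule ccontr)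
    assume "bump a b n x \<noteq> 0"
    from bump_support[OF this] False show False
      by (smt (verit) divide_nonneg_nonneg of_nat_0_le_iff)
  qed
  then show ?thesis using False by (auto simp: indicator_def)
qed

lemma bump_integrable: "integrable lborel (bump a b n)"
proof -
  have "integrable lborel (\<lambda>x. indicator {a..b} x *\<^sub>R bump a b n x)"
    using borel_integrable_compact[OF compact_Icc smooth_continuous[OF smooth_bump]]
    by (simp add: indicator_def cond_case_prod_eta if_distrib cong: if_cong)
  moreover have "(\<lambda>x. indicator {a..b} x *\<^sub>R bump a b n x) = bump a b n"
  proof
    fix x show "indicator {a..b} x *\<^sub>R bump a b n x = bump a b n x"
    proof (cases "bump a b n x = 0")
      case False
      from bump_support[OF this] have "a \<le> x" "x \<le> b"
        by (smt (verit) divide_nonneg_nonneg of_nat_0_le_iff)+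
      then show ?thesis by simp
    qed simp
  qed
  ultimately show ?thesis by simp
qed

lemma bump_le_indicator: "bump a b n x \<le> indicator {a<..<b} x"
proof (cases "bump a b n x = 0")
  case False
  from bump_support[OF this] have "a < x" "x < b"
    by (smt (verit) divide_nonneg_nonneg of_nat_0_le_iff)+
  then show ?thesis using bump_bounds[of a b n x] by simp
qed (simp add: indicator_def)

lemma bump_integral_tendsto:
  assumes "S \<in> sets lborel"
  shows "(\<lambda>n. LINT x:S|lborel. bump a b n x) \<longlonglongrightarrow> measure lborel ({a<..<b} \<inter> S)"
proof -
  note assms[measurable]
  have [measurable]: "bump a b n \<in> borel_measurable borel" for n
    using smooth_continuous[OF smooth_bump] by (rule borel_measurable_continuous_onI)
  have "(\<lambda>n. LINT x|lborel. indicator S x *\<^sub>R bump a b n x)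
      \<longlonglongrightarrow> (LINT x|lborel. indicator S x *\<^sub>R indicator {a<..<b} x)"
  proof (rule integral_dominated_convergence[where w = "indicator {a<..<b}"])
    show "AE x in lborel. (\<lambda>n. indicator S x *\<^sub>R bump a b n x)
       \<longlonglongrightarrow> indicator S x *\<^sub>R (indicator {a<..<b} x :: real)"
      by (intro AE_I2 tendsto_intros bump_tendsto)
    show "AE x in lborel. norm (indicator S x *\<^sub>R bump a b n x) \<le> indicator {a<..<b} x" for n
    proof (rule AE_I2)
      fix x show "norm (indicator S x *\<^sub>R bump a b n x) \<le> indicator {a<..<b} x"
        using bump_le_indicator[of a b n x] bump_bounds(1)[of a b n x]
        by (cases "x \<in> S") auto
    qed
    show "integrable lborel (indicator {a<..<b} :: real \<Rightarrow> real)"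
      by (cases "a \<le> b") (auto simp: integrable_indicator_iff emeasure_lborel_Ioo)
  qed auto
  also have "(\<lambda>x. indicator S x *\<^sub>R (indicator {a<..<b} x :: real)) = indicator ({a<..<b} \<inter> S)"
    by (auto simp: indicator_def)
  finally show ?thesis by (simp add: set_lebesgue_integral_def)
qed

text \<open>
  Locally, the set integral over a half line is an interval integral from a point to the left of
  the support, so the fundamental theorem of calculus applies.
\<close>

lemma primitive_of_compactly_supported:
  fixes f :: "real \<Rightarrow> real"
  assumes cont: "continuous_on UNIV f" and supp: "\<And>x. f x \<noteq> 0 \<Longrightarrow> c \<le> x \<and> x \<le> d"
  shows "((\<lambda>s. LINT x:{..<s}|lborel. f x) has_real_derivative f s) (at s)"
proof -
  define p where "p = min c s - 1"
  define q where "q = s + 1"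
  have int: "(LINT x:{..<u}|lborel. f x) = (LBINT x=p..u. f x)" if "p \<le> u" for u
  proof -
    have "(LBINT x=p..u. f x) = (LINT x|lborel. indicator {p<..<u} x *\<^sub>R f x)"
      using that by (simp add: interval_lebesgue_integral_def set_lebesgue_integral_def einterval_eq)
    also have "(\<lambda>x. indicator {p<..<u} x *\<^sub>R f x) = (\<lambda>x. indicator {..<u} x *\<^sub>R f x)"
    proof
      fix x show "indicator {p<..<u} x *\<^sub>R f x = indicator {..<u} x *\<^sub>R f x"
        using supp[of x] by (cases "f x = 0") (auto simp: indicator_def p_def)
    qed
    finally show ?thesis by (simp add: set_lebesgue_integral_def)
  qed
  have "((\<lambda>u. LBINT x=p..u. f x) has_vector_derivative f s) (at s within {p..q})"
    by (rule interval_integral_FTC2)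
      (use continuous_on_subset[OF cont] in \<open>auto simp: p_def q_def\<close>)
  then have "((\<lambda>u. LBINT x=p..u. f x) has_real_derivative f s) (at s)"
    using at_within_Icc_at[of p s q]
    by (auto simp: has_real_derivative_iff_has_vector_derivative p_def q_def)
  then show ?thesis
    by (rule has_field_derivative_transform_within_open[where S = "{p<..<q}"])
      (auto simp: int p_def q_def)
qed

text \<open>
  Pairs that are bounded pointwise limits of test functions and of their derivatives. An
  integration by parts formula for test functions passes to such pairs by dominated convergence.
\<close>

definition test_limit :: "real \<Rightarrow> nat \<Rightarrow> (real \<Rightarrow> real) \<Rightarrow> (real \<Rightarrow> real) \<Rightarrow> bool" where
  "test_limit L k f g \<longleftrightarrow> (\<exists>\<psi> B. \<forall>n. smooth (\<psi> n) \<and>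
     (\<exists>c d. 0 < c \<and> d < L \<and> (\<forall>x. \<psi> n x \<noteq> 0 \<longrightarrow> c \<le> x \<and> x \<le> d)) \<and>
     (\<forall>x. \<bar>\<psi> n x\<bar> \<le> B \<and> \<bar>(deriv ^^ k) (\<psi> n) x\<bar> \<le> B) \<and>
     (\<forall>x. 0 < x \<and> x < L \<longrightarrow> (\<lambda>n. \<psi> n x) \<longlonglongrightarrow> f x \<and> (\<lambda>n. (deriv ^^ k) (\<psi> n) x) \<longlonglongrightarrow> g x))"

lemma test_limitI:
  assumes "\<And>n. smooth (\<psi> n)"
    and "\<And>n. \<exists>c d. 0 < c \<and> d < L \<and> (\<forall>x. \<psi> n x \<noteq> 0 \<longrightarrow> c \<le> x \<and> x \<le> d)"
    and "\<And>n x. \<bar>\<psi> n x\<bar> \<le> B" "\<And>n x. \<bar>(deriv ^^ k) (\<psi> n) x\<bar> \<le> B"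
    and "\<And>x. 0 < x \<Longrightarrow> x < L \<Longrightarrow> (\<lambda>n. \<psi> n x) \<longlonglongrightarrow> f x"
    and "\<And>x. 0 < x \<Longrightarrow> x < L \<Longrightarrow> (\<lambda>n. (deriv ^^ k) (\<psi> n) x) \<longlonglongrightarrow> g x"
  shows "test_limit L k f g"
  unfolding test_limit_def using assms by blast

lemma bump_compact_support:
  assumes "0 \<le> a" "b \<le> L"
  obtains c d where "0 < c" "d < L" "\<And>x. bump a b n x \<noteq> 0 \<Longrightarrow> c \<le> x \<and> x \<le> d"
proof (cases "n = 0")
  case True
  then show ?thesis using bump_support(1)[of a b n] by (intro that[of 1 "L - 1"]) auto
next
  case False
  have "1 / real n \<le> x \<and> x \<le> L - 1 / real n" if "bump a b n x \<noteq> 0" for x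
    using bump_support(2,3)[OF that] assms by linarith
  then show ?thesis using False by (intro that[of "1 / real n" "L - 1 / real n"]) auto
qed

lemma test_limit_indicator:
  assumes "0 \<le> a" "b \<le> L"
  shows "test_limit L 0 (indicator {a<..<b}) (indicator {a<..<b})"
proof (rule test_limitI[where \<psi> = "bump a b" and B = 1])
  fix n
  show "\<exists>c d. 0 < c \<and> d < L \<and> (\<forall>x. bump a b n x \<noteq> 0 \<longrightarrow> c \<le> x \<and> x \<le> d)"
    by (rule bump_compact_support[OF assms, of n]) blast
qed (use bump_bounds bump_tendsto in \<open>auto intro: smooth_bump\<close>)

text \<open>
  On \<open>[0, L]\<close> this is the function with zero boundary values whose derivative is the indicator
  function of \<open>(a, b)\<close> minus its mean.
\<close>

definition tent :: "real \<Rightarrow> real \<Rightarrow> real \<Rightarrow> real \<Rightarrow> real" where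
  "tent L a b s = measure lborel ({a<..<b} \<inter> {..<s}) - s * (b - a) / L"

text \<open>
  A primitive of a bump is not compactly supported in \<open>(0, L)\<close>, because in general
  the integral of the bump is positive. Subtracting the right multiple \<open>r\<close> of the bump over all of \<open>(0, L)\<close> makes the total
  integral zero; in the limit this multiple becomes the mean \<open>(b - a) / L\<close> of the
  indicator function.
\<close>

lemma test_limit_tent:
  assumes "0 \<le> a" "a < b" "b \<le> L"
  shows "test_limit L 1 (tent L a b) (\<lambda>x. indicator {a<..<b} x - (b - a) / L)"
proof -
  have L: "L > 0" using assms by linarith
  define I where "I n = (LINT x|lborel. bump a b n x)" for n
  define J where "J n = (LINT x|lborel. bump 0 L n x)" for n
  have I: "I \<longlonglongrightarrow> b - a" and J: "J \<longlonglongrightarrow> L"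
    using bump_integral_tendsto[of UNIV a b] bump_integral_tendsto[of UNIV 0 L] assms L
    by (simp_all add: I_def[abs_def] J_def[abs_def] set_lebesgue_integral_def)
  \<comment> \<open>Only from \<open>N\<close> on does the bump over \<open>(0, L)\<close> have positive integral, so that dividing by it makes sense.\<close>
  then obtain N where N: "\<And>n. n \<ge> N \<Longrightarrow> J n > 0"
    using L order_tendstoD(1)[OF J L] by (auto simp: eventually_sequentially)
  define r where "r n = I n / J n" for n
  have r: "r \<longlonglongrightarrow> (b - a) / L"
    unfolding r_def using I J L by (intro tendsto_divide) auto
  then obtain C where C: "\<And>n. \<bar>r n\<bar> \<le> C"
    using convergent_imp_Bseq[OF convergentI] by (metis Bseq_def real_norm_def)
  then have C0: "0 \<le> C" by (meson abs_ge_zero order_trans)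
  define f where "f n x = bump a b n x - r n * bump 0 L n x" for n x
  define F where "F n s = (LINT x:{..<s}|lborel. f n x)" for n s
  have smf: "smooth (f n)" for n
    unfolding f_def[abs_def] by (intro smooth_diff smooth_mult smooth_const smooth_bump)
  have suppf: "\<exists>c d. 0 < c \<and> d < L \<and> (\<forall>x. f n x \<noteq> 0 \<longrightarrow> c \<le> x \<and> x \<le> d)" for n
  proof -
    obtain c d where 1: "0 < c" "d < L" "\<And>x. bump a b n x \<noteq> 0 \<Longrightarrow> c \<le> x \<and> x \<le> d"
      by (rule bump_compact_support[OF assms(1,3), of n]) blast
    obtain c' d' where 2: "0 < c'" "d' < L" "\<And>x. bump 0 L n x \<noteq> 0 \<Longrightarrow> c' \<le> x \<and> x \<le> d'"
      by (rule bump_compact_support[OF order_refl order_refl, of L n]) blast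
    have "min c c' \<le> x \<and> x \<le> max d d'" if "f n x \<noteq> 0" for x
    proof -
      have "bump a b n x \<noteq> 0 \<or> bump 0 L n x \<noteq> 0" using that by (auto simp: f_def)
      then show ?thesis using 1(3)[of x] 2(3)[of x] by linarith
    qed
    then show ?thesis using 1(1,2) 2(1,2)
      by (intro exI[of _ "min c c'"] exI[of _ "max d d'"]) auto
  qed
  have deriv_F: "(F n has_real_derivative f n s) (at s)" for n s
    using suppf[of n] primitive_of_compactly_supported[OF smooth_continuous[OF smf[of n]]]
    unfolding F_def by blast
  have smF: "smooth (F n)" for n
    using smooth_primitive[OF deriv_F smf] .
  have intf: "integrable lborel (f n)" for n
    unfolding f_def[abs_def] by (intro Bochner_Integration.integrable_diff integrable_mult_right bump_integrable)
  have F_split: "F n s = (LINT x:{..<s}|lborel. bump a b n x) - r n * (LINT x:{..<s}|lborel. bump 0 L n x)"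
    and part: "0 \<le> (LINT x:{..<s}|lborel. bump a b n x)" "(LINT x:{..<s}|lborel. bump a b n x) \<le> L"
      "0 \<le> (LINT x:{..<s}|lborel. bump 0 L n x)" "(LINT x:{..<s}|lborel. bump 0 L n x) \<le> L" for n s
  proof -
    have si: "set_integrable lborel {..<s} (bump p q n)" for p q
      unfolding set_integrable_def by (intro integrable_mult_indicator bump_integrable) auto
    show "F n s = (LINT x:{..<s}|lborel. bump a b n x) - r n * (LINT x:{..<s}|lborel. bump 0 L n x)"
      unfolding F_def f_def using si by (subst set_integral_diff) auto
    have le: "(LINT x:{..<s}|lborel. bump p q n x) \<le> L" if "p \<le> q" "q - p \<le> L" for p q
    proof -
      have "(LINT x:{..<s}|lborel. bump p q n x) \<le> (LINT x|lborel. indicator {p<..<q} x)"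
        unfolding set_lebesgue_integral_def
      proof (rule integral_mono)
        fix x show "indicator {..<s} x *\<^sub>R bump p q n x \<le> indicator {p<..<q} x"
          using bump_le_indicator[of p q n x] bump_bounds(1)[of p q n x]
          by (cases "x < s") auto
        show "integrable lborel (\<lambda>x. indicator {..<s} x *\<^sub>R bump p q n x)"
          by (intro integrable_mult_indicator bump_integrable) auto
      qed (auto simp: integrable_indicator_iff emeasure_lborel_Ioo that)
      then show ?thesis using that by simp
    qed
    show "(LINT x:{..<s}|lborel. bump a b n x) \<le> L" "(LINT x:{..<s}|lborel. bump 0 L n x) \<le> L"
      using assms L by (auto intro: le)
    show "0 \<le> (LINT x:{..<s}|lborel. bump a b n x)" "0 \<le> (LINT x:{..<s}|lborel. bump 0 L n x)"
      unfolding set_lebesgue_integral_def by (auto intro!: integral_nonneg_AE simp: bump_bounds)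
  qed
  have suppF: "\<exists>c d. 0 < c \<and> d < L \<and> (\<forall>x. F n x \<noteq> 0 \<longrightarrow> c \<le> x \<and> x \<le> d)" if "n \<ge> N" for n
  proof -
    obtain c d where cd: "0 < c" "d < L" "\<And>x. f n x \<noteq> 0 \<Longrightarrow> c \<le> x \<and> x \<le> d"
      using suppf[of n] by auto
    have "F n x = 0" if "x < c" for x
    proof -
      have "indicator {..<x} t *\<^sub>R f n t = 0" for t
        using cd(3)[of t] that by (cases "f n t = 0") (auto simp: indicator_def)
      then show ?thesis by (simp only: F_def set_lebesgue_integral_def integral_zero)
    qed
    moreover have "F n x = 0" if "d < x" for x
    proof -
      have "indicator {..<x} t *\<^sub>R f n t = f n t" for t
        using cd(3)[of t] that by (cases "f n t = 0") (auto simp: indicator_def)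
      then have "F n x = (LINT t|lborel. f n t)" by (simp only: F_def set_lebesgue_integral_def)
      also have "\<dots> = I n - r n * J n"
        unfolding f_def I_def J_def
        by (subst Bochner_Integration.integral_diff) (auto intro: bump_integrable)
      also have "\<dots> = 0" using N[OF \<open>n \<ge> N\<close>] by (simp add: r_def)
      finally show ?thesis .
    qed
    ultimately show ?thesis using cd(1,2) by (meson not_le)
  qed
  have boundf: "\<bar>f n x\<bar> \<le> 1 + C" for n x
  proof -
    have "\<bar>f n x\<bar> \<le> \<bar>bump a b n x\<bar> + \<bar>r n\<bar> * \<bar>bump 0 L n x\<bar>"
      unfolding f_def by (metis abs_mult abs_triangle_ineq4)
    also have "\<dots> \<le> 1 + C * 1"
      using bump_bounds C C0 by (intro add_mono mult_mono) auto
    finally show ?thesis by simp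
  qed
  have boundF: "\<bar>F n x\<bar> \<le> L + C * L" for n x
  proof -
    have "\<bar>F n x\<bar> \<le> \<bar>LINT x:{..<x}|lborel. bump a b n x\<bar> + \<bar>r n\<bar> * \<bar>LINT x:{..<x}|lborel. bump 0 L n x\<bar>"
      unfolding F_split by (metis abs_mult abs_triangle_ineq4)
    also have "\<dots> \<le> L + C * L"
      using part[of x n] C[of n] C0 by (intro add_mono mult_mono) auto
    finally show ?thesis .
  qed
  have limf: "(\<lambda>n. f n x) \<longlonglongrightarrow> indicator {a<..<b} x - (b - a) / L" if "0 < x" "x < L" for x
  proof -
    have "(\<lambda>n. f n x) \<longlonglongrightarrow> indicator {a<..<b} x - (b - a) / L * indicator {0<..<L} x"
      unfolding f_def by (intro tendsto_intros r bump_tendsto)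
    then show ?thesis using that by simp
  qed
  have limF: "(\<lambda>n. F n x) \<longlonglongrightarrow> tent L a b x" if "0 < x" "x < L" for x
  proof -
    have "(\<lambda>n. F n x) \<longlonglongrightarrow> measure lborel ({a<..<b} \<inter> {..<x})
        - (b - a) / L * measure lborel ({0<..<L} \<inter> {..<x})"
      unfolding F_split by (intro tendsto_intros r bump_integral_tendsto) auto
    moreover have "{0<..<L} \<inter> {..<x} = {0<..<x}" using that by auto
    ultimately show ?thesis using that by (simp add: tent_def mult.commute)
  qed
  have dF: "deriv (F n) = f n" for n
    using deriv_F by (auto intro: DERIV_imp_deriv)
  show ?thesis
  proof (rule test_limitI[where \<psi> = "\<lambda>n. F (n + N)" and B = "max (1 + C) (L + C * L)"])
    fix n x
    show "\<bar>F (n + N) x\<bar> \<le> max (1 + C) (L + C * L)" using boundF[of "n + N" x] by auto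
    show "\<bar>(deriv ^^ 1) (F (n + N)) x\<bar> \<le> max (1 + C) (L + C * L)"
      using boundf[of "n + N" x] by (auto simp: dF)
    show "smooth (F (n + N))" by (rule smF)
    show "\<exists>c d. 0 < c \<and> d < L \<and> (\<forall>x. F (n + N) x \<noteq> 0 \<longrightarrow> c \<le> x \<and> x \<le> d)"
      using suppF by auto
  next
    fix x assume x: "0 < x" "x < L"
    show "(\<lambda>n. F (n + N) x) \<longlonglongrightarrow> tent L a b x"
      using LIMSEQ_ignore_initial_segment[OF limF[OF x]] .
    show "(\<lambda>n. (deriv ^^ 1) (F (n + N)) x) \<longlonglongrightarrow> indicator {a<..<b} x - (b - a) / L"
      using LIMSEQ_ignore_initial_segment[OF limf[OF x]] by (simp add: dF)
  qed
qed

section \<open>Semi-inner product spaces of functions\<close>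

text \<open>
  Elements of a Sobolev space are represented by functions, and a function that vanishes almost
  everywhere has norm zero. The form is therefore only positive semidefinite, and the space is a set
  of functions with pointwise operations.
\<close>

locale semi_inner_space =
  fixes S :: "('a \<Rightarrow> real) set" and ip :: "('a \<Rightarrow> real) \<Rightarrow> ('a \<Rightarrow> real) \<Rightarrow> real"
  assumes zero_mem: "(\<lambda>_. 0) \<in> S"
    and lincomb_mem: "u \<in> S \<Longrightarrow> v \<in> S \<Longrightarrow> (\<lambda>x. u x + c * v x) \<in> S"
    and ip_commute: "u \<in> S \<Longrightarrow> v \<in> S \<Longrightarrow> ip u v = ip v u"
    and ip_nonneg: "u \<in> S \<Longrightarrow> 0 \<le> ip u u"
    and ip_lincomb: "u \<in> S \<Longrightarrow> v \<in> S \<Longrightarrow> w \<in> S \<Longrightarrow> ip (\<lambda>x. u x + c * v x) w = ip u w + c * ip v w"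
begin

definition nrm :: "('a \<Rightarrow> real) \<Rightarrow> real" where "nrm u = sqrt (ip u u)"

lemma add_mem: "u \<in> S \<Longrightarrow> v \<in> S \<Longrightarrow> (\<lambda>x. u x + v x) \<in> S"
  using lincomb_mem[of u v 1] by simp

lemma diff_mem: "u \<in> S \<Longrightarrow> v \<in> S \<Longrightarrow> (\<lambda>x. u x - v x) \<in> S"
  using lincomb_mem[of u v "-1"] by simp

lemma cmult_mem: "u \<in> S \<Longrightarrow> (\<lambda>x. c * u x) \<in> S"
  using lincomb_mem[OF zero_mem, of u c] by simp

lemma ip_add: "u \<in> S \<Longrightarrow> v \<in> S \<Longrightarrow> w \<in> S \<Longrightarrow> ip (\<lambda>x. u x + v x) w = ip u w + ip v w"
  using ip_lincomb[of u v w 1] by simp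

lemma ip_diff: "u \<in> S \<Longrightarrow> v \<in> S \<Longrightarrow> w \<in> S \<Longrightarrow> ip (\<lambda>x. u x - v x) w = ip u w - ip v w"
  using ip_lincomb[of u v w "-1"] by simp

lemma ip_zero: "w \<in> S \<Longrightarrow> ip (\<lambda>_. 0) w = 0"
  using ip_lincomb[OF zero_mem zero_mem, of w 1] by simp

lemma ip_cmult: "u \<in> S \<Longrightarrow> w \<in> S \<Longrightarrow> ip (\<lambda>x. c * u x) w = c * ip u w"
  using ip_lincomb[OF zero_mem, of u w c] ip_zero by simp

lemma ip_lincomb2: "u \<in> S \<Longrightarrow> v \<in> S \<Longrightarrow> w \<in> S \<Longrightarrow> ip w (\<lambda>x. u x + c * v x) = ip w u + c * ip w v"
  using ip_lincomb[of u v w c] by (simp add: ip_commute lincomb_mem)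

lemma ip_add2: "u \<in> S \<Longrightarrow> v \<in> S \<Longrightarrow> w \<in> S \<Longrightarrow> ip w (\<lambda>x. u x + v x) = ip w u + ip w v"
  using ip_lincomb2[of u v w 1] by simp

lemma ip_cmult2: "u \<in> S \<Longrightarrow> w \<in> S \<Longrightarrow> ip w (\<lambda>x. c * u x) = c * ip w u"
  using ip_cmult[of u w c] by (simp add: ip_commute cmult_mem)

lemma nrm_square: "u \<in> S \<Longrightarrow> (nrm u)\<^sup>2 = ip u u"
  by (simp add: nrm_def ip_nonneg)

lemma nrm_nonneg: "u \<in> S \<Longrightarrow> 0 \<le> nrm u"
  by (simp add: nrm_def ip_nonneg)

lemma nrm_zero: "nrm (\<lambda>_. 0) = 0"
  by (simp add: nrm_def ip_zero zero_mem)

lemma ip_expand: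
  "u \<in> S \<Longrightarrow> v \<in> S \<Longrightarrow> ip (\<lambda>x. u x + c * v x) (\<lambda>x. u x + c * v x) = ip u u + 2 * c * ip u v + c\<^sup>2 * ip v v"
  by (simp add: ip_lincomb ip_lincomb2 lincomb_mem ip_commute[of v u] power2_eq_square algebra_simps)

lemma Cauchy_Schwarz:
  assumes u: "u \<in> S" and v: "v \<in> S"
  shows "\<bar>ip u v\<bar> \<le> nrm u * nrm v"
proof -
  have quad: "0 \<le> ip u u + 2 * c * ip u v + c\<^sup>2 * ip v v" for c
    using ip_nonneg[OF lincomb_mem[OF u v, of c]] by (simp add: ip_expand u v)
  have "(ip u v)\<^sup>2 \<le> ip u u * ip v v"
  proof (cases "ip v v = 0")
    case True
    have "ip u v = 0"
    proof (rule ccontr)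
      assume "ip u v \<noteq> 0"
      with quad[of "- (ip u u + 1) / (2 * ip u v)"] True show False by (simp add: field_simps)
    qed
    then show ?thesis using True by simp
  next
    case False
    then have pos: "0 < ip v v" using ip_nonneg[OF v] by simp
    with quad[of "- ip u v / ip v v"] have "0 \<le> ip u u - (ip u v)\<^sup>2 / ip v v"
      by (simp add: field_simps power2_eq_square)
    then show ?thesis using pos by (simp add: field_simps)
  qed
  then have "sqrt ((ip u v)\<^sup>2) \<le> sqrt (ip u u * ip v v)" by (rule real_sqrt_le_mono)
  then show ?thesis by (simp add: nrm_def real_sqrt_mult)
qed

lemma nrm_cmult: "u \<in> S \<Longrightarrow> nrm (\<lambda>x. c * u x) = \<bar>c\<bar> * nrm u"
  by (simp add: nrm_def ip_cmult ip_cmult2 cmult_mem real_sqrt_mult mult.assoc[symmetric])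

lemma nrm_triangle:
  assumes u: "u \<in> S" and v: "v \<in> S"
  shows "nrm (\<lambda>x. u x + v x) \<le> nrm u + nrm v"
proof (rule power2_le_imp_le)
  have "(nrm (\<lambda>x. u x + v x))\<^sup>2 = ip u u + 2 * ip u v + ip v v"
    using ip_expand[OF u v, of 1] by (simp add: nrm_square add_mem u v)
  also have "\<dots> \<le> (nrm u)\<^sup>2 + 2 * (nrm u * nrm v) + (nrm v)\<^sup>2"
    using Cauchy_Schwarz[OF u v] by (simp add: nrm_square u v)
  also have "\<dots> = (nrm u + nrm v)\<^sup>2" by (simp add: power2_sum)
  finally show "(nrm (\<lambda>x. u x + v x))\<^sup>2 \<le> (nrm u + nrm v)\<^sup>2" .
qed (use u v in \<open>simp add: nrm_nonneg\<close>)

lemma nrm_minus_commute: "u \<in> S \<Longrightarrow> v \<in> S \<Longrightarrow> nrm (\<lambda>x. u x - v x) = nrm (\<lambda>x. v x - u x)"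
  using nrm_cmult[OF diff_mem, of v u "-1"] by simp

lemma nrm_diff_triangle:
  "u \<in> S \<Longrightarrow> v \<in> S \<Longrightarrow> w \<in> S \<Longrightarrow> nrm (\<lambda>x. u x - w x) \<le> nrm (\<lambda>x. u x - v x) + nrm (\<lambda>x. v x - w x)"
  using nrm_triangle[OF diff_mem diff_mem, of u v v w] by simp

lemma nrm_diff_le: "u \<in> S \<Longrightarrow> v \<in> S \<Longrightarrow> nrm (\<lambda>x. u x - v x) \<le> nrm u + nrm v"
  using nrm_triangle[OF _ cmult_mem, of u v "-1"] nrm_cmult[of v "-1"] by simp

text \<open>
  One step of gradient descent contracts: in the expansion of the square, strong monotonicity
  contributes \<open>- 2 \<kappa> \<gamma>\<close>, and the Lipschitz bound together with the smallness of \<open>\<kappa>\<close> keeps the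
  quadratic term below \<open>\<kappa> \<gamma>\<close>.
\<close>

lemma descent_step:
  assumes e: "e \<in> S" and g: "g \<in> S"
    and monotone: "\<gamma> * (nrm e)\<^sup>2 \<le> ip g e" and Lip: "nrm g \<le> L * nrm e"
    and \<kappa>: "0 < \<kappa>" "\<kappa> * L\<^sup>2 \<le> \<gamma>" "\<kappa> * \<gamma> \<le> 1"
  shows "nrm (\<lambda>x. e x - \<kappa> * g x) \<le> sqrt (1 - \<kappa> * \<gamma>) * nrm e"
proof (rule power2_le_imp_le)
  have d: "(\<lambda>x. e x - \<kappa> * g x) \<in> S" using diff_mem[OF e cmult_mem[OF g]] .
  have "(nrm (\<lambda>x. e x - \<kappa> * g x))\<^sup>2 = (nrm e)\<^sup>2 - 2 * \<kappa> * ip g e + \<kappa>\<^sup>2 * (nrm g)\<^sup>2"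
    using ip_expand[OF e g, of "- \<kappa>"] by (simp add: nrm_square d e g ip_commute[OF e g])
  also have "\<dots> \<le> (nrm e)\<^sup>2 - 2 * \<kappa> * (\<gamma> * (nrm e)\<^sup>2) + \<kappa> * (\<gamma> * (nrm e)\<^sup>2)"
  proof -
    have "(nrm g)\<^sup>2 \<le> (L * nrm e)\<^sup>2" using Lip nrm_nonneg[OF g] by (rule power_mono)
    then have "\<kappa>\<^sup>2 * (nrm g)\<^sup>2 \<le> \<kappa>\<^sup>2 * (L * nrm e)\<^sup>2" by (rule mult_left_mono) simp
    also have "\<dots> = \<kappa> * (\<kappa> * L\<^sup>2 * (nrm e)\<^sup>2)" by (simp add: power_mult_distrib power2_eq_square mult_ac)
    also have "\<dots> \<le> \<kappa> * (\<gamma> * (nrm e)\<^sup>2)" using \<kappa> by (intro mult_left_mono mult_right_mono) auto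
    finally have 1: "\<kappa>\<^sup>2 * (nrm g)\<^sup>2 \<le> \<kappa> * (\<gamma> * (nrm e)\<^sup>2)" .
    have "2 * \<kappa> * (\<gamma> * (nrm e)\<^sup>2) \<le> 2 * \<kappa> * ip g e" using \<kappa> monotone by (intro mult_left_mono) auto
    with 1 show ?thesis by linarith
  qed
  also have "\<dots> = (sqrt (1 - \<kappa> * \<gamma>) * nrm e)\<^sup>2" using \<kappa> by (simp add: power_mult_distrib algebra_simps)
  finally show "(nrm (\<lambda>x. e x - \<kappa> * g x))\<^sup>2 \<le> (sqrt (1 - \<kappa> * \<gamma>) * nrm e)\<^sup>2" .
qed (use nrm_nonneg[OF e] \<kappa> in simp)

text \<open>
  Elements at distance zero need not be equal; they cannot be told apart by the inner product.
\<close>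

definition eqv :: "('a \<Rightarrow> real) \<Rightarrow> ('a \<Rightarrow> real) \<Rightarrow> bool" where
  "eqv u v \<longleftrightarrow> u \<in> S \<and> v \<in> S \<and> nrm (\<lambda>x. u x - v x) = 0"

lemma eqv_refl: "u \<in> S \<Longrightarrow> eqv u u"
  by (simp add: eqv_def nrm_zero)

lemma eqv_trans [trans]: "eqv u v \<Longrightarrow> eqv v w \<Longrightarrow> eqv u w"
  unfolding eqv_def using nrm_diff_triangle[of u v w] nrm_nonneg[OF diff_mem, of u w] by auto

lemma eqv_add:
  assumes "eqv u v" "eqv u' v'" shows "eqv (\<lambda>x. u x + u' x) (\<lambda>x. v x + v' x)"
proof -
  have m: "u \<in> S" "v \<in> S" "u' \<in> S" "v' \<in> S" using assms by (auto simp: eqv_def)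
  have "(\<lambda>x. u x + u' x - (v x + v' x)) = (\<lambda>x. (u x - v x) + (u' x - v' x))" by auto
  then have "nrm (\<lambda>x. u x + u' x - (v x + v' x)) \<le> 0"
    using nrm_triangle[OF diff_mem[OF m(1,2)] diff_mem[OF m(3,4)]] assms by (simp add: eqv_def)
  then show ?thesis using m nrm_nonneg[OF diff_mem[OF add_mem[OF m(1,3)] add_mem[OF m(2,4)]]]
    by (auto simp: eqv_def add_mem)
qed

lemma eqv_ip:
  assumes "eqv u v" "w \<in> S" shows "ip u w = ip v w"
proof -
  have m: "u \<in> S" "v \<in> S" and "nrm (\<lambda>x. u x - v x) = 0" using assms by (auto simp: eqv_def)
  then have "\<bar>ip (\<lambda>x. u x - v x) w\<bar> \<le> 0"
    using Cauchy_Schwarz[OF diff_mem[OF m] assms(2)] by simp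
  then show ?thesis using m assms(2) by (simp add: ip_diff)
qed

lemma eqv_ip_self:
  assumes "eqv u v" shows "ip u u = ip v v"
proof -
  have m: "u \<in> S" "v \<in> S" using assms by (auto simp: eqv_def)
  show ?thesis using eqv_ip[OF assms m(1)] eqv_ip[OF assms m(2)] ip_commute[OF m] by simp
qed

text \<open>
  The Riesz representation theorem: the representing element minimises \<open>\<parallel>h\<parallel>\<^sup>2 - 2 L h\<close>, and
  minimising sequences are Cauchy by the parallelogram law.
\<close>

lemma Riesz:
  assumes complete: "\<And>f. (\<And>n. f n \<in> S) \<Longrightarrow>
      (\<And>e. e > 0 \<Longrightarrow> \<exists>N. \<forall>m\<ge>N. \<forall>n\<ge>N. nrm (\<lambda>x. f m x - f n x) < e) \<Longrightarrow>
      \<exists>g\<in>S. (\<lambda>n::nat. nrm (\<lambda>x. f n x - g x)) \<longlonglongrightarrow> 0"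
    and L_lin: "\<And>u v c. u \<in> S \<Longrightarrow> v \<in> S \<Longrightarrow> L (\<lambda>x. u x + c * v x) = L u + c * L v"
    and L_bound: "\<And>u. u \<in> S \<Longrightarrow> \<bar>L u\<bar> \<le> C * nrm u"
  shows "\<exists>g\<in>S. \<forall>h\<in>S. ip g h = L h"
proof -
  define q where "q h = ip h h - 2 * L h" for h
  have q_expand: "q (\<lambda>x. u x + c * v x) = q u + 2 * c * (ip u v - L v) + c\<^sup>2 * ip v v" if "u \<in> S" "v \<in> S" for u v c
    using that by (simp add: q_def ip_expand L_lin algebra_simps)
  have lower: "- C\<^sup>2 \<le> q h" if "h \<in> S" for h
  proof -
    have "q h \<ge> (nrm h)\<^sup>2 - 2 * (C * nrm h)"
      using L_bound[OF that] by (simp add: q_def nrm_square that abs_le_iff)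
    moreover have "(nrm h)\<^sup>2 - 2 * (C * nrm h) = (nrm h - C)\<^sup>2 - C\<^sup>2" by (simp add: power2_diff)
    ultimately show ?thesis using zero_le_power2[of "nrm h - C"] by linarith
  qed
  define m where "m = Inf (q ` S)"
  have bdd: "bdd_below (q ` S)" using lower by (auto intro!: bdd_belowI)
  have m_le: "m \<le> q h" if "h \<in> S" for h unfolding m_def using bdd that by (simp add: cInf_lower)
  have "\<exists>h\<in>S. q h < m + 1 / (real n + 1)" for n
  proof -
    have "Inf (q ` S) < m + 1 / (real n + 1)" by (simp add: m_def)
    from cInf_lessD[OF _ this] zero_mem show ?thesis by auto
  qed
  then obtain f where f: "\<And>n. f n \<in> S" "\<And>n. q (f n) < m + 1 / (real n + 1)" by metis
  have para: "(nrm (\<lambda>x. f i x - f j x))\<^sup>2 \<le> 2 / (real i + 1) + 2 / (real j + 1)" for i j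
  proof -
    note fi = f(1)[of i] and fj = f(1)[of j]
    have d: "(\<lambda>x. f i x - f j x) \<in> S" using fi fj by (rule diff_mem)
    \<comment> \<open>The midpoint of \<open>f i\<close> and \<open>f j\<close>, as seen from each of the two ends.\<close>
    have mid: "(\<lambda>x. f j x + 1 / 2 * (f i x - f j x)) \<in> S" by (rule lincomb_mem[OF fj d])
    have "f i = (\<lambda>x. f j x + 1 * (f i x - f j x))" by auto
    then have "q (f i) = q (f j) + 2 * (ip (f j) (\<lambda>x. f i x - f j x) - L (\<lambda>x. f i x - f j x)) + ip (\<lambda>x. f i x - f j x) (\<lambda>x. f i x - f j x)"
      using q_expand[OF fj d, of 1] by simp
    moreover have "q (\<lambda>x. f j x + 1 / 2 * (f i x - f j x)) = q (f j) + (ip (f j) (\<lambda>x. f i x - f j x) - L (\<lambda>x. f i x - f j x))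
        + ip (\<lambda>x. f i x - f j x) (\<lambda>x. f i x - f j x) / 4"
      using q_expand[OF fj d, of "1 / 2"] by (simp add: power2_eq_square)
    ultimately have "ip (\<lambda>x. f i x - f j x) (\<lambda>x. f i x - f j x) = 2 * q (f i) + 2 * q (f j) - 4 * q (\<lambda>x. f j x + 1 / 2 * (f i x - f j x))"
      by simp
    also have "\<dots> \<le> 2 * (m + 1 / (real i + 1)) + 2 * (m + 1 / (real j + 1)) - 4 * m"
    proof -
      have "2 * a + 2 * a' - 4 * e \<le> 2 * (m + d) + 2 * (m + d') - 4 * m"
        if "a < m + d" "a' < m + d'" "m \<le> e" for a a' d d' e :: real using that by (simp add: algebra_simps)
      from this[OF f(2) f(2) m_le[OF mid]] show ?thesis .
    qed
    finally show ?thesis using d by (simp add: nrm_square)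
  qed
  have "\<exists>N. \<forall>i\<ge>N. \<forall>j\<ge>N. nrm (\<lambda>x. f i x - f j x) < e" if e: "e > 0" for e
  proof -
    have "0 < e\<^sup>2 / 4" using e by simp
    then obtain N where N: "inverse (real (Suc N)) < e\<^sup>2 / 4" using reals_Archimedean by blast
    have "nrm (\<lambda>x. f i x - f j x) < e" if "i \<ge> N" "j \<ge> N" for i j
    proof -
      have "1 / (real i + 1) \<le> inverse (real (Suc N))" "1 / (real j + 1) \<le> inverse (real (Suc N))"
        using that by (auto simp: inverse_eq_divide intro!: divide_left_mono)
      then have "1 / (real i + 1) < e\<^sup>2 / 4" "1 / (real j + 1) < e\<^sup>2 / 4" using N by linarith+
      then have "2 / (real i + 1) + 2 / (real j + 1) < e\<^sup>2" by linarith
      then have "(nrm (\<lambda>x. f i x - f j x))\<^sup>2 < e\<^sup>2" using para[of i j] by linarith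
      then show ?thesis using e by (simp add: power_less_imp_less_base)
    qed
    then show ?thesis by blast
  qed
  from complete[OF f(1) this] obtain g where g: "g \<in> S" "(\<lambda>n. nrm (\<lambda>x. f n x - g x)) \<longlonglongrightarrow> 0" by blast
  have qg: "q g \<le> m"
  proof -
    have le: "q g \<le> q (f n) + 2 * ((nrm g + C) * nrm (\<lambda>x. f n x - g x))" for n
    proof -
      have d: "(\<lambda>x. f n x - g x) \<in> S" by (rule diff_mem[OF f(1) g(1)])
      have "q (f n) = q g + 2 * (ip g (\<lambda>x. f n x - g x) - L (\<lambda>x. f n x - g x)) + ip (\<lambda>x. f n x - g x) (\<lambda>x. f n x - g x)"
        using q_expand[OF g(1) d, of 1] by simp
      moreover have "\<bar>ip g (\<lambda>x. f n x - g x)\<bar> \<le> nrm g * nrm (\<lambda>x. f n x - g x)" by (rule Cauchy_Schwarz[OF g(1) d])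
      ultimately show ?thesis using L_bound[OF d] ip_nonneg[OF d] by (simp add: algebra_simps)
    qed
    have "(\<lambda>n. (m + 1 / (real n + 1)) + 2 * ((nrm g + C) * nrm (\<lambda>x. f n x - g x))) \<longlonglongrightarrow> (m + 0) + 2 * ((nrm g + C) * 0)"
      by (intro tendsto_add tendsto_const tendsto_mult g(2))
        (use LIMSEQ_inverse_real_of_nat in \<open>simp add: inverse_eq_divide add.commute\<close>)
    moreover have "q g \<le> (m + 1 / (real n + 1)) + 2 * ((nrm g + C) * nrm (\<lambda>x. f n x - g x))" for n
      using le[of n] f(2)[of n] by linarith
    ultimately have "q g \<le> (m + 0) + 2 * ((nrm g + C) * 0)" by (intro LIMSEQ_le_const) auto
    then show ?thesis by simp
  qed
  have "ip g h = L h" if h: "h \<in> S" for h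
  proof (rule ccontr)
    assume "ip g h \<noteq> L h"
    define a where "a = ip g h - L h"
    have a: "a \<noteq> 0" using \<open>ip g h \<noteq> L h\<close> by (simp add: a_def)
    have quad: "0 \<le> 2 * c * a + c\<^sup>2 * ip h h" for c
      using qg m_le[OF lincomb_mem[OF g(1) h, of c]] q_expand[OF g(1) h, of c] by (simp add: a_def)
    have pos: "0 < ip h h + 1" using ip_nonneg[OF h] by simp
    define t where "t = a\<^sup>2 / (ip h h + 1)"
    have t: "0 < t" using a pos by (simp add: t_def)
    have "(- a / (ip h h + 1))\<^sup>2 * ip h h = t * (ip h h / (ip h h + 1))"
      by (simp add: t_def power2_eq_square)
    also have "\<dots> \<le> t * 1" using t pos by (intro mult_left_mono) auto
    finally have "2 * (- a / (ip h h + 1)) * a + (- a / (ip h h + 1))\<^sup>2 * ip h h \<le> - t"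
      by (simp add: t_def power2_eq_square)
    then show False using quad[of "- a / (ip h h + 1)"] t by linarith
  qed
  then show ?thesis using g(1) by blast
qed

end

section \<open>Square integrable functions\<close>

definition L2 :: "'a measure \<Rightarrow> ('a \<Rightarrow> real) set" where
  "L2 M = {f \<in> borel_measurable M. integrable M (\<lambda>x. (f x)\<^sup>2)}"

lemma L2_measurable [measurable_dest]: "f \<in> L2 M \<Longrightarrow> f \<in> borel_measurable M"
  and L2_square: "f \<in> L2 M \<Longrightarrow> integrable M (\<lambda>x. (f x)\<^sup>2)"
  by (auto simp: L2_def)

lemma L2_mult_integrable:
  assumes "f \<in> L2 M" "g \<in> L2 M"
  shows "integrable M (\<lambda>x. f x * g x)"
proof (rule Bochner_Integration.integrable_bound)
  note assms[THEN L2_measurable, measurable]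
  show "integrable M (\<lambda>x. (f x)\<^sup>2 + (g x)\<^sup>2)"
    using assms by (intro Bochner_Integration.integrable_add L2_square)
  show "(\<lambda>x. f x * g x) \<in> borel_measurable M" by measurable
  have "\<bar>s * t\<bar> \<le> s\<^sup>2 + t\<^sup>2" for s t :: real
  proof -
    have "2 * \<bar>s\<bar> * \<bar>t\<bar> \<le> s\<^sup>2 + t\<^sup>2" "0 \<le> \<bar>s\<bar> * \<bar>t\<bar>"
      using sum_squares_bound[of "\<bar>s\<bar>" "\<bar>t\<bar>"] by simp_all
    then show ?thesis unfolding abs_mult by linarith
  qed
  then show "AE x in M. norm (f x * g x) \<le> norm ((f x)\<^sup>2 + (g x)\<^sup>2)"
    by (auto intro!: AE_I2)
qed

lemma L2_cmult: "f \<in> L2 M \<Longrightarrow> (\<lambda>x. c * f x) \<in> L2 M"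
  by (auto simp: L2_def power_mult_distrib)

lemma L2_add:
  assumes "f \<in> L2 M" "g \<in> L2 M"
  shows "(\<lambda>x. f x + g x) \<in> L2 M"
proof -
  note assms[THEN L2_measurable, measurable]
  have "integrable M (\<lambda>x. (f x)\<^sup>2 + (g x)\<^sup>2 + 2 * (f x * g x))"
    using assms by (intro Bochner_Integration.integrable_add L2_square integrable_mult_right L2_mult_integrable)
  then show ?thesis by (simp add: L2_def power2_sum mult.assoc)
qed

lemma L2_lincomb: "f \<in> L2 M \<Longrightarrow> g \<in> L2 M \<Longrightarrow> (\<lambda>x. f x + c * g x) \<in> L2 M"
  by (intro L2_add L2_cmult)

lemma L2_diff: "f \<in> L2 M \<Longrightarrow> g \<in> L2 M \<Longrightarrow> (\<lambda>x. f x - g x) \<in> L2 M"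
  using L2_lincomb[of f M g "-1"] by simp

lemma L2_cong_AE:
  assumes "f \<in> L2 M" "AE x in M. f x = g x" and g[measurable]: "g \<in> borel_measurable M"
  shows "g \<in> L2 M"
proof -
  note assms(1)[THEN L2_measurable, measurable]
  have "integrable M (\<lambda>x. (f x)\<^sup>2) \<longleftrightarrow> integrable M (\<lambda>x. (g x)\<^sup>2)"
    by (rule integrable_cong_AE) (use assms(2) in auto)
  then show ?thesis using assms by (simp add: L2_def)
qed

lemma L2_bounded_mult:
  assumes "f \<in> L2 M" and [measurable]: "g \<in> borel_measurable M" and "AE x in M. \<bar>g x\<bar> \<le> B"
  shows "(\<lambda>x. g x * f x) \<in> L2 M"
proof -
  note assms(1)[THEN L2_measurable, measurable]
  have "integrable M (\<lambda>x. (g x * f x)\<^sup>2)"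
  proof (rule Bochner_Integration.integrable_bound)
    show "integrable M (\<lambda>x. B\<^sup>2 * (f x)\<^sup>2)" using assms(1) by (intro integrable_mult_right L2_square)
    show "AE x in M. norm ((g x * f x)\<^sup>2) \<le> norm (B\<^sup>2 * (f x)\<^sup>2)"
      using assms(3)
    proof eventually_elim
      case (elim x)
      then have "(g x)\<^sup>2 \<le> B\<^sup>2" using power_mono[OF elim, of 2] by simp
      then show ?case by (simp add: power_mult_distrib mult_right_mono)
    qed
  qed measurable
  then show ?thesis by (simp add: L2_def)
qed

lemma (in finite_measure) L2_integrable:
  assumes "f \<in> L2 M" shows "integrable M f"
proof -
  have "(\<lambda>_. 1) \<in> L2 M" by (simp add: L2_def)
  from L2_mult_integrable[OF assms this] show ?thesis by simp
qed

lemma (in finite_measure) L2_bounded: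
  assumes "f \<in> borel_measurable M" "AE x in M. \<bar>f x\<bar> \<le> B"
  shows "f \<in> L2 M"
proof -
  have "(\<lambda>_. 1) \<in> L2 M" by (simp add: L2_def)
  from L2_bounded_mult[OF this assms] show ?thesis by simp
qed

lemma L2_semi_inner: "semi_inner_space (L2 M) (\<lambda>f g. LINT x|M. f x * g x)"
proof
  show "(\<lambda>_. 0) \<in> L2 M" by (simp add: L2_def)
  show "(LINT x|M. (u x + c * v x) * w x) = (LINT x|M. u x * w x) + c * (LINT x|M. v x * w x)"
    if "u \<in> L2 M" "v \<in> L2 M" "w \<in> L2 M" for u v w c
    using L2_mult_integrable[OF that(1,3)] L2_mult_integrable[OF that(2,3)] by (simp add: algebra_simps)
qed (auto intro: L2_lincomb simp: mult.commute)

lemma L2_Cauchy_Schwarz: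
  assumes f: "f \<in> L2 M" and g: "g \<in> L2 M"
  shows "(LINT x|M. \<bar>f x * g x\<bar>)\<^sup>2 \<le> (LINT x|M. (f x)\<^sup>2) * (LINT x|M. (g x)\<^sup>2)"
proof -
  interpret semi_inner_space "L2 M" "\<lambda>f g. LINT x|M. f x * g x" by (rule L2_semi_inner)
  have abs: "(\<lambda>x. \<bar>f x\<bar>) \<in> L2 M" "(\<lambda>x. \<bar>g x\<bar>) \<in> L2 M" using f g by (auto simp: L2_def)
  have "(LINT x|M. \<bar>f x * g x\<bar>)\<^sup>2 \<le> (nrm (\<lambda>x. \<bar>f x\<bar>) * nrm (\<lambda>x. \<bar>g x\<bar>))\<^sup>2"
    using Cauchy_Schwarz[OF abs] by (intro power_mono) (auto simp: abs_mult)
  then show ?thesis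
    by (simp add: power_mult_distrib nrm_square abs power2_eq_square[symmetric])
qed

lemma (in finite_measure) L1_le_L2:
  assumes "f \<in> L2 M"
  shows "(LINT x|M. \<bar>f x\<bar>) \<le> sqrt (measure M (space M)) * sqrt (LINT x|M. (f x)\<^sup>2)"
proof -
  have one: "(\<lambda>_. 1) \<in> L2 M" by (simp add: L2_def)
  have "(LINT x|M. \<bar>f x\<bar>)\<^sup>2 \<le> (LINT x|M. (f x)\<^sup>2) * measure M (space M)"
    using L2_Cauchy_Schwarz[OF assms one] by simp
  from real_le_rsqrt[OF this] show ?thesis by (simp add: real_sqrt_mult mult.commute)
qed

text \<open>
  Riesz--Fischer on a finite measure space: an \<open>L\<^sup>2\<close> Cauchy sequence is \<open>L\<^sup>1\<close> Cauchy, so a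
  subsequence converges almost everywhere, and Fatou's lemma turns this limit into the \<open>L\<^sup>2\<close> limit.
\<close>

lemma (in finite_measure) L2_complete:
  assumes f: "\<And>n. f n \<in> L2 M"
    and cauchy: "\<And>e. e > 0 \<Longrightarrow> \<exists>N. \<forall>m\<ge>N. \<forall>n\<ge>N. (LINT x|M. (f m x - f n x)\<^sup>2) < e"
  obtains g where "g \<in> L2 M" "(\<lambda>n. LINT x|M. (f n x - g x)\<^sup>2) \<longlonglongrightarrow> 0"
proof -
  have [measurable]: "f n \<in> borel_measurable M" for n using f by (rule L2_measurable)
  define c where "c = sqrt (measure M (space M)) + 1"
  have c: "c > 0" by (simp add: c_def add_nonneg_pos)
  have "\<exists>N. \<forall>i\<ge>N. \<forall>j\<ge>N. (LINT x|M. norm (f i x - f j x)) < e" if "e > 0" for e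
  proof -
    from that c have "(e / c)\<^sup>2 > 0" by simp
    from cauchy[OF this] obtain N where N: "\<forall>m\<ge>N. \<forall>n\<ge>N. (LINT x|M. (f m x - f n x)\<^sup>2) < (e / c)\<^sup>2" ..
    have "(LINT x|M. norm (f i x - f j x)) < e" if "i \<ge> N" "j \<ge> N" for i j
    proof -
      have "sqrt (LINT x|M. (f i x - f j x)\<^sup>2) < e / c"
        using N that \<open>e > 0\<close> c by (intro real_less_lsqrt) auto
      moreover have "(LINT x|M. \<bar>f i x - f j x\<bar>) \<le> sqrt (measure M (space M)) * sqrt (LINT x|M. (f i x - f j x)\<^sup>2)"
        by (rule L1_le_L2) (intro L2_diff f)
      moreover have "\<dots> \<le> c * sqrt (LINT x|M. (f i x - f j x)\<^sup>2)"
        by (intro mult_right_mono) (auto simp: c_def)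
      ultimately show ?thesis using c by (simp add: field_simps)
    qed
    then show ?thesis by blast
  qed
  then obtain r where r: "strict_mono r" and conv: "AE x in M. Cauchy (\<lambda>i. f (r i) x)"
    using cauchy_L1_AE_cauchy_subseq[of M f] L2_integrable[OF f] by metis
  define g where "g x = lim (\<lambda>i. f (r i) x)" for x
  have g_meas[measurable]: "g \<in> borel_measurable M"
    unfolding g_def[abs_def] by measurable
  have lim: "AE x in M. (\<lambda>i. f (r i) x) \<longlonglongrightarrow> g x"
    using conv by eventually_elim (auto simp: g_def Cauchy_convergent_iff convergent_LIMSEQ_iff)
  have est: "integrable M (\<lambda>x. (f n x - g x)\<^sup>2) \<and> (LINT x|M. (f n x - g x)\<^sup>2) \<le> e"
    if N: "\<forall>m\<ge>N. \<forall>n\<ge>N. (LINT x|M. (f m x - f n x)\<^sup>2) < e" and n: "n \<ge> N" for n N e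
  proof -
    have e: "0 \<le> e" using N[rule_format, OF n n] by simp
    have "(\<integral>\<^sup>+x. ennreal ((f n x - g x)\<^sup>2) \<partial>M) = (\<integral>\<^sup>+x. liminf (\<lambda>i. ennreal ((f n x - f (r i) x)\<^sup>2)) \<partial>M)"
    proof (rule nn_integral_cong_AE)
      show "AE x in M. ennreal ((f n x - g x)\<^sup>2) = liminf (\<lambda>i. ennreal ((f n x - f (r i) x)\<^sup>2))"
        using lim
      proof eventually_elim
        case (elim x)
        have "(\<lambda>i. ennreal ((f n x - f (r i) x)\<^sup>2)) \<longlonglongrightarrow> ennreal ((f n x - g x)\<^sup>2)"
          by (intro tendsto_intros tendsto_ennrealI elim)
        then show ?case using lim_imp_Liminf[OF sequentially_bot] by (metis (no_types))
      qed
    qed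
    also have "\<dots> \<le> liminf (\<lambda>i. \<integral>\<^sup>+x. ennreal ((f n x - f (r i) x)\<^sup>2) \<partial>M)"
      by (rule nn_integral_liminf) measurable
    also have "\<dots> \<le> ennreal e"
    proof -
      have "\<forall>\<^sub>F i in sequentially. (\<integral>\<^sup>+x. ennreal ((f n x - f (r i) x)\<^sup>2) \<partial>M) \<le> ennreal e"
        using eventually_ge_at_top[of N]
      proof eventually_elim
        case (elim i)
        then have "r i \<ge> N" using seq_suble[OF r, of i] by linarith
        then have "(LINT x|M. (f n x - f (r i) x)\<^sup>2) \<le> e" using N n by (simp add: less_imp_le)
        moreover have "(\<integral>\<^sup>+x. ennreal ((f n x - f (r i) x)\<^sup>2) \<partial>M) = ennreal (LINT x|M. (f n x - f (r i) x)\<^sup>2)"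
          by (intro nn_integral_eq_integral L2_square L2_diff f) auto
        ultimately show ?case by (simp add: ennreal_leI)
      qed
      then show ?thesis by (intro Liminf_le) auto
    qed
    finally have le: "(\<integral>\<^sup>+x. ennreal ((f n x - g x)\<^sup>2) \<partial>M) \<le> ennreal e" .
    have int: "integrable M (\<lambda>x. (f n x - g x)\<^sup>2)"
      by (rule integrableI_nonneg) (use le in \<open>auto simp: less_top[symmetric] top_unique\<close>)
    moreover have "ennreal (LINT x|M. (f n x - g x)\<^sup>2) \<le> ennreal e"
      using le nn_integral_eq_integral[OF int] by simp
    ultimately show ?thesis using e by (simp add: ennreal_le_iff)
  qed
  show thesis
  proof (rule that)
    obtain N where N: "\<forall>m\<ge>N. \<forall>n\<ge>N. (LINT x|M. (f m x - f n x)\<^sup>2) < 1" using cauchy[of 1] by auto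
    have "(\<lambda>x. f N x - g x) \<in> L2 M" using est[OF N order_refl] by (simp add: L2_def)
    from L2_diff[OF f[of N] this] show "g \<in> L2 M" by simp
    show "(\<lambda>n. LINT x|M. (f n x - g x)\<^sup>2) \<longlonglongrightarrow> 0"
    proof (rule LIMSEQ_I)
      fix e :: real assume "e > 0"
      then obtain N where N: "\<forall>m\<ge>N. \<forall>n\<ge>N. (LINT x|M. (f m x - f n x)\<^sup>2) < e / 2" using cauchy[of "e/2"] by auto
      have "(LINT x|M. (f n x - g x)\<^sup>2) \<le> e / 2" if "n \<ge> N" for n using est[OF N that] by simp
      then show "\<exists>N. \<forall>n\<ge>N. norm ((LINT x|M. (f n x - g x)\<^sup>2) - 0) < e"
        using \<open>e > 0\<close> by (intro exI[of _ N]) (auto, smt (verit) field_sum_of_halves)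
    qed
  qed
qed

text \<open>Boxes form an intersection-stable generator, so the integrals over boxes determine a function.\<close>

lemma AE_zero_if_box_integrals_zero:
  fixes f :: "'a::euclidean_space \<Rightarrow> real"
  assumes f: "integrable lborel f" and boxes: "\<And>p q. (LINT x:box p q|lborel. f x) = 0"
  shows "AE x in lborel. f x = 0"
proof -
  let ?E = "range (\<lambda>(p, q). box p q :: 'a set)"
  have gen: "sets lborel = sigma_sets UNIV ?E"
    by (simp add: borel_eq_box)
  have si: "set_integrable lborel A f" if "A \<in> sets lborel" for A
    using f that unfolding set_integrable_def by (intro integrable_mult_indicator)
  have total: "(LINT x|lborel. f x) = 0"
  proof -
    have "(\<lambda>n. LINT x|lborel. indicator (box (- real n *\<^sub>R One) (real n *\<^sub>R One :: 'a)) x *\<^sub>R f x) \<longlonglongrightarrow> (LINT x|lborel. f x)"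
    proof (rule integral_dominated_convergence[where w = "\<lambda>x. \<bar>f x\<bar>"])
      show "AE x in lborel. (\<lambda>n. indicator (box (- real n *\<^sub>R One) (real n *\<^sub>R One :: 'a)) x *\<^sub>R f x) \<longlonglongrightarrow> f x"
      proof (rule AE_I2)
        fix x :: 'a
        obtain N where N: "norm x < real N" using reals_Archimedean2 by blast
        have "x \<in> box (- real n *\<^sub>R One) (real n *\<^sub>R One)" if "n \<ge> N" for n
        proof -
          have "\<bar>x \<bullet> i\<bar> < real n" if "i \<in> Basis" for i
            using N Basis_le_norm[OF that, of x] \<open>n \<ge> N\<close> by (meson le_less_trans less_le_trans of_nat_le_iff)
          then show ?thesis by (force simp: mem_box abs_less_iff)
        qed
        then have "\<forall>\<^sub>F n in sequentially. indicator (box (- real n *\<^sub>R One) (real n *\<^sub>R One :: 'a)) x *\<^sub>R f x = f x"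
          unfolding eventually_sequentially by (intro exI[of _ N]) auto
        then show "(\<lambda>n. indicator (box (- real n *\<^sub>R One) (real n *\<^sub>R One :: 'a)) x *\<^sub>R f x) \<longlonglongrightarrow> f x"
          by (rule tendsto_eventually)
      qed
      show "AE x in lborel. norm (indicator (box (- real n *\<^sub>R One) (real n *\<^sub>R One :: 'a)) x *\<^sub>R f x) \<le> \<bar>f x\<bar>" for n
        by (auto intro!: AE_I2 simp: indicator_def)
    qed (use f in auto)
    then show ?thesis using boxes by (simp add: set_lebesgue_integral_def LIMSEQ_const_iff)
  qed
  have "Int_stable ?E" "?E \<subseteq> Pow UNIV" by (auto simp: Int_stable_def box_Int_box)
  then have "(LINT x:A|lborel. f x) = 0" if "A \<in> sigma_sets UNIV ?E" for A
    using that
  proof (induction rule: sigma_sets_induct_disjoint)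
    fix A assume "A \<in> ?E" then show "(LINT x:A|lborel. f x) = 0" using boxes by auto
  next
    fix A assume A: "A \<in> sigma_sets UNIV ?E" "(LINT x:A|lborel. f x) = 0"
    then have A': "A \<in> sets lborel" using gen by simp
    have "(LINT x:A \<union> (UNIV - A)|lborel. f x) = (LINT x:A|lborel. f x) + (LINT x:UNIV - A|lborel. f x)"
      using A' by (intro set_integral_Un si) auto
    moreover have "A \<union> (UNIV - A) = UNIV" by auto
    ultimately show "(LINT x:UNIV - A|lborel. f x) = 0"
      using A total by (simp add: set_lebesgue_integral_def)
  next
    fix A :: "nat \<Rightarrow> 'a set"
    assume A: "disjoint_family A" "range A \<subseteq> sigma_sets UNIV ?E" "\<And>i. (LINT x:A i|lborel. f x) = 0"
    then have "\<And>i. A i \<in> sets lborel" using gen by auto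
    then have "(LINT x:(\<Union>i. A i)|lborel. f x) = (\<Sum>i. LINT x:A i|lborel. f x)"
      using A(1) by (intro lebesgue_integral_countable_add si sets.countable_UN) (auto simp: disjoint_family_on_def)
    then show "(LINT x:(\<Union>i. A i)|lborel. f x) = 0" using A by simp
  qed (simp add: set_lebesgue_integral_def)
  then show ?thesis
    using f gen by (intro density_unique_real) auto
qed

section \<open>Jets of test functions\<close>

lemma test_jet_smooth: "test_jet \<Omega> D \<Longrightarrow> smooth_jet D" by (simp add: test_jet_def)

lemma smooth_jet_continuous: "smooth_jet D \<Longrightarrow> continuous_on S (D \<alpha>)"
  unfolding smooth_jet_def by (meson continuous_at_imp_continuous_on has_derivative_continuous)

lemma smooth_jet_vanish_step:
  fixes D :: "('a::euclidean_space \<Rightarrow> nat) \<Rightarrow> 'a \<Rightarrow> real"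
  assumes D: "smooth_jet D" and U: "open U" "\<And>x. x \<in> U \<Longrightarrow> D \<alpha> x = 0" and e: "e \<in> Basis" and x: "x \<in> U"
  shows "D (\<alpha>(e := Suc (\<alpha> e))) x = 0"
proof -
  have "((\<lambda>_. 0) has_derivative (\<lambda>h. \<Sum>e\<in>Basis. (h \<bullet> e) * D (\<alpha>(e := Suc (\<alpha> e))) x)) (at x)"
    by (rule has_derivative_transform_within_open[OF D[unfolded smooth_jet_def, rule_format, of \<alpha> x] U(1) x])
      (rule U(2))
  moreover have "((\<lambda>_. 0) has_derivative (\<lambda>_. 0 :: real)) (at x)" by simp
  ultimately have "(\<lambda>h. \<Sum>e\<in>Basis. (h \<bullet> e) * D (\<alpha>(e := Suc (\<alpha> e))) x) = (\<lambda>_. 0)"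
    by (rule has_derivative_unique)
  from fun_cong[OF this, of e] show ?thesis
    using e by (simp add: inner_Basis if_distrib[of "\<lambda>z. z * _"] cong: if_cong)
qed

lemma multi_index_induct [consumes 1, case_names zero step]:
  fixes \<alpha> :: "'a::euclidean_space \<Rightarrow> nat"
  assumes "\<forall>e. e \<notin> Basis \<longrightarrow> \<alpha> e = 0" and "P (\<lambda>_. 0)"
    and "\<And>\<beta> e. \<forall>e. e \<notin> Basis \<longrightarrow> \<beta> e = 0 \<Longrightarrow> P \<beta> \<Longrightarrow> e \<in> Basis \<Longrightarrow> P (\<beta>(e := Suc (\<beta> e)))"
  shows "P \<alpha>"
  using assms(1)
proof (induction "\<Sum>e\<in>Basis. \<alpha> e" arbitrary: \<alpha>)
  case 0
  then have "\<alpha> = (\<lambda>_. 0)" by (metis finite_Basis sum_eq_0_iff)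
  then show ?case using assms(2) by simp
next
  case (Suc n)
  then obtain e where e: "e \<in> Basis" "\<alpha> e \<noteq> 0" by (metis Zero_not_Suc sum.neutral)
  define \<beta> where "\<beta> = \<alpha>(e := \<alpha> e - 1)"
  have \<alpha>: "\<alpha> = \<beta>(e := Suc (\<beta> e))" using e by (auto simp: \<beta>_def)
  have 1: "(\<Sum>i\<in>Basis. \<alpha> i) = \<alpha> e + (\<Sum>i\<in>Basis - {e}. \<alpha> i)"
     "(\<Sum>i\<in>Basis. \<beta> i) = \<beta> e + (\<Sum>i\<in>Basis - {e}. \<beta> i)"
    using e by (simp_all add: sum.remove)
  have 2: "(\<Sum>i\<in>Basis - {e}. \<beta> i) = (\<Sum>i\<in>Basis - {e}. \<alpha> i)"
    by (rule sum.cong) (auto simp: \<beta>_def)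
  from 1 2 e Suc.hyps(2) have "n = (\<Sum>i\<in>Basis. \<beta> i)" by (simp add: \<beta>_def)
  moreover have "\<forall>e. e \<notin> Basis \<longrightarrow> \<beta> e = 0" using Suc.prems e by (auto simp: \<beta>_def)
  ultimately have "P \<beta>" using Suc.hyps(1) by blast
  then show ?case using assms(3)[of \<beta> e] \<open>\<forall>e. e \<notin> Basis \<longrightarrow> \<beta> e = 0\<close> e \<alpha> by metis
qed

text \<open>
  On an open set where a function vanishes, so do all its derivatives. Hence a compact set that
  contains the support of a test function contains the supports of all its derivatives.
\<close>

lemma smooth_jet_vanish:
  fixes D :: "('a::euclidean_space \<Rightarrow> nat) \<Rightarrow> 'a \<Rightarrow> real"
  assumes D: "smooth_jet D" and U: "open U" "\<And>x. x \<in> U \<Longrightarrow> D (\<lambda>_. 0) x = 0"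
    and \<alpha>: "\<forall>e. e \<notin> Basis \<longrightarrow> \<alpha> e = 0" and x: "x \<in> U"
  shows "D \<alpha> x = 0"
  using \<alpha> x
proof (induction \<alpha> arbitrary: x rule: multi_index_induct)
  case zero then show ?case using U by simp
next
  case (step \<beta> e) then show ?case using smooth_jet_vanish_step[OF D U(1), of \<beta> e x] by blast
qed

lemma test_jet_support:
  fixes D :: "('a::euclidean_space \<Rightarrow> nat) \<Rightarrow> 'a \<Rightarrow> real"
  assumes "test_jet \<Omega> D"
  obtains K where "compact K" "K \<subseteq> \<Omega>"
    "\<And>\<alpha> x. \<forall>e. e \<notin> Basis \<longrightarrow> \<alpha> e = 0 \<Longrightarrow> D \<alpha> x \<noteq> 0 \<Longrightarrow> x \<in> K"
proof
  let ?K = "closure {x. D (\<lambda>_. 0) x \<noteq> 0}"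
  show "compact ?K" "?K \<subseteq> \<Omega>" using assms by (auto simp: test_jet_def)
  fix \<alpha> x assume \<alpha>: "\<forall>e. e \<notin> Basis \<longrightarrow> \<alpha> e = 0" and "D \<alpha> x \<noteq> 0"
  have vanish: "D (\<lambda>_. 0) z = 0" if "z \<in> - ?K" for z
    using that closure_subset[of "{x. D (\<lambda>_. 0) x \<noteq> 0}"] by blast
  show "x \<in> ?K"
  proof (rule ccontr)
    assume "x \<notin> ?K"
    then have "D \<alpha> x = 0"
      using smooth_jet_vanish[OF test_jet_smooth[OF assms] open_Compl[OF closed_closure] vanish \<alpha>]
      by blast
    then show False using \<open>D \<alpha> x \<noteq> 0\<close> by simp
  qed
qed

lemma test_jet_bounded:
  assumes "test_jet \<Omega> D" "\<forall>e. e \<notin> Basis \<longrightarrow> \<alpha> e = 0"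
  obtains B where "\<And>x. \<bar>D \<alpha> x\<bar> \<le> B"
proof -
  obtain K where K: "compact K" "\<And>x. D \<alpha> x \<noteq> 0 \<Longrightarrow> x \<in> K"
    using test_jet_support[OF assms(1)] assms(2) by metis
  have "compact (D \<alpha> ` K)"
    by (intro compact_continuous_image smooth_jet_continuous[OF test_jet_smooth[OF assms(1)]] K)
  from compact_imp_bounded[OF this] obtain B where "\<And>x. x \<in> K \<Longrightarrow> \<bar>D \<alpha> x\<bar> \<le> B"
    by (auto simp: bounded_iff)
  then have "\<bar>D \<alpha> x\<bar> \<le> max B 0" for x
    using K(2)[of x] by (cases "D \<alpha> x = 0") force+
  then show ?thesis by (rule that)
qed

text \<open>
  Derivatives do not enlarge the support, so a derivative of a test function is a test function.
\<close>

lemma test_jet_shift: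
  fixes D :: "('a::euclidean_space \<Rightarrow> nat) \<Rightarrow> 'a \<Rightarrow> real"
  assumes D: "test_jet \<Omega> D" and \<alpha>: "\<forall>e. e \<notin> Basis \<longrightarrow> \<alpha> e = 0"
  shows "test_jet \<Omega> (\<lambda>\<gamma>. D (\<lambda>e. \<gamma> e + \<alpha> e))"
proof -
  obtain K where K: "compact K" "K \<subseteq> \<Omega>" "\<And>x. D \<alpha> x \<noteq> 0 \<Longrightarrow> x \<in> K"
    using test_jet_support[OF D] \<alpha> by metis
  have sub: "closure {x. D \<alpha> x \<noteq> 0} \<subseteq> K"
    using K by (intro closure_minimal compact_imp_closed) auto
  have "smooth_jet (\<lambda>\<gamma>. D (\<lambda>e. \<gamma> e + \<alpha> e))"
    unfolding smooth_jet_def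
  proof (intro allI)
    fix \<gamma> x
    have "(\<lambda>i. (\<gamma>(e := Suc (\<gamma> e))) i + \<alpha> i) = (\<lambda>i. \<gamma> i + \<alpha> i)(e := Suc (\<gamma> e + \<alpha> e))" for e by auto
    then show "(D (\<lambda>e. \<gamma> e + \<alpha> e) has_derivative (\<lambda>h. \<Sum>e\<in>Basis. (h \<bullet> e) *
        D (\<lambda>ea. (\<gamma>(e := Suc (\<gamma> e))) ea + \<alpha> ea) x)) (at x)"
      using test_jet_smooth[OF D, unfolded smooth_jet_def, rule_format, of "\<lambda>e. \<gamma> e + \<alpha> e" x] by simp
  qed
  moreover have "compact (closure {x. D \<alpha> x \<noteq> 0})"
    using sub K(1) by (metis closed_closure compact_Int_closed inf.absorb_iff2)
  ultimately show ?thesis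
    using sub K unfolding test_jet_def by auto
qed

definition product_jet :: "(real \<Rightarrow> real) \<Rightarrow> (real \<Rightarrow> real) \<Rightarrow> (real \<times> real \<Rightarrow> nat) \<Rightarrow> real \<times> real \<Rightarrow> real" where
  "product_jet \<psi> \<eta> \<alpha> = (\<lambda>(y, t). (deriv ^^ \<alpha> (1, 0)) \<psi> y * (deriv ^^ \<alpha> (0, 1)) \<eta> t)"

lemma sum_Basis_plane: "(\<Sum>e\<in>Basis. f e) = f (1, 0) + f (0, 1)"
  for f :: "real \<times> real \<Rightarrow> 'b::comm_monoid_add"
  by (simp add: Basis_prod_def add.commute)

lemma smooth_jet_product:
  assumes "smooth \<psi>" "smooth \<eta>"
  shows "smooth_jet (product_jet \<psi> \<eta>)"
  unfolding smooth_jet_def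
proof (intro allI)
  fix \<alpha> :: "real \<times> real \<Rightarrow> nat" and x :: "real \<times> real"
  obtain y t where x: "x = (y, t)" by (cases x)
  let ?f = "(deriv ^^ \<alpha> (1, 0)) \<psi>" and ?g = "(deriv ^^ \<alpha> (0, 1)) \<eta>"
  have f: "(?f has_real_derivative deriv ?f y) (at y)" and g: "(?g has_real_derivative deriv ?g t) (at t)"
    by (intro smooth_has_deriv smooth_iterate_deriv assms)+
  have "((\<lambda>z. ?f (fst z)) has_derivative (\<lambda>h. deriv ?f y * fst h)) (at x)"
    using f has_derivative_compose[OF has_derivative_fst[OF has_derivative_ident], of ?f "(*) (deriv ?f y)" x UNIV]
    by (simp add: has_field_derivative_def x)
  moreover have "((\<lambda>z. ?g (snd z)) has_derivative (\<lambda>h. deriv ?g t * snd h)) (at x)"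
    using g has_derivative_compose[OF has_derivative_snd[OF has_derivative_ident], of ?g "(*) (deriv ?g t)" x UNIV]
    by (simp add: has_field_derivative_def x)
  ultimately have "((\<lambda>z. ?f (fst z) * ?g (snd z)) has_derivative
      (\<lambda>h. ?f (fst x) * (deriv ?g t * snd h) + deriv ?f y * fst h * ?g (snd x))) (at x)"
    by (rule has_derivative_mult)
  moreover have "(\<lambda>h. ?f (fst x) * (deriv ?g t * snd h) + deriv ?f y * fst h * ?g (snd x))
     = (\<lambda>h. \<Sum>e\<in>Basis. (h \<bullet> e) * product_jet \<psi> \<eta> (\<alpha>(e := Suc (\<alpha> e))) x)"
    by (auto simp: sum_Basis_plane product_jet_def x inner_prod_def algebra_simps)
  moreover have "product_jet \<psi> \<eta> \<alpha> = (\<lambda>z. ?f (fst z) * ?g (snd z))"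
    by (auto simp: product_jet_def)
  ultimately show "(product_jet \<psi> \<eta> \<alpha> has_derivative
     (\<lambda>h. \<Sum>e\<in>Basis. (h \<bullet> e) * product_jet \<psi> \<eta> (\<alpha>(e := Suc (\<alpha> e))) x)) (at x)" by simp
qed

lemma test_jet_product:
  assumes "smooth \<psi>" "smooth \<eta>"
    and "\<And>y. \<psi> y \<noteq> 0 \<Longrightarrow> c \<le> y \<and> y \<le> d" "0 < c" "d < b"
    and "\<And>t. \<eta> t \<noteq> 0 \<Longrightarrow> c' \<le> t \<and> t \<le> d'" "0 < c'" "d' < T"
  shows "test_jet (rect b T) (product_jet \<psi> \<eta>)"
proof -
  have sub: "closure {x. product_jet \<psi> \<eta> (\<lambda>_. 0) x \<noteq> 0} \<subseteq> {c..d} \<times> {c'..d'}"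
    using assms by (intro closure_minimal closed_Times) (auto simp: product_jet_def)
  then have "compact (closure {x. product_jet \<psi> \<eta> (\<lambda>_. 0) x \<noteq> 0})"
    using compact_Times[OF compact_Icc compact_Icc, of c d c' d']
    by (metis closed_closure compact_Int_closed inf.absorb_iff2)
  moreover have "{c..d} \<times> {c'..d'} \<subseteq> rect b T" using assms by (auto simp: rect_def)
  ultimately show ?thesis
    using sub smooth_jet_product[OF assms(1,2)] by (auto simp: test_jet_def)
qed

section \<open>The fundamental lemma on a rectangle\<close>

lemma set_integral_as_restrict:
  fixes f :: "'a::euclidean_space \<Rightarrow> real"
  shows "\<Omega> \<in> sets borel \<Longrightarrow> (LINT x:\<Omega>|lborel. f x) = integral\<^sup>L (restrict_space lborel \<Omega>) f"
  by (simp add: set_lebesgue_integral_def integral_restrict_space)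

lemma set_integrable_as_restrict:
  fixes f :: "'a::euclidean_space \<Rightarrow> real"
  shows "\<Omega> \<in> sets borel \<Longrightarrow> set_integrable lborel \<Omega> f \<longleftrightarrow> integrable (restrict_space lborel \<Omega>) f"
  by (simp add: set_integrable_def integrable_restrict_space)

lemma square_integrable_iff_L2:
  "\<Omega> \<in> sets borel \<Longrightarrow> square_integrable \<Omega> u \<longleftrightarrow> u \<in> L2 (restrict_space lborel \<Omega>)"
  by (simp add: square_integrable_def L2_def set_integrable_as_restrict set_borel_measurable_def
      borel_measurable_restrict_space_iff)

lemma box_Pair_eq: "box (p1, p2) (q1, q2) = {p1<..<q1} \<times> {p2<..<q2}" for p1 q1 p2 q2 :: real
  by (auto simp: box_def Basis_prod_def)

definition multi_index :: "('a::euclidean_space \<Rightarrow> nat) \<Rightarrow> bool" where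
  "multi_index \<alpha> \<longleftrightarrow> (\<forall>e. e \<notin> Basis \<longrightarrow> \<alpha> e = 0)"

lemma multi_index_0 [simp]: "multi_index (\<lambda>_. 0)"
  by (simp add: multi_index_def)

locale rectangle =
  fixes b T :: real
  assumes b_pos: "0 < b" and T_pos: "0 < T"
begin

abbreviation "R \<equiv> rect b T"
abbreviation "\<mu> \<equiv> restrict_space lborel R"

lemma open_rect: "open R" unfolding rect_def by (intro open_Times) auto

lemma rect_borel [measurable, simp]: "R \<in> sets borel" using open_rect by simp

lemma emeasure_rect: "emeasure lborel R = ennreal (b * T)"
proof -
  have "emeasure lborel R = emeasure lborel {0<..<b} * emeasure lborel {0<..<T}"
    unfolding rect_def lborel_prod[symmetric] by (rule lborel.emeasure_pair_measure_Times) auto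
  then show ?thesis using b_pos T_pos by (simp add: ennreal_mult)
qed

lemma space_mu [simp]: "space \<mu> = R" by simp

lemma AE_mu: "(AE x in \<mu>. P x) \<longleftrightarrow> (AE x in lborel. x \<in> R \<longrightarrow> P x)"
  by (subst AE_restrict_space_iff) auto

lemma emeasure_mu: "emeasure \<mu> R = ennreal (b * T)"
  by (subst emeasure_restrict_space) (auto simp: emeasure_rect)

sublocale finite_measure \<mu>
  by (rule finite_measureI) (simp add: emeasure_mu)

lemma measure_mu: "measure \<mu> R = b * T"
  using b_pos T_pos by (simp add: measure_def emeasure_mu)

lemma square_integrable_mu: "square_integrable R u \<longleftrightarrow> u \<in> L2 \<mu>"
  by (rule square_integrable_iff_L2) simp

lemma continuous_measurable_mu:
  "continuous_on UNIV f \<Longrightarrow> f \<in> borel_measurable \<mu>"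
  for f :: "real \<times> real \<Rightarrow> real"
  by (intro measurable_restrict_space1) (simp add: borel_measurable_continuous_onI)

lemma integrable_imp_locally_integrable:
  assumes "integrable \<mu> u" shows "locally_integrable R u"
  unfolding locally_integrable_def
proof (intro allI impI, elim conjE)
  fix K assume K: "compact K" "K \<subseteq> R"
  have "set_integrable lborel R u" using assms by (simp add: set_integrable_as_restrict)
  then show "set_integrable lborel K u"
    by (rule set_integrable_subset) (use K in \<open>auto intro: borel_compact\<close>)
qed

lemma L2_imp_locally_integrable: "u \<in> L2 \<mu> \<Longrightarrow> locally_integrable R u"
  by (intro integrable_imp_locally_integrable L2_integrable)

definition inner_box :: "nat \<Rightarrow> (real \<times> real) set" where
  "inner_box n = box (b / (real n + 2), T / (real n + 2)) (b - b / (real n + 2), T - T / (real n + 2))"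

lemma inner_box_exhausts:
  assumes "x \<in> R"
  shows "\<forall>\<^sub>F n in sequentially. x \<in> inner_box n"
proof -
  obtain y t where x: "x = (y, t)" "0 < y" "y < b" "0 < t" "t < T"
    using assms by (auto simp: rect_def)
  have lim: "(\<lambda>n. c / (real n + 2)) \<longlonglongrightarrow> 0" for c
    using LIMSEQ_ignore_initial_segment[OF lim_const_over_n[of c], of 2] by (simp add: algebra_simps)
  have "\<forall>\<^sub>F n in sequentially. b / (real n + 2) < y" "\<forall>\<^sub>F n in sequentially. b / (real n + 2) < b - y"
    "\<forall>\<^sub>F n in sequentially. T / (real n + 2) < t" "\<forall>\<^sub>F n in sequentially. T / (real n + 2) < T - t"
    using x by (auto intro!: order_tendstoD(2)[OF lim])
  then show ?thesis
    by eventually_elim (auto simp: inner_box_def x box_Pair_eq)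
qed

lemma inner_box_compact:
  obtains K where "compact K" "inner_box n \<subseteq> K" "K \<subseteq> R"
proof
  let ?K = "cbox (b / (real n + 2), T / (real n + 2)) (b - b / (real n + 2), T - T / (real n + 2))"
  show "compact ?K" "inner_box n \<subseteq> ?K" by (auto simp: inner_box_def box_subset_cbox)
  have "0 < b / (real n + 2)" "0 < T / (real n + 2)" using b_pos T_pos by simp_all
  then show "?K \<subseteq> R" by (auto simp: rect_def cbox_Pair_eq)
qed

lemma locally_integrable_inner_box:
  assumes "locally_integrable R u"
  shows "set_integrable lborel (inner_box n) u"
proof -
  obtain K where K: "compact K" "inner_box n \<subseteq> K" "K \<subseteq> R" by (rule inner_box_compact)
  then have "set_integrable lborel K u" using assms by (auto simp: locally_integrable_def)
  then show ?thesis by (rule set_integrable_subset) (use K in \<open>auto simp: inner_box_def\<close>)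
qed

text \<open>
  Local integrability yields Borel measurability on compact subsets only; the inner boxes exhaust
  the rectangle.
\<close>

lemma locally_integrable_measurable:
  assumes "locally_integrable R u" shows "u \<in> borel_measurable \<mu>"
proof -
  have "(\<lambda>x. indicator (R \<inter> inner_box n) x *\<^sub>R u x) \<in> borel_measurable borel" for n
  proof -
    have "(\<lambda>x. indicator (inner_box n) x *\<^sub>R u x) \<in> borel_measurable borel"
      using locally_integrable_inner_box[OF assms, of n] by (auto simp: set_integrable_def)
    then have "(\<lambda>x. indicator R x *\<^sub>R (indicator (inner_box n) x *\<^sub>R u x)) \<in> borel_measurable borel"
      by measurable
    then show ?thesis by (simp add: indicator_inter_arith mult.assoc)
  qed
  then have "(\<lambda>x. indicator R x *\<^sub>R u x) \<in> borel_measurable borel"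
  proof (rule borel_measurable_LIMSEQ_real[rotated])
    fix x :: "real \<times> real"
    show "(\<lambda>n. indicator (R \<inter> inner_box n) x *\<^sub>R u x) \<longlonglongrightarrow> indicator R x *\<^sub>R u x"
    proof (cases "x \<in> R")
      case True
      have "\<forall>\<^sub>F n in sequentially. indicator (R \<inter> inner_box n) x *\<^sub>R u x = indicator R x *\<^sub>R u x"
        using inner_box_exhausts[OF True] by eventually_elim (auto simp: True)
      then show ?thesis by (rule tendsto_eventually)
    qed simp
  qed
  then show ?thesis by (simp add: borel_measurable_restrict_space_iff)
qed

lemma test_product_integrable:
  assumes u: "locally_integrable R u" and D: "test_jet R D" and \<alpha>: "multi_index \<alpha>"
  shows "integrable \<mu> (\<lambda>x. u x * D \<alpha> x)"
proof -
  obtain K where K: "compact K" "K \<subseteq> R" "\<And>x. D \<alpha> x \<noteq> 0 \<Longrightarrow> x \<in> K"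
    using test_jet_support[OF D] \<alpha> unfolding multi_index_def by metis
  obtain B where B: "\<And>x. \<bar>D \<alpha> x\<bar> \<le> B"
    using test_jet_bounded[OF D] \<alpha> unfolding multi_index_def by metis
  have [measurable]: "D \<alpha> \<in> borel_measurable borel"
    by (intro borel_measurable_continuous_onI smooth_jet_continuous test_jet_smooth[OF D])
  have "integrable lborel (\<lambda>x. indicator K x *\<^sub>R u x)"
    using u K by (auto simp: locally_integrable_def set_integrable_def)
  then have int: "integrable lborel (\<lambda>x. B * (indicator K x *\<^sub>R u x))" 
    and [measurable]: "(\<lambda>x. indicator K x *\<^sub>R u x) \<in> borel_measurable borel" by auto
  have "integrable lborel (\<lambda>x. D \<alpha> x * (indicator K x *\<^sub>R u x))"
  proof (rule Bochner_Integration.integrable_bound[OF int])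
    have "\<bar>D \<alpha> x\<bar> * \<bar>u x\<bar> \<le> \<bar>B\<bar> * \<bar>u x\<bar>" for x
      using B[of x] by (intro mult_right_mono) auto
    then show "AE x in lborel. norm (D \<alpha> x * (indicator K x *\<^sub>R u x)) \<le> norm (B * (indicator K x *\<^sub>R u x))"
      by (auto intro!: AE_I2 simp: indicator_def abs_mult)
  qed measurable
  also have "(\<lambda>x. D \<alpha> x * (indicator K x *\<^sub>R u x)) = (\<lambda>x. indicator R x *\<^sub>R (u x * D \<alpha> x))"
  proof
    fix x show "D \<alpha> x * (indicator K x *\<^sub>R u x) = indicator R x *\<^sub>R (u x * D \<alpha> x)"
      using K(2) K(3)[of x] by (cases "D \<alpha> x = 0") (auto simp: indicator_def)
  qed
  finally show ?thesis by (simp add: integrable_restrict_space)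
qed

text \<open>
  The fundamental lemma of the calculus of variations: products of bumps are test functions and
  converge boundedly to the indicator functions of boxes, so the integrals of \<open>v\<close> over all boxes
  inside the rectangle vanish. An exhaustion is needed because \<open>v\<close> is integrable only locally.
\<close>

lemma AE_zero_if_test_integrals_zero:
  assumes v: "locally_integrable R v"
    and zero: "\<And>D. test_jet R D \<Longrightarrow> (LINT x|\<mu>. v x * D (\<lambda>_. 0) x) = 0"
  shows "AE x in \<mu>. v x = 0"
proof -
  note locally_integrable_measurable[OF v, measurable]
  have AE_inner: "AE x in lborel. indicator (inner_box n) x *\<^sub>R v x = 0" for n
  proof (rule AE_zero_if_box_integrals_zero)
    show int: "integrable lborel (\<lambda>x. indicator (inner_box n) x *\<^sub>R v x)"
      using locally_integrable_inner_box[OF v, of n] by (simp add: set_integrable_def)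
    fix p q :: "real \<times> real"
    define c where "c = (b / (real n + 2), T / (real n + 2))"
    define d where "d = (b - b / (real n + 2), T - T / (real n + 2))"
    define p1 q1 p2 q2 where "p1 = max (fst p) (fst c)" "q1 = min (fst q) (fst d)"
      "p2 = max (snd p) (snd c)" "q2 = min (snd q) (snd d)"
    have box: "box p q \<inter> inner_box n = {p1<..<q1} \<times> {p2<..<q2}"
      by (cases p; cases q) (auto simp: p1_q1_p2_q2_def inner_box_def c_def d_def box_Pair_eq)
    have bd: "0 < p1" "q1 < b" "0 < p2" "q2 < T"
    proof -
      have "0 < b / (real n + 2)" "0 < T / (real n + 2)" using b_pos T_pos by simp_all
      then show "0 < p1" "q1 < b" "0 < p2" "q2 < T"
        by (auto simp: p1_q1_p2_q2_def c_def d_def)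
    qed
    define j where "j m = product_jet (bump p1 q1 m) (bump p2 q2 m) (\<lambda>_. 0)" for m
    have supp: "p \<le> y \<and> y \<le> q" if "bump p q m y \<noteq> 0" for p q m y
      using bump_le_indicator[of p q m y] bump_bounds(1)[of p q m y] that
      by (cases "y \<in> {p<..<q}") auto
    have tj: "test_jet R (product_jet (bump p1 q1 m) (bump p2 q2 m))" for m
      using supp bd by (intro test_jet_product[where c = p1 and d = q1 and c' = p2 and d' = q2] smooth_bump) auto
    have j_lim: "(\<lambda>m. j m x) \<longlonglongrightarrow> indicator (box p q \<inter> inner_box n) x" for x
    proof -
      have "(\<lambda>m. bump p1 q1 m (fst x) * bump p2 q2 m (snd x))
         \<longlonglongrightarrow> indicator {p1<..<q1} (fst x) * indicator {p2<..<q2} (snd x)"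
        by (intro tendsto_mult bump_tendsto)
      then show ?thesis unfolding box
        by (simp add: j_def product_jet_def case_prod_beta indicator_times)
    qed
    have j_le: "0 \<le> j m x" "j m x \<le> indicator (box p q \<inter> inner_box n) x" for m x
    proof -
      show "0 \<le> j m x" by (auto simp: j_def product_jet_def case_prod_beta bump_bounds)
      have "j m x \<le> indicator {p1<..<q1} (fst x) * indicator {p2<..<q2} (snd x)"
        using bump_le_indicator bump_bounds(1)
        by (auto simp: j_def product_jet_def case_prod_beta intro!: mult_mono simp del: indicator_simps)
      then show "j m x \<le> indicator (box p q \<inter> inner_box n) x"
        unfolding box by (simp add: indicator_times)
    qed
    have [measurable]: "j m \<in> borel_measurable borel" for m
      unfolding j_def by (rule borel_measurable_continuous_onI) (rule smooth_jet_continuous[OF test_jet_smooth[OF tj]])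
    have vm [measurable]: "(\<lambda>x. indicator (inner_box n) x *\<^sub>R v x) \<in> borel_measurable borel"
      using int by auto
    have prod_eq: "j m x * (indicator (inner_box n) x *\<^sub>R v x) = indicator R x *\<^sub>R (v x * j m x)" for m x
    proof (cases "j m x = 0")
      case False
      then have "x \<in> box p q \<inter> inner_box n"
        using j_le[of m x] by (cases "x \<in> box p q \<inter> inner_box n") simp_all
      moreover have "inner_box n \<subseteq> R" by (rule inner_box_compact[of n]) (rule subset_trans)
      ultimately have "indicator (inner_box n) x = (1 :: real)" "indicator R x = (1 :: real)" by auto
      then show ?thesis by simp
    qed simp
    have "(\<lambda>m. LINT x|lborel. j m x * (indicator (inner_box n) x *\<^sub>R v x))
       \<longlonglongrightarrow> (LINT x|lborel. indicator (box p q \<inter> inner_box n) x * (indicator (inner_box n) x *\<^sub>R v x))"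
    proof (rule integral_dominated_convergence[where w = "\<lambda>x. norm (indicator (inner_box n) x *\<^sub>R v x)"])
      show "AE x in lborel. (\<lambda>m. j m x * (indicator (inner_box n) x *\<^sub>R v x)) \<longlonglongrightarrow>
          indicator (box p q \<inter> inner_box n) x * (indicator (inner_box n) x *\<^sub>R v x)"
        by (intro AE_I2 tendsto_mult j_lim tendsto_const)
      show "AE x in lborel. norm (j m x * (indicator (inner_box n) x *\<^sub>R v x)) \<le> norm (indicator (inner_box n) x *\<^sub>R v x)" for m
      proof (rule AE_I2)
        fix x
        have "j m x \<le> 1" using j_le(2)[of m x] by (rule order_trans) (simp add: indicator_def)
        then show "norm (j m x * (indicator (inner_box n) x *\<^sub>R v x)) \<le> norm (indicator (inner_box n) x *\<^sub>R v x)"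
          using j_le(1)[of m x] by (simp add: abs_mult mult_left_le_one_le)
      qed
      have [measurable]: "inner_box n \<in> sets borel" by (simp add: inner_box_def)
      show "(\<lambda>x. indicator (box p q \<inter> inner_box n) x * (indicator (inner_box n) x *\<^sub>R v x)) \<in> borel_measurable lborel"
        by measurable
      show "integrable lborel (\<lambda>x. norm (indicator (inner_box n) x *\<^sub>R v x))"
        by (rule integrable_norm[OF int])
    qed measurable
    moreover have "(LINT x|lborel. j m x * (indicator (inner_box n) x *\<^sub>R v x)) = 0" for m
      using zero[OF tj[of m]] unfolding prod_eq by (simp add: integral_restrict_space j_def)
    ultimately have "(LINT x|lborel. indicator (box p q \<inter> inner_box n) x * (indicator (inner_box n) x *\<^sub>R v x)) = 0"
      by (simp add: LIMSEQ_const_iff)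
    moreover have "(\<lambda>x. indicator (box p q \<inter> inner_box n) x * (indicator (inner_box n) x *\<^sub>R v x))
        = (\<lambda>x. indicator (box p q) x *\<^sub>R (indicator (inner_box n) x *\<^sub>R v x))"
      by (intro ext) (auto simp: indicator_def)
    ultimately show "(LINT x:box p q|lborel. indicator (inner_box n) x *\<^sub>R v x) = 0"
      unfolding set_lebesgue_integral_def by simp
  qed
  have "AE x in lborel. \<forall>n. indicator (inner_box n) x *\<^sub>R v x = 0"
    using AE_inner unfolding AE_all_countable by blast
  then have "AE x in lborel. x \<in> R \<longrightarrow> v x = 0"
  proof eventually_elim
    case (elim x)
    show ?case
    proof
      assume "x \<in> R"
      from inner_box_exhausts[OF this] obtain n where "x \<in> inner_box n"
        by (auto simp: eventually_sequentially)
      then show "v x = 0" using elim[rule_format, of n] by simp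
    qed
  qed
  then show ?thesis by (simp add: AE_mu)
qed

section \<open>Calculus of weak derivatives\<close>

lemma has_weak_deriv_mu:
  "has_weak_deriv R \<alpha> u v \<longleftrightarrow> locally_integrable R u \<and> locally_integrable R v \<and>
     (\<forall>D. test_jet R D \<longrightarrow>
        (LINT x|\<mu>. u x * D \<alpha> x) = (-1) ^ (\<Sum>e\<in>Basis. \<alpha> e) * (LINT x|\<mu>. v x * D (\<lambda>_. 0) x))"
  by (simp add: has_weak_deriv_def set_integral_as_restrict)

lemma locally_integrable_lincomb:
  "locally_integrable R u \<Longrightarrow> locally_integrable R v \<Longrightarrow> locally_integrable R (\<lambda>x. u x + c * v x)"
  by (auto simp: locally_integrable_def)

lemma has_weak_deriv_lincomb:
  assumes "multi_index \<alpha>" "has_weak_deriv R \<alpha> u v" "has_weak_deriv R \<alpha> u' v'"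
  shows "has_weak_deriv R \<alpha> (\<lambda>x. u x + c * u' x) (\<lambda>x. v x + c * v' x)"
  unfolding has_weak_deriv_mu
proof (intro conjI allI impI)
  fix D assume D: "test_jet R D"
  have int: "(LINT x|\<mu>. (w x + c * w' x) * D \<beta> x) = (LINT x|\<mu>. w x * D \<beta> x) + c * (LINT x|\<mu>. w' x * D \<beta> x)"
    if "locally_integrable R w" "locally_integrable R w'" "multi_index \<beta>" for w w' \<beta>
  proof -
    have "integrable \<mu> (\<lambda>x. w x * D \<beta> x)" "integrable \<mu> (\<lambda>x. w' x * D \<beta> x)"
      using that D by (auto intro: test_product_integrable)
    then have "(LINT x|\<mu>. w x * D \<beta> x + c * (w' x * D \<beta> x)) = (LINT x|\<mu>. w x * D \<beta> x) + c * (LINT x|\<mu>. w' x * D \<beta> x)"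
      by simp
    then show ?thesis by (simp add: algebra_simps)
  qed
  show "(LINT x|\<mu>. (u x + c * u' x) * D \<alpha> x) =
      (-1) ^ (\<Sum>e\<in>Basis. \<alpha> e) * (LINT x|\<mu>. (v x + c * v' x) * D (\<lambda>_. 0) x)"
    using assms D by (subst (1 2) int) (auto simp: has_weak_deriv_mu algebra_simps)
qed (use assms in \<open>auto simp: has_weak_deriv_mu intro: locally_integrable_lincomb\<close>)

text \<open>
  This is why the choice of a representative in the definition of the weak derivative is harmless.
\<close>

lemma has_weak_deriv_unique:
  assumes "has_weak_deriv R \<alpha> u v" "has_weak_deriv R \<alpha> u v'"
  shows "AE x in \<mu>. v x = v' x"
proof -
  have "AE x in \<mu>. v x + (-1) * v' x = 0"
  proof (rule AE_zero_if_test_integrals_zero)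
    show "locally_integrable R (\<lambda>x. v x + (-1) * v' x)"
      using assms by (intro locally_integrable_lincomb) (auto simp: has_weak_deriv_mu)
    fix D assume D: "test_jet R D"
    have "(-1) ^ (\<Sum>e\<in>Basis. \<alpha> e) * (LINT x|\<mu>. v x * D (\<lambda>_. 0) x) = (-1) ^ (\<Sum>e\<in>Basis. \<alpha> e) * (LINT x|\<mu>. v' x * D (\<lambda>_. 0) x)"
      using assms D by (simp add: has_weak_deriv_mu)
    then have eq: "(LINT x|\<mu>. v x * D (\<lambda>_. 0) x) = (LINT x|\<mu>. v' x * D (\<lambda>_. 0) x)" by simp
    have "integrable \<mu> (\<lambda>x. v x * D (\<lambda>_. 0) x)" "integrable \<mu> (\<lambda>x. v' x * D (\<lambda>_. 0) x)"
      using assms D by (auto intro!: test_product_integrable simp: has_weak_deriv_mu)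
    then show "(LINT x|\<mu>. (v x + (-1) * v' x) * D (\<lambda>_. 0) x) = 0"
      using eq by (simp add: left_diff_distrib)
  qed
  then show ?thesis by simp
qed

lemma has_weak_deriv_zero_order: "locally_integrable R u \<Longrightarrow> has_weak_deriv R (\<lambda>_. 0) u u"
  by (simp add: has_weak_deriv_mu)

lemma locally_integrable_cong_AE:
  assumes u: "locally_integrable R u" and eq: "AE x in \<mu>. u x = u' x" and u': "u' \<in> borel_measurable \<mu>"
  shows "locally_integrable R u'"
  unfolding locally_integrable_def
proof (intro allI impI, elim conjE)
  fix K assume K: "compact K" "K \<subseteq> R"
  then have KR: "K \<in> sets borel" by (auto intro: borel_compact)
  have "(\<lambda>x. indicator R x *\<^sub>R u' x) \<in> borel_measurable borel"
    using u' by (simp add: borel_measurable_restrict_space_iff)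
  then have "(\<lambda>x. indicator K x *\<^sub>R (indicator R x *\<^sub>R u' x)) \<in> borel_measurable borel"
    using KR by measurable
  moreover have "(\<lambda>x. indicator K x *\<^sub>R (indicator R x *\<^sub>R u' x)) = (\<lambda>x. indicator K x *\<^sub>R u' x)"
    using K by (intro ext) (auto simp: indicator_def)
  ultimately have m: "(\<lambda>x. indicator K x *\<^sub>R u' x) \<in> borel_measurable borel" by simp
  have int: "integrable lborel (\<lambda>x. indicator K x *\<^sub>R u x)"
    using u K by (auto simp: locally_integrable_def set_integrable_def)
  have "AE x in lborel. indicator K x *\<^sub>R u x = indicator K x *\<^sub>R u' x"
    using eq unfolding AE_mu by eventually_elim (use K in \<open>auto simp: indicator_def\<close>)
  then show "set_integrable lborel K u'"
    using int m unfolding set_integrable_def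
    by (subst integrable_cong_AE[where g = "\<lambda>x. indicator K x *\<^sub>R u x"]) auto
qed

text \<open>
  Equality almost everywhere does not transfer Borel measurability, so the measurability of the new
  representatives is a hypothesis.
\<close>

lemma has_weak_deriv_cong_AE:
  assumes \<alpha>: "multi_index \<alpha>" and uv: "has_weak_deriv R \<alpha> u v"
    and u': "AE x in \<mu>. u x = u' x" "u' \<in> borel_measurable \<mu>"
    and v': "AE x in \<mu>. v x = v' x" "v' \<in> borel_measurable \<mu>"
  shows "has_weak_deriv R \<alpha> u' v'"
proof -
  have li: "locally_integrable R u" "locally_integrable R v" "locally_integrable R u'" "locally_integrable R v'"
    using uv u' v' locally_integrable_cong_AE by (auto simp: has_weak_deriv_mu)
  have int: "(LINT x|\<mu>. w x * D \<beta> x) = (LINT x|\<mu>. w' x * D \<beta> x)"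
    if "locally_integrable R w" "locally_integrable R w'" "multi_index \<beta>" "AE x in \<mu>. w x = w' x" "test_jet R D" for w w' \<beta> D
    using that(4) test_product_integrable[OF that(1,5,3)] test_product_integrable[OF that(2,5,3)]
    by (intro integral_cong_AE) auto
  show ?thesis
    unfolding has_weak_deriv_mu
  proof (intro conjI allI impI)
    fix D assume D: "test_jet R D"
    have "(LINT x|\<mu>. u' x * D \<alpha> x) = (LINT x|\<mu>. u x * D \<alpha> x)"
      by (rule int[OF li(1,3) \<alpha> u'(1) D, symmetric])
    moreover have "(LINT x|\<mu>. v' x * D (\<lambda>_. 0) x) = (LINT x|\<mu>. v x * D (\<lambda>_. 0) x)"
      by (rule int[OF li(2,4) multi_index_0 v'(1) D, symmetric])
    ultimately show "(LINT x|\<mu>. u' x * D \<alpha> x) = (-1) ^ (\<Sum>e\<in>Basis. \<alpha> e) * (LINT x|\<mu>. v' x * D (\<lambda>_. 0) x)"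
      using uv D by (simp add: has_weak_deriv_mu)
  qed (use li in auto)
qed

text \<open>
  If \<open>v\<close> is the derivative of order \<open>\<alpha>\<close> of \<open>u\<close>, then a derivative of order \<open>\<beta> + \<alpha>\<close> of \<open>u\<close>
  is one of order \<open>\<beta>\<close> of \<open>v\<close>, because derivatives of test functions are test functions.
\<close>

lemma has_weak_deriv_compose:
  assumes \<alpha>: "multi_index \<alpha>" and \<beta>: "multi_index \<beta>" and uv: "has_weak_deriv R \<alpha> u v"
    and uw: "has_weak_deriv R (\<lambda>e. \<beta> e + \<alpha> e) u w"
  shows "has_weak_deriv R \<beta> v w"
  unfolding has_weak_deriv_mu
proof (intro conjI allI impI)
  fix D assume D: "test_jet R D"
  define s where "s = (\<Sum>e\<in>Basis. \<alpha> e)"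
  define r where "r = (\<Sum>e\<in>Basis. \<beta> e)"
  \<comment> \<open>Test \<open>v = D\<^sup>\<alpha> u\<close> with the jet that starts at the derivative of order \<open>\<beta>\<close>.\<close>
  have "test_jet R (\<lambda>\<gamma>. D (\<lambda>e. \<gamma> e + \<beta> e))"
    using test_jet_shift[OF D] \<beta> by (simp add: multi_index_def)
  then have "(LINT x|\<mu>. u x * D (\<lambda>e. \<alpha> e + \<beta> e) x) = (-1) ^ s * (LINT x|\<mu>. v x * D (\<lambda>e. 0 + \<beta> e) x)"
    using uv[unfolded has_weak_deriv_mu, THEN conjunct2, THEN conjunct2, rule_format] by (fastforce simp: s_def)
  moreover have "(LINT x|\<mu>. u x * D (\<lambda>e. \<beta> e + \<alpha> e) x) = (-1) ^ (r + s) * (LINT x|\<mu>. w x * D (\<lambda>_. 0) x)"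
    using uw D by (simp add: has_weak_deriv_mu r_def s_def sum.distrib)
  ultimately have "(-1) ^ s * (LINT x|\<mu>. v x * D \<beta> x) = (-1) ^ s * ((-1) ^ r * (LINT x|\<mu>. w x * D (\<lambda>_. 0) x))"
    by (simp add: add.commute power_add)
  then show "(LINT x|\<mu>. v x * D \<beta> x) = (-1) ^ (\<Sum>e\<in>Basis. \<beta> e) * (LINT x|\<mu>. w x * D (\<lambda>_. 0) x)"
    by (simp add: r_def)
qed (use assms in \<open>auto simp: has_weak_deriv_mu\<close>)

end

section \<open>Sobolev spaces on the rectangle\<close>

lemma multi_indices_multi_index: "\<alpha> \<in> multi_indices k \<Longrightarrow> multi_index \<alpha>"
  by (auto simp: multi_indices_def multi_index_def)

lemma zero_multi_indices [simp]: "(\<lambda>_. 0) \<in> multi_indices k"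
  by (auto simp: multi_indices_def)

lemma finite_multi_indices [simp]: "finite (multi_indices k :: ('a::euclidean_space \<Rightarrow> nat) set)"
proof (rule finite_subset)
  let ?F = "{f :: 'a \<Rightarrow> nat. \<forall>e. (e \<in> Basis \<longrightarrow> f e \<in> {..k}) \<and> (e \<notin> Basis \<longrightarrow> f e = 0)}"
  show "finite ?F" by (rule finite_set_of_finite_funs) auto
  show "multi_indices k \<subseteq> ?F"
  proof
    fix \<alpha> :: "'a \<Rightarrow> nat" assume \<alpha>: "\<alpha> \<in> multi_indices k"
    have "\<alpha> e \<le> k" if "e \<in> Basis" for e
      using \<alpha> member_le_sum[OF that, of \<alpha>] by (auto simp: multi_indices_def)
    then show "\<alpha> \<in> ?F" using \<alpha> by (auto simp: multi_indices_def)
  qed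
qed

lemma multi_indices_mono: "k \<le> l \<Longrightarrow> multi_indices k \<subseteq> multi_indices l"
  by (auto simp: multi_indices_def)

lemma multi_indices_add:
  "\<alpha> \<in> multi_indices k \<Longrightarrow> \<beta> \<in> multi_indices l \<Longrightarrow> (\<lambda>e. \<beta> e + \<alpha> e) \<in> multi_indices (l + k)"
  by (auto simp: multi_indices_def sum.distrib)

context rectangle
begin

abbreviation "wd \<equiv> weak_deriv R"

lemma has_weak_deriv_wd:
  assumes "has_weak_deriv R \<alpha> u v"
  shows "has_weak_deriv R \<alpha> u (wd \<alpha> u)" "AE x in \<mu>. wd \<alpha> u x = v x"
proof -
  show "has_weak_deriv R \<alpha> u (wd \<alpha> u)"
    unfolding weak_deriv_def by (rule someI[of "has_weak_deriv R \<alpha> u", OF assms])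
  then show "AE x in \<mu>. wd \<alpha> u x = v x" using assms by (rule has_weak_deriv_unique)
qed

lemma has_weak_deriv_measurable:
  assumes "has_weak_deriv R \<alpha> u v" shows "u \<in> borel_measurable \<mu>" "v \<in> borel_measurable \<mu>"
  using assms by (auto simp: has_weak_deriv_mu intro: locally_integrable_measurable)

lemma sobolevI:
  "(\<And>\<alpha>. \<alpha> \<in> multi_indices k \<Longrightarrow> \<exists>v. has_weak_deriv R \<alpha> u v \<and> v \<in> L2 \<mu>) \<Longrightarrow> u \<in> sobolev k R"
  by (auto simp: sobolev_def square_integrable_mu)

lemma sobolev_has_weak_deriv:
  assumes "u \<in> sobolev k R" "\<alpha> \<in> multi_indices k"
  shows "has_weak_deriv R \<alpha> u (wd \<alpha> u)" and "wd \<alpha> u \<in> L2 \<mu>"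
proof -
  obtain v where v: "has_weak_deriv R \<alpha> u v" "v \<in> L2 \<mu>"
    using assms by (auto simp: sobolev_def square_integrable_mu)
  show 1: "has_weak_deriv R \<alpha> u (wd \<alpha> u)" using v(1) by (rule has_weak_deriv_wd)
  have "AE x in \<mu>. v x = wd \<alpha> u x" using has_weak_deriv_wd(2)[OF v(1)] by auto
  then show "wd \<alpha> u \<in> L2 \<mu>"
    by (rule L2_cong_AE[OF v(2)]) (rule has_weak_deriv_measurable[OF 1])
qed

lemma sobolev_wd_0:
  assumes "u \<in> sobolev k R"
  shows "AE x in \<mu>. wd (\<lambda>_. 0) u x = u x" and "u \<in> L2 \<mu>"
proof -
  have hw: "has_weak_deriv R (\<lambda>_. 0) u (wd (\<lambda>_. 0) u)"
    by (rule sobolev_has_weak_deriv[OF assms]) simp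
  then have "has_weak_deriv R (\<lambda>_. 0) u u"
    by (intro has_weak_deriv_zero_order) (simp add: has_weak_deriv_mu)
  then show ae: "AE x in \<mu>. wd (\<lambda>_. 0) u x = u x" by (rule has_weak_deriv_wd)
  show "u \<in> L2 \<mu>"
    by (rule L2_cong_AE[OF sobolev_has_weak_deriv(2)[OF assms zero_multi_indices] ae])
      (rule has_weak_deriv_measurable[OF hw])
qed

lemma sobolev_mono: "k \<le> l \<Longrightarrow> sobolev l R \<subseteq> sobolev k R"
  using multi_indices_mono by (fastforce simp: sobolev_def)

lemma sobolev_lincomb: "u \<in> sobolev k R \<Longrightarrow> v \<in> sobolev k R \<Longrightarrow> (\<lambda>x. u x + c * v x) \<in> sobolev k R"
  by (rule sobolevI, rule exI, rule conjI,
      rule has_weak_deriv_lincomb[OF multi_indices_multi_index sobolev_has_weak_deriv(1) sobolev_has_weak_deriv(1)])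
    (auto intro: L2_lincomb sobolev_has_weak_deriv)

lemma wd_lincomb:
  assumes "u \<in> sobolev k R" "v \<in> sobolev k R" "\<alpha> \<in> multi_indices k"
  shows "AE x in \<mu>. wd \<alpha> (\<lambda>x. u x + c * v x) x = wd \<alpha> u x + c * wd \<alpha> v x"
  using assms by (intro has_weak_deriv_wd has_weak_deriv_lincomb sobolev_has_weak_deriv multi_indices_multi_index)

lemma sobolev_zero: "(\<lambda>_. 0) \<in> sobolev k R"
proof (rule sobolevI)
  fix \<alpha> show "\<exists>v. has_weak_deriv R \<alpha> (\<lambda>_. 0) v \<and> v \<in> L2 \<mu>"
    by (intro exI[of _ "\<lambda>_. 0"]) (simp add: has_weak_deriv_mu locally_integrable_def set_integrable_def L2_def)
qed

lemma sobolev_cmult: "u \<in> sobolev k R \<Longrightarrow> (\<lambda>x. c * u x) \<in> sobolev k R"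
  using sobolev_lincomb[OF sobolev_zero, of u k c] by simp

lemma sobolev_diff: "u \<in> sobolev k R \<Longrightarrow> v \<in> sobolev k R \<Longrightarrow> (\<lambda>x. u x - v x) \<in> sobolev k R"
  using sobolev_lincomb[of u k v "-1"] by simp

lemma wd_diff:
  assumes "u \<in> sobolev k R" "v \<in> sobolev k R" "\<alpha> \<in> multi_indices k"
  shows "AE x in \<mu>. wd \<alpha> (\<lambda>x. u x - v x) x = wd \<alpha> u x - wd \<alpha> v x"
  using wd_lincomb[OF assms, of "-1"] by simp

lemma sobolev_cong_AE:
  assumes "u \<in> sobolev k R" "AE x in \<mu>. u x = u' x" "u' \<in> borel_measurable \<mu>"
  shows "u' \<in> sobolev k R"
    and "\<And>\<alpha>. \<alpha> \<in> multi_indices k \<Longrightarrow> AE x in \<mu>. wd \<alpha> u' x = wd \<alpha> u x"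
proof -
  have hw: "has_weak_deriv R \<alpha> u' (wd \<alpha> u)" if "\<alpha> \<in> multi_indices k" for \<alpha>
    by (rule has_weak_deriv_cong_AE[OF multi_indices_multi_index[OF that]
          sobolev_has_weak_deriv(1)[OF assms(1) that] assms(2,3) AE_I2])
      (auto intro: has_weak_deriv_measurable sobolev_has_weak_deriv[OF assms(1) that])
  then show "u' \<in> sobolev k R"
    using sobolev_has_weak_deriv(2)[OF assms(1)] by (intro sobolevI) blast
  show "AE x in \<mu>. wd \<alpha> u' x = wd \<alpha> u x" if "\<alpha> \<in> multi_indices k" for \<alpha>
    using hw[OF that] by (rule has_weak_deriv_wd)
qed

lemma sobolev_inner_mu:
  "sobolev_inner k R u v = (\<Sum>\<alpha>\<in>multi_indices k. LINT x|\<mu>. wd \<alpha> u x * wd \<alpha> v x)"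
  by (simp add: sobolev_inner_def set_integral_as_restrict)

lemma sobolev_inner_commute: "sobolev_inner k R u v = sobolev_inner k R v u"
  by (simp add: sobolev_inner_mu mult.commute)

lemma sobolev_inner_nonneg: "0 \<le> sobolev_inner k R u u"
  by (auto simp: sobolev_inner_mu intro!: sum_nonneg)

lemma sobolev_inner_lincomb:
  assumes "u \<in> sobolev k R" "v \<in> sobolev k R" "w \<in> sobolev k R"
  shows "sobolev_inner k R (\<lambda>x. u x + c * v x) w = sobolev_inner k R u w + c * sobolev_inner k R v w"
proof -
  have "(LINT x|\<mu>. wd \<alpha> (\<lambda>x. u x + c * v x) x * wd \<alpha> w x)
     = (LINT x|\<mu>. wd \<alpha> u x * wd \<alpha> w x) + c * (LINT x|\<mu>. wd \<alpha> v x * wd \<alpha> w x)"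
    if \<alpha>: "\<alpha> \<in> multi_indices k" for \<alpha>
  proof -
    note D = sobolev_has_weak_deriv(2)[OF _ \<alpha>]
    note [measurable] = D[THEN L2_measurable]
    have "(LINT x|\<mu>. wd \<alpha> (\<lambda>x. u x + c * v x) x * wd \<alpha> w x)
        = (LINT x|\<mu>. wd \<alpha> u x * wd \<alpha> w x + c * (wd \<alpha> v x * wd \<alpha> w x))"
      using wd_lincomb[OF assms(1,2) \<alpha>, of c] D[OF sobolev_lincomb[OF assms(1,2), of c]] D[OF assms(1)] D[OF assms(2)] D[OF assms(3)]
      by (intro integral_cong_AE) (auto intro!: borel_measurable_times borel_measurable_add
          dest: L2_measurable elim!: AE_mp simp: algebra_simps)
    also have "\<dots> = (LINT x|\<mu>. wd \<alpha> u x * wd \<alpha> w x) + c * (LINT x|\<mu>. wd \<alpha> v x * wd \<alpha> w x)"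
      using L2_mult_integrable[OF D[OF assms(1)] D[OF assms(3)]] L2_mult_integrable[OF D[OF assms(2)] D[OF assms(3)]]
      by simp
    finally show ?thesis .
  qed
  then show ?thesis by (simp add: sobolev_inner_mu sum.distrib sum_distrib_left)
qed

lemma sobolev_norm_square: "(sobolev_norm k R u)\<^sup>2 = (\<Sum>\<alpha>\<in>multi_indices k. LINT x|\<mu>. (wd \<alpha> u x)\<^sup>2)"
  using sobolev_inner_nonneg[of k u] by (simp add: sobolev_norm_def) (simp add: sobolev_inner_mu power2_eq_square)

lemma sobolev_norm_nonneg [simp]: "0 \<le> sobolev_norm k R u"
  by (simp add: sobolev_norm_def sobolev_inner_nonneg)

lemma sobolev_norm_cong:
  assumes "\<And>\<alpha>. \<alpha> \<in> multi_indices k \<Longrightarrow> AE x in \<mu>. wd \<alpha> u x = f \<alpha> x"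
    and "u \<in> sobolev k R" "\<And>\<alpha>. \<alpha> \<in> multi_indices k \<Longrightarrow> f \<alpha> \<in> borel_measurable \<mu>"
  shows "(sobolev_norm k R u)\<^sup>2 = (\<Sum>\<alpha>\<in>multi_indices k. LINT x|\<mu>. (f \<alpha> x)\<^sup>2)"
  unfolding sobolev_norm_square
proof (intro sum.cong refl integral_cong_AE)
  fix \<alpha> :: "real \<times> real \<Rightarrow> nat" assume \<alpha>: "\<alpha> \<in> multi_indices k"
  show "(\<lambda>x. (wd \<alpha> u x)\<^sup>2) \<in> borel_measurable \<mu>" "(\<lambda>x. (f \<alpha> x)\<^sup>2) \<in> borel_measurable \<mu>"
    using sobolev_has_weak_deriv(2)[OF assms(2) \<alpha>, THEN L2_measurable] assms(3)[OF \<alpha>] by measurable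
  show "AE x in \<mu>. (wd \<alpha> u x)\<^sup>2 = (f \<alpha> x)\<^sup>2" using assms(1)[OF \<alpha>] by auto
qed

lemma sobolev_norm_cong_AE:
  assumes "u \<in> sobolev k R" "AE x in \<mu>. u x = u' x" "u' \<in> borel_measurable \<mu>"
  shows "sobolev_norm k R u' = sobolev_norm k R u"
proof -
  have "(sobolev_norm k R u')\<^sup>2 = (sobolev_norm k R u)\<^sup>2"
    unfolding sobolev_norm_square[of k u]
    using sobolev_cong_AE[OF assms] sobolev_has_weak_deriv(2)[OF assms(1), THEN L2_measurable]
    by (intro sobolev_norm_cong) auto
  then show ?thesis by simp
qed

lemma wd_norm_le:
  assumes "\<alpha> \<in> multi_indices k"
  shows "(LINT x|\<mu>. (wd \<alpha> u x)\<^sup>2) \<le> (sobolev_norm k R u)\<^sup>2"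
  unfolding sobolev_norm_square
  using assms by (intro member_le_sum) (auto intro: finite_multi_indices)

lemma sobolev_norm_mono: "k \<le> l \<Longrightarrow> sobolev_norm k R u \<le> sobolev_norm l R u"
  by (rule power2_le_imp_le) (auto simp: sobolev_norm_square intro!: sum_mono2 dest: multi_indices_mono)

text \<open>
  Adding \<open>\<alpha>\<close> maps the multi-indices of order at most \<open>l\<close> injectively into those of order at most
  \<open>l + k\<close>, so the norm of the derivative is a part of the norm of the function.
\<close>

lemma sobolev_deriv:
  assumes u: "u \<in> sobolev (l + k) R" and \<alpha>: "\<alpha> \<in> multi_indices k"
  shows "wd \<alpha> u \<in> sobolev l R"
    and "\<And>\<beta>. \<beta> \<in> multi_indices l \<Longrightarrow> AE x in \<mu>. wd \<beta> (wd \<alpha> u) x = wd (\<lambda>e. \<beta> e + \<alpha> e) u x"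
    and "sobolev_norm l R (wd \<alpha> u) \<le> sobolev_norm (l + k) R u"
proof -
  have \<alpha>': "\<alpha> \<in> multi_indices (l + k)" using \<alpha> multi_indices_mono[of k "l + k"] by auto
  have hw: "has_weak_deriv R \<beta> (wd \<alpha> u) (wd (\<lambda>e. \<beta> e + \<alpha> e) u)" if "\<beta> \<in> multi_indices l" for \<beta>
    using that \<alpha> by (intro has_weak_deriv_compose[OF _ _ sobolev_has_weak_deriv(1)[OF u \<alpha>']]
      sobolev_has_weak_deriv[OF u] multi_indices_add multi_indices_multi_index[of _ l] multi_indices_multi_index[of _ k])
  show mem: "wd \<alpha> u \<in> sobolev l R"
    using hw sobolev_has_weak_deriv(2)[OF u multi_indices_add[OF \<alpha>]] by (intro sobolevI) blast
  show eq: "AE x in \<mu>. wd \<beta> (wd \<alpha> u) x = wd (\<lambda>e. \<beta> e + \<alpha> e) u x" if "\<beta> \<in> multi_indices l" for \<beta>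
    using hw[OF that] by (rule has_weak_deriv_wd)
  have inj: "inj_on (\<lambda>\<beta> e. \<beta> e + \<alpha> e) (multi_indices l)"
    by (rule inj_onI) (auto simp: fun_eq_iff)
  have "(sobolev_norm l R (wd \<alpha> u))\<^sup>2 = (\<Sum>\<beta>\<in>multi_indices l. LINT x|\<mu>. (wd (\<lambda>e. \<beta> e + \<alpha> e) u x)\<^sup>2)"
    using eq mem sobolev_has_weak_deriv(2)[OF u multi_indices_add[OF \<alpha>], THEN L2_measurable]
    by (intro sobolev_norm_cong) auto
  also have "\<dots> = (\<Sum>\<gamma>\<in>(\<lambda>\<beta> e. \<beta> e + \<alpha> e) ` multi_indices l. LINT x|\<mu>. (wd \<gamma> u x)\<^sup>2)"
    by (simp add: sum.reindex[OF inj])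
  also have "\<dots> \<le> (sobolev_norm (l + k) R u)\<^sup>2"
    unfolding sobolev_norm_square by (intro sum_mono2) (auto intro: multi_indices_add[OF \<alpha>])
  finally show "sobolev_norm l R (wd \<alpha> u) \<le> sobolev_norm (l + k) R u"
    by (rule power2_le_imp_le) simp
qed

text \<open>
  A test function and its derivatives are bounded, so both sides of the defining identity are
  continuous with respect to \<open>L\<^sup>2\<close> convergence.
\<close>

lemma has_weak_deriv_limit:
  assumes \<alpha>: "multi_index \<alpha>" and hw: "\<And>n. has_weak_deriv R \<alpha> (u n) (v n)"
    and u: "\<And>n. u n \<in> L2 \<mu>" "U \<in> L2 \<mu>" "(\<lambda>n. LINT x|\<mu>. (u n x - U x)\<^sup>2) \<longlonglongrightarrow> 0"
    and v: "\<And>n. v n \<in> L2 \<mu>" "V \<in> L2 \<mu>" "(\<lambda>n. LINT x|\<mu>. (v n x - V x)\<^sup>2) \<longlonglongrightarrow> 0"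
  shows "has_weak_deriv R \<alpha> U V"
  unfolding has_weak_deriv_mu
proof (intro conjI allI impI)
  fix D assume D: "test_jet R D"
  have lim: "(\<lambda>n. LINT x|\<mu>. w n x * D \<beta> x) \<longlonglongrightarrow> (LINT x|\<mu>. W x * D \<beta> x)"
    if \<beta>: "multi_index \<beta>" and w: "\<And>n. w n \<in> L2 \<mu>" "W \<in> L2 \<mu>" "(\<lambda>n. LINT x|\<mu>. (w n x - W x)\<^sup>2) \<longlonglongrightarrow> 0"
    for w W \<beta>
  proof -
    obtain B where B: "\<And>x. \<bar>D \<beta> x\<bar> \<le> B"
      using test_jet_bounded[OF D] \<beta> unfolding multi_index_def by metis
    have D2: "D \<beta> \<in> L2 \<mu>"
      using B by (intro L2_bounded[of _ B] continuous_measurable_mu smooth_jet_continuous[OF test_jet_smooth[OF D]]) auto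
    define C where "C = (LINT x|\<mu>. (D \<beta> x)\<^sup>2)"
    have e1: "norm ((LINT x|\<mu>. w n x * D \<beta> x) - (LINT x|\<mu>. W x * D \<beta> x)) \<le> sqrt ((LINT x|\<mu>. (w n x - W x)\<^sup>2) * C)" for n
    proof -
      have "(LINT x|\<mu>. w n x * D \<beta> x) - (LINT x|\<mu>. W x * D \<beta> x) = (LINT x|\<mu>. (w n x - W x) * D \<beta> x)"
        using L2_mult_integrable[OF w(1) D2] L2_mult_integrable[OF w(2) D2] by (simp add: left_diff_distrib)
      moreover have "\<bar>LINT x|\<mu>. (w n x - W x) * D \<beta> x\<bar> \<le> (LINT x|\<mu>. \<bar>(w n x - W x) * D \<beta> x\<bar>)"
        using integral_norm_bound[of \<mu> "\<lambda>x. (w n x - W x) * D \<beta> x"] by simp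
      moreover have "\<dots> \<le> sqrt ((LINT x|\<mu>. (w n x - W x)\<^sup>2) * C)"
        unfolding C_def by (intro real_le_rsqrt L2_Cauchy_Schwarz L2_diff w D2)
      ultimately show ?thesis unfolding real_norm_def by linarith
    qed
    have e2: "(\<lambda>n. sqrt ((LINT x|\<mu>. (w n x - W x)\<^sup>2) * C)) \<longlonglongrightarrow> 0"
      using tendsto_real_sqrt[OF tendsto_mult_right[OF w(3), of C]] by simp
    have "(\<lambda>n. (LINT x|\<mu>. w n x * D \<beta> x) - (LINT x|\<mu>. W x * D \<beta> x)) \<longlonglongrightarrow> 0"
      by (rule Lim_null_comparison[OF always_eventually[OF allI] e2]) (rule e1)
    then show ?thesis by (rule LIM_zero_cancel)
  qed
  have "(\<lambda>n. LINT x|\<mu>. u n x * D \<alpha> x) \<longlonglongrightarrow> (LINT x|\<mu>. U x * D \<alpha> x)" by (rule lim[OF \<alpha> u])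
  moreover have "(\<lambda>n. (-1) ^ (\<Sum>e\<in>Basis. \<alpha> e) * (LINT x|\<mu>. v n x * D (\<lambda>_. 0) x))
      \<longlonglongrightarrow> (-1) ^ (\<Sum>e\<in>Basis. \<alpha> e) * (LINT x|\<mu>. V x * D (\<lambda>_. 0) x)"
    by (rule tendsto_mult_left[OF lim[OF multi_index_0 v]])
  moreover have "(LINT x|\<mu>. u n x * D \<alpha> x) = (-1) ^ (\<Sum>e\<in>Basis. \<alpha> e) * (LINT x|\<mu>. v n x * D (\<lambda>_. 0) x)" for n
    using hw D by (auto simp: has_weak_deriv_mu)
  ultimately show "(LINT x|\<mu>. U x * D \<alpha> x) = (-1) ^ (\<Sum>e\<in>Basis. \<alpha> e) * (LINT x|\<mu>. V x * D (\<lambda>_. 0) x)"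
    by (simp add: LIMSEQ_unique)
qed (use u v in \<open>auto intro: L2_imp_locally_integrable\<close>)

text \<open>
  All weak derivatives of a Cauchy sequence converge in \<open>L\<^sup>2\<close>, and by the preceding lemma their
  limits are the weak derivatives of the limit.
\<close>

lemma sobolev_complete:
  assumes f: "\<And>n. f n \<in> sobolev k R"
    and cauchy: "\<And>e. e > 0 \<Longrightarrow> \<exists>N. \<forall>m\<ge>N. \<forall>n\<ge>N. sobolev_norm k R (\<lambda>x. f m x - f n x) < e"
  obtains g where "g \<in> sobolev k R" "(\<lambda>n. sobolev_norm k R (\<lambda>x. f n x - g x)) \<longlonglongrightarrow> 0"
proof -
  have L2f: "wd \<alpha> (f n) \<in> L2 \<mu>" if "\<alpha> \<in> multi_indices k" for \<alpha> n
    by (rule sobolev_has_weak_deriv[OF f that])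
  have "\<exists>G. G \<in> L2 \<mu> \<and> (\<lambda>n. LINT x|\<mu>. (wd \<alpha> (f n) x - G x)\<^sup>2) \<longlonglongrightarrow> 0" if \<alpha>: "\<alpha> \<in> multi_indices k" for \<alpha>
  proof -
    have "\<exists>N. \<forall>m\<ge>N. \<forall>n\<ge>N. (LINT x|\<mu>. (wd \<alpha> (f m) x - wd \<alpha> (f n) x)\<^sup>2) < e" if e: "e > 0" for e
    proof -
      obtain N where N: "\<forall>m\<ge>N. \<forall>n\<ge>N. sobolev_norm k R (\<lambda>x. f m x - f n x) < sqrt e"
        using cauchy[of "sqrt e"] e by auto
      have "(LINT x|\<mu>. (wd \<alpha> (f m) x - wd \<alpha> (f n) x)\<^sup>2) < e" if "m \<ge> N" "n \<ge> N" for m n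
      proof -
        have "(LINT x|\<mu>. (wd \<alpha> (f m) x - wd \<alpha> (f n) x)\<^sup>2) = (LINT x|\<mu>. (wd \<alpha> (\<lambda>x. f m x - f n x) x)\<^sup>2)"
          using wd_diff[OF f f \<alpha>, of m n] L2f[OF \<alpha>, THEN L2_measurable]
            sobolev_has_weak_deriv(2)[OF sobolev_diff[OF f f] \<alpha>, THEN L2_measurable]
          by (intro integral_cong_AE) auto
        also have "\<dots> \<le> (sobolev_norm k R (\<lambda>x. f m x - f n x))\<^sup>2" by (rule wd_norm_le[OF \<alpha>])
        also have "\<dots> < (sqrt e)\<^sup>2" using N that by (intro power_strict_mono) auto
        finally show ?thesis using e by simp
      qed
      then show ?thesis by blast
    qed
    then obtain G where "G \<in> L2 \<mu>" "(\<lambda>n. LINT x|\<mu>. (wd \<alpha> (f n) x - G x)\<^sup>2) \<longlonglongrightarrow> 0"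
      by (rule L2_complete[of "\<lambda>n. wd \<alpha> (f n)", OF L2f[OF \<alpha>]])
    then show ?thesis by blast
  qed
  then have "\<forall>\<alpha>. \<exists>G. \<alpha> \<in> multi_indices k \<longrightarrow>
      G \<in> L2 \<mu> \<and> (\<lambda>n. LINT x|\<mu>. (wd \<alpha> (f n) x - G x)\<^sup>2) \<longlonglongrightarrow> 0" by blast
  from choice[OF this] obtain G where G: "\<And>\<alpha>. \<alpha> \<in> multi_indices k \<Longrightarrow> G \<alpha> \<in> L2 \<mu>"
    "\<And>\<alpha>. \<alpha> \<in> multi_indices k \<Longrightarrow> (\<lambda>n. LINT x|\<mu>. (wd \<alpha> (f n) x - G \<alpha> x)\<^sup>2) \<longlonglongrightarrow> 0"
    by blast
  define g where "g = G (\<lambda>_. 0)"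
  have fL2: "f n \<in> L2 \<mu>" for n by (rule sobolev_wd_0[OF f])
  have f_lim: "(\<lambda>n. LINT x|\<mu>. (f n x - g x)\<^sup>2) \<longlonglongrightarrow> 0"
  proof -
    have "(LINT x|\<mu>. (f n x - g x)\<^sup>2) = (LINT x|\<mu>. (wd (\<lambda>_. 0) (f n) x - g x)\<^sup>2)" for n
      using sobolev_wd_0(1)[OF f, of n] L2f[OF zero_multi_indices, THEN L2_measurable] fL2[THEN L2_measurable]
        G(1)[OF zero_multi_indices, THEN L2_measurable]
      by (intro integral_cong_AE) (auto simp: g_def)
    then show ?thesis using G(2)[OF zero_multi_indices] by (simp add: g_def)
  qed
  have hw: "has_weak_deriv R \<alpha> g (G \<alpha>)" if "\<alpha> \<in> multi_indices k" for \<alpha>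
    by (rule has_weak_deriv_limit[where u = f and v = "\<lambda>n. wd \<alpha> (f n)", OF multi_indices_multi_index[OF that]
          sobolev_has_weak_deriv(1)[OF f that] fL2 _ f_lim L2f[OF that] G(1)[OF that] G(2)[OF that]])
      (simp add: g_def G)
  have g: "g \<in> sobolev k R" using hw G(1) by (intro sobolevI) blast
  have sq: "(sobolev_norm k R (\<lambda>x. f n x - g x))\<^sup>2 = (\<Sum>\<alpha>\<in>multi_indices k. LINT x|\<mu>. (wd \<alpha> (f n) x - G \<alpha> x)\<^sup>2)" for n
  proof (rule sobolev_norm_cong)
    fix \<alpha> :: "real \<times> real \<Rightarrow> nat" assume \<alpha>: "\<alpha> \<in> multi_indices k"
    show "AE x in \<mu>. wd \<alpha> (\<lambda>x. f n x - g x) x = wd \<alpha> (f n) x - G \<alpha> x"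
      using wd_diff[OF f g \<alpha>, of n] has_weak_deriv_wd(2)[OF hw[OF \<alpha>]] by eventually_elim simp
    show "(\<lambda>x. wd \<alpha> (f n) x - G \<alpha> x) \<in> borel_measurable \<mu>"
      using L2_diff[OF L2f[OF \<alpha>] G(1)[OF \<alpha>]] by (rule L2_measurable)
  qed (intro sobolev_diff f g)
  have "(\<lambda>n. (sobolev_norm k R (\<lambda>x. f n x - g x))\<^sup>2)
     \<longlonglongrightarrow> (\<Sum>\<alpha>\<in>(multi_indices k :: (real \<times> real \<Rightarrow> nat) set). 0)"
    unfolding sq by (intro tendsto_sum G(2))
  then have "(\<lambda>n. sqrt ((sobolev_norm k R (\<lambda>x. f n x - g x))\<^sup>2)) \<longlonglongrightarrow> sqrt 0"
    by (intro tendsto_real_sqrt) simp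
  then show thesis using g by (intro that[of g]) simp_all
qed

end

section \<open>Integration by parts against tents\<close>

definition mixed :: "nat \<Rightarrow> nat \<Rightarrow> real \<times> real \<Rightarrow> nat" where
  "mixed i j = (\<lambda>_. 0)((1, 0) := i, (0, 1) := j)"

lemma mixed_simps [simp]: "mixed i j (1, 0) = i" "mixed i j (0, 1) = j"
  by (auto simp: mixed_def)

lemma mixed_in_multi_indices: "mixed i j \<in> multi_indices k \<longleftrightarrow> i + j \<le> k"
  by (auto simp: multi_indices_def sum_Basis_plane) (auto simp: mixed_def Basis_prod_def)

lemma lborel_product_integral:
  fixes F G :: "real \<Rightarrow> real"
  assumes F: "integrable lborel F" and G: "integrable lborel G"
  shows "(LINT z|lborel. F (fst z) * G (snd z)) = (LINT y|lborel. F y) * (LINT t|lborel. G t)"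
proof -
  have [measurable]: "F \<in> borel_measurable borel" "G \<in> borel_measurable borel"
    using F G by auto
  have int: "integrable (lborel \<Otimes>\<^sub>M lborel) (\<lambda>z. F (fst z) * G (snd z))"
  proof (rule lborel_pair.Fubini_integrable)
    show "(\<lambda>z. F (fst z) * G (snd z)) \<in> borel_measurable (lborel \<Otimes>\<^sub>M lborel)" by measurable
    show "integrable lborel (\<lambda>x. LINT y|lborel. norm (F (fst (x, y)) * G (snd (x, y))))"
      using F by (simp add: abs_mult)
    show "AE x in lborel. integrable lborel (\<lambda>y. F (fst (x, y)) * G (snd (x, y)))" using G by simp
  qed
  have "(LINT z|lborel. F (fst z) * G (snd z)) = (LINT x|lborel. LINT y|lborel. F x * G y)"
    using lborel_pair.integral_fst'[OF int] by (simp add: lborel_prod)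
  then show ?thesis by simp
qed

text \<open>
  The kernel \<open>k\<close> of the formula
  \<open>f t = (\<integral> f s ds) / L + \<integral> k t s * f' s ds\<close> on \<open>(0, L)\<close>, which follows from integration by parts
  on both sides of \<open>t\<close>.
\<close>

definition interval_kernel :: "real \<Rightarrow> real \<Rightarrow> real \<Rightarrow> real" where
  "interval_kernel L t s = s / L - (if t < s then 1 else 0)"

lemma interval_kernel_bound: "0 \<le> s \<Longrightarrow> s \<le> L \<Longrightarrow> \<bar>interval_kernel L t s\<bar> \<le> 1"
  by (cases "L = 0") (auto simp: interval_kernel_def abs_le_iff field_simps)

lemma interval_kernel_integral:
  assumes "p \<le> q"
  shows "(LINT t:{p<..<q}|lborel. interval_kernel L t s) = - tent L p q s"
proof -
  have i1: "set_integrable lborel {p<..<q} (\<lambda>_. s / L)" 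
    using assms by (auto simp: set_integrable_def emeasure_lborel_Ioo intro!: integrable_real_indicator integrable_mult_left)
  have i2: "integrable lborel (indicator ({p<..<q} \<inter> {..<s}) :: real \<Rightarrow> real)"
  proof (rule integrable_real_indicator)
    have "emeasure lborel ({p<..<q} \<inter> {..<s}) \<le> emeasure lborel {p<..<q}" by (intro emeasure_mono) auto
    then show "emeasure lborel ({p<..<q} \<inter> {..<s}) < \<infinity>"
      using assms by (auto simp: emeasure_lborel_Ioo top_unique less_top[symmetric])
  qed simp
  have "(LINT t:{p<..<q}|lborel. interval_kernel L t s)
      = (LINT t|lborel. s / L * indicator {p<..<q} t - indicator ({p<..<q} \<inter> {..<s}) t)"
    unfolding set_lebesgue_integral_def interval_kernel_def
    by (intro Bochner_Integration.integral_cong) (auto simp: indicator_def)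
  also have "\<dots> = s / L * (q - p) - measure lborel ({p<..<q} \<inter> {..<s})"
    using i1 i2 assms by (subst Bochner_Integration.integral_diff) (auto simp: set_integrable_def mult.commute)
  finally show ?thesis by (simp add: tent_def)
qed

lemma integrable_bounded_mult:
  fixes k v :: "'a \<Rightarrow> real"
  assumes v: "integrable M v" and [measurable]: "k \<in> borel_measurable M"
    and k: "\<And>z. z \<in> space M \<Longrightarrow> \<bar>k z\<bar> \<le> C"
  shows "integrable M (\<lambda>z. k z * v z)"
proof (rule Bochner_Integration.integrable_bound)
  have [measurable]: "v \<in> borel_measurable M" using v by auto
  show "(\<lambda>z. k z * v z) \<in> borel_measurable M" by measurable
  show "integrable M (\<lambda>z. C * \<bar>v z\<bar>)" using v by simp
  show "AE z in M. norm (k z * v z) \<le> norm (C * \<bar>v z\<bar>)"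
    using k by (intro AE_I2) (auto simp: abs_mult intro!: mult_right_mono intro: order_trans[OF _ abs_ge_self])
qed

context rectangle
begin

lemma fst_mu [measurable]: "fst \<in> borel_measurable \<mu>" and snd_mu [measurable]: "snd \<in> borel_measurable \<mu>"
proof -
  have "(fst :: real \<times> real \<Rightarrow> real) \<in> borel_measurable borel" "(snd :: real \<times> real \<Rightarrow> real) \<in> borel_measurable borel"
    by (intro borel_measurable_continuous_onI continuous_intros)+
  then show "fst \<in> borel_measurable \<mu>" "snd \<in> borel_measurable \<mu>"
    by (auto intro: measurable_restrict_space1)
qed

text \<open>
  The weak derivative is tested with products of test functions of one variable, and dominated
  convergence extends this to their bounded limits. In particular one may test with products of
  indicator functions and tents.
\<close>

lemma weak_deriv_product_formula:
  assumes uv: "has_weak_deriv R (mixed i j) u v" and u: "integrable \<mu> u" and v: "integrable \<mu> v"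
    and f: "test_limit b i f f'" and g: "test_limit T j g g'"
  shows "(LINT z|\<mu>. u z * (f' (fst z) * g' (snd z))) = (-1) ^ (i + j) * (LINT z|\<mu>. v z * (f (fst z) * g (snd z)))"
proof -
  obtain \<psi> B where \<psi>: "\<And>n. smooth (\<psi> n)"
    "\<And>n. \<exists>c d. 0 < c \<and> d < b \<and> (\<forall>x. \<psi> n x \<noteq> 0 \<longrightarrow> c \<le> x \<and> x \<le> d)"
    "\<And>n x. \<bar>\<psi> n x\<bar> \<le> B" "\<And>n x. \<bar>(deriv ^^ i) (\<psi> n) x\<bar> \<le> B"
    "\<And>x. 0 < x \<Longrightarrow> x < b \<Longrightarrow> (\<lambda>n. \<psi> n x) \<longlonglongrightarrow> f x"
    "\<And>x. 0 < x \<Longrightarrow> x < b \<Longrightarrow> (\<lambda>n. (deriv ^^ i) (\<psi> n) x) \<longlonglongrightarrow> f' x"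
    using f unfolding test_limit_def by blast
  obtain \<eta> C where \<eta>: "\<And>n. smooth (\<eta> n)"
    "\<And>n. \<exists>c d. 0 < c \<and> d < T \<and> (\<forall>x. \<eta> n x \<noteq> 0 \<longrightarrow> c \<le> x \<and> x \<le> d)"
    "\<And>n x. \<bar>\<eta> n x\<bar> \<le> C" "\<And>n x. \<bar>(deriv ^^ j) (\<eta> n) x\<bar> \<le> C"
    "\<And>x. 0 < x \<Longrightarrow> x < T \<Longrightarrow> (\<lambda>n. \<eta> n x) \<longlonglongrightarrow> g x"
    "\<And>x. 0 < x \<Longrightarrow> x < T \<Longrightarrow> (\<lambda>n. (deriv ^^ j) (\<eta> n) x) \<longlonglongrightarrow> g' x"
    using g unfolding test_limit_def by blast
  have B0: "0 \<le> B" using \<psi>(3)[of 0 0] by linarith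
  have lim: "(\<lambda>n. LINT z|\<mu>. w z * (F n (fst z) * G n (snd z))) \<longlonglongrightarrow> (LINT z|\<mu>. w z * (F' (fst z) * G' (snd z)))"
    if w: "integrable \<mu> w" and F: "\<And>n x. \<bar>F n x\<bar> \<le> B" "\<And>x. 0 < x \<Longrightarrow> x < b \<Longrightarrow> (\<lambda>n. F n x) \<longlonglongrightarrow> F' x"
      "\<And>n. smooth (F n)"
      and G: "\<And>n x. \<bar>G n x\<bar> \<le> C" "\<And>x. 0 < x \<Longrightarrow> x < T \<Longrightarrow> (\<lambda>n. G n x) \<longlonglongrightarrow> G' x" "\<And>n. smooth (G n)"
    for w F F' G G'
  proof (rule integral_dominated_convergence)
    have [measurable]: "F n \<in> borel_measurable borel" "G n \<in> borel_measurable borel" for n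
      using F(3) G(3) by (auto intro: borel_measurable_continuous_onI smooth_continuous)
    have [measurable]: "w \<in> borel_measurable \<mu>" using w by auto
    have tends: "(\<lambda>n. w z * (F n (fst z) * G n (snd z))) \<longlonglongrightarrow> w z * (F' (fst z) * G' (snd z))" if "z \<in> R" for z
      using that by (intro tendsto_mult tendsto_const F(2) G(2)) (auto simp: rect_def)
    then show "AE z in \<mu>. (\<lambda>n. w z * (F n (fst z) * G n (snd z))) \<longlonglongrightarrow> w z * (F' (fst z) * G' (snd z))"
      by (intro AE_I2) simp
    show meas: "(\<lambda>z. w z * (F n (fst z) * G n (snd z))) \<in> borel_measurable \<mu>" for n by measurable
    show "(\<lambda>z. w z * (F' (fst z) * G' (snd z))) \<in> borel_measurable \<mu>"
      by (rule borel_measurable_LIMSEQ_real[OF tends meas]) simp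
    show "integrable \<mu> (\<lambda>z. norm (w z) * (B * C))" using w by (intro integrable_mult_left integrable_norm)
    show "AE z in \<mu>. norm (w z * (F n (fst z) * G n (snd z))) \<le> norm (w z) * (B * C)" for n
      using F(1) G(1) B0 by (intro AE_I2) (auto simp: abs_mult intro!: mult_left_mono mult_mono)
  qed
  have tj: "test_jet R (product_jet (\<psi> n) (\<eta> n))" for n
  proof -
    obtain c d c' d' where "0 < c" "d < b" "\<forall>x. \<psi> n x \<noteq> 0 \<longrightarrow> c \<le> x \<and> x \<le> d"
      "0 < c'" "d' < T" "\<forall>x. \<eta> n x \<noteq> 0 \<longrightarrow> c' \<le> x \<and> x \<le> d'"
      using \<psi>(2)[of n] \<eta>(2)[of n] by blast
    then show ?thesis
      by (intro test_jet_product[where c = c and d = d and c' = c' and d' = d'] \<psi>(1) \<eta>(1)) auto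
  qed
  have eq: "(LINT z|\<mu>. u z * ((deriv ^^ i) (\<psi> n) (fst z) * (deriv ^^ j) (\<eta> n) (snd z)))
     = (-1) ^ (i + j) * (LINT z|\<mu>. v z * (\<psi> n (fst z) * \<eta> n (snd z)))" for n
  proof -
    have "(LINT z|\<mu>. u z * product_jet (\<psi> n) (\<eta> n) (mixed i j) z)
       = (-1) ^ (\<Sum>e\<in>Basis. mixed i j e) * (LINT z|\<mu>. v z * product_jet (\<psi> n) (\<eta> n) (\<lambda>_. 0) z)"
      using uv[unfolded has_weak_deriv_mu] tj[of n] by blast
    then show ?thesis by (simp add: product_jet_def case_prod_beta sum_Basis_plane)
  qed
  have 1: "(\<lambda>n. LINT z|\<mu>. u z * ((deriv ^^ i) (\<psi> n) (fst z) * (deriv ^^ j) (\<eta> n) (snd z)))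
     \<longlonglongrightarrow> (LINT z|\<mu>. u z * (f' (fst z) * g' (snd z)))"
    by (rule lim[OF u \<psi>(4,6) smooth_iterate_deriv[OF \<psi>(1)] \<eta>(4,6) smooth_iterate_deriv[OF \<eta>(1)]])
  have 2: "(\<lambda>n. LINT z|\<mu>. v z * (\<psi> n (fst z) * \<eta> n (snd z))) \<longlonglongrightarrow> (LINT z|\<mu>. v z * (f (fst z) * g (snd z)))"
    by (rule lim[OF v \<psi>(3,5,1) \<eta>(3,5,1)])
  show ?thesis
    by (rule LIMSEQ_unique[OF 1[unfolded eq] tendsto_mult_left[OF 2]])
qed

lemma mu_product_integral:
  fixes F G :: "real \<Rightarrow> real"
  assumes I: "0 \<le> p" "q \<le> b" "0 \<le> r" "s \<le> T"
    and F: "set_integrable lborel {p<..<q} F" and G: "set_integrable lborel {r<..<s} G"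
  shows "(LINT z|\<mu>. (indicator {p<..<q} (fst z) * F (fst z)) * (indicator {r<..<s} (snd z) * G (snd z)))
     = (LINT y:{p<..<q}|lborel. F y) * (LINT t:{r<..<s}|lborel. G t)"
proof -
  have "(LINT z|\<mu>. (indicator {p<..<q} (fst z) * F (fst z)) * (indicator {r<..<s} (snd z) * G (snd z)))
    = (LINT z|lborel. (indicator {p<..<q} (fst z) * F (fst z)) * (indicator {r<..<s} (snd z) * G (snd z)))"
  proof -
    have "indicator R z *\<^sub>R ((indicator {p<..<q} (fst z) * F (fst z)) * (indicator {r<..<s} (snd z) * G (snd z)))
       = (indicator {p<..<q} (fst z) * F (fst z)) * (indicator {r<..<s} (snd z) * G (snd z))" for z
      using I by (cases z) (auto simp: indicator_def rect_def)
    then show ?thesis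
      by (subst integral_restrict_space) (auto simp del: real_scaleR_def)
  qed
  also have "\<dots> = (LINT y|lborel. indicator {p<..<q} y * F y) * (LINT t|lborel. indicator {r<..<s} t * G t)"
    using F G by (intro lborel_product_integral) (auto simp: set_integrable_def)
  finally show ?thesis by (simp add: set_lebesgue_integral_def)
qed

lemma mu_box_Fubini:
  fixes k l :: "real \<Rightarrow> real \<Rightarrow> real"
  assumes Q: "0 \<le> p" "p \<le> q" "q \<le> b" "0 \<le> r" "r \<le> s" "s \<le> T"
    and v: "integrable \<mu> v"
    and k: "(\<lambda>z. k (fst z) (snd z)) \<in> borel_measurable borel" "\<And>y z. 0 < z \<Longrightarrow> z < b \<Longrightarrow> \<bar>k y z\<bar> \<le> B"
    and l: "(\<lambda>z. l (fst z) (snd z)) \<in> borel_measurable borel" "\<And>y z. 0 < z \<Longrightarrow> z < T \<Longrightarrow> \<bar>l y z\<bar> \<le> B"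
  shows "integrable \<mu> (\<lambda>x. indicator ({p<..<q} \<times> {r<..<s}) x * (LINT z|\<mu>. k (fst x) (fst z) * l (snd x) (snd z) * v z))"
    and "(LINT x|\<mu>. indicator ({p<..<q} \<times> {r<..<s}) x * (LINT z|\<mu>. k (fst x) (fst z) * l (snd x) (snd z) * v z))
    = (LINT z|\<mu>. v z * ((LINT y:{p<..<q}|lborel. k y (fst z)) * (LINT t:{r<..<s}|lborel. l t (snd z))))"
proof -
  interpret P: pair_sigma_finite \<mu> \<mu> ..
  have [measurable]: "v \<in> borel_measurable \<mu>" using v by auto
  have km[measurable]: "(\<lambda>z. k (fst z) (snd z)) \<in> borel_measurable (borel \<Otimes>\<^sub>M borel)"
    and lm[measurable]: "(\<lambda>z. l (fst z) (snd z)) \<in> borel_measurable (borel \<Otimes>\<^sub>M borel)"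
    using k(1) l(1) by (simp_all add: borel_prod)
  have [measurable]: "(\<lambda>z. k (fst (fst z)) (fst (snd z))) \<in> borel_measurable (\<mu> \<Otimes>\<^sub>M \<mu>)"
    using measurable_compose[OF _ km, of "\<lambda>z. (fst (fst z), fst (snd z))" "\<mu> \<Otimes>\<^sub>M \<mu>"] by simp
  have [measurable]: "(\<lambda>z. l (snd (fst z)) (snd (snd z))) \<in> borel_measurable (\<mu> \<Otimes>\<^sub>M \<mu>)"
    using measurable_compose[OF _ lm, of "\<lambda>z. (snd (fst z), snd (snd z))" "\<mu> \<Otimes>\<^sub>M \<mu>"] by simp
  have "{p<..<q} \<times> {r<..<s} \<in> sets (borel :: (real \<times> real) measure)" by (simp add: borel_Times)
  then have [measurable]: "(indicator ({p<..<q} \<times> {r<..<s}) :: real \<times> real \<Rightarrow> real) \<in> borel_measurable \<mu>"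
    by (intro measurable_restrict_space1) simp
  define h where "h x z = indicator ({p<..<q} \<times> {r<..<s}) x * (k (fst x) (fst z) * l (snd x) (snd z) * v z)" for x z
  have hm: "(\<lambda>(x, z). h x z) \<in> borel_measurable (\<mu> \<Otimes>\<^sub>M \<mu>)"
    unfolding h_def case_prod_beta by measurable
  have B0: "0 \<le> B" using k(2)[of "b / 2" 0] b_pos by (simp add: order_trans[OF abs_ge_zero])
  have vint: "integrable (\<mu> \<Otimes>\<^sub>M \<mu>) (\<lambda>(x, z). B * B * \<bar>v z\<bar>)"
  proof (rule P.Fubini_integrable)
    show "(\<lambda>(x, z). B * B * \<bar>v z\<bar>) \<in> borel_measurable (\<mu> \<Otimes>\<^sub>M \<mu>)" unfolding case_prod_beta by measurable
  qed (use v in \<open>auto intro!: integrable_const\<close>)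
  have hint: "integrable (\<mu> \<Otimes>\<^sub>M \<mu>) (\<lambda>(x, z). h x z)"
  proof (rule Bochner_Integration.integrable_bound[OF vint hm])
    show "AE xz in \<mu> \<Otimes>\<^sub>M \<mu>. norm (case xz of (x, z) \<Rightarrow> h x z) \<le> norm (case xz of (x, z) \<Rightarrow> B * B * \<bar>v z\<bar>)"
    proof (rule AE_I2, clarify)
      fix a c d e assume "((a, c), (d, e)) \<in> space (\<mu> \<Otimes>\<^sub>M \<mu>)"
      then have "(d, e) \<in> R" by (auto simp: space_pair_measure)
      then have "0 < d" "d < b" "0 < e" "e < T" by (auto simp: rect_def)
      then have "\<bar>k a d\<bar> * \<bar>l c e\<bar> * \<bar>v (d, e)\<bar> \<le> B * B * \<bar>v (d, e)\<bar>"
        using k(2) l(2) B0 by (intro mult_right_mono mult_mono) auto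
      then show "norm (h (a, c) (d, e)) \<le> norm (B * B * \<bar>v (d, e)\<bar>)"
        using B0 by (auto simp: h_def indicator_def abs_mult)
    qed
  qed
  show "integrable \<mu> (\<lambda>x. indicator ({p<..<q} \<times> {r<..<s}) x * (LINT z|\<mu>. k (fst x) (fst z) * l (snd x) (snd z) * v z))"
    using P.integrable_fst'[OF hint] by (simp add: h_def)
  have "(LINT x|\<mu>. indicator ({p<..<q} \<times> {r<..<s}) x * (LINT z|\<mu>. k (fst x) (fst z) * l (snd x) (snd z) * v z))
     = (LINT x|\<mu>. LINT z|\<mu>. h x z)"
    unfolding h_def by simp
  also have "\<dots> = (LINT z|\<mu>. LINT x|\<mu>. h x z)"
    using P.Fubini_integral[OF hint] by simp
  also have "\<dots> = (LINT z|\<mu>. v z * ((LINT y:{p<..<q}|lborel. k y (fst z)) * (LINT t:{r<..<s}|lborel. l t (snd z))))"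
  proof (intro Bochner_Integration.integral_cong refl)
    fix z assume "z \<in> space \<mu>"
    then have "z \<in> R" by simp
    then have z: "0 < fst z" "fst z < b" "0 < snd z" "snd z < T" by (auto simp: rect_def)
    have int: "set_integrable lborel {p'<..<q'} f"
      if "p' \<le> q'" "f \<in> borel_measurable borel" "\<And>y. \<bar>f y\<bar> \<le> B" for p' q' and f :: "real \<Rightarrow> real"
      unfolding set_integrable_def
    proof (rule Bochner_Integration.integrable_bound)
      show "integrable lborel (\<lambda>x. B * indicator {p'<..<q'} x)"
        using that by (intro integrable_mult_right integrable_real_indicator) (auto simp: emeasure_lborel_Ioo)
      show "AE x in lborel. norm (indicator {p'<..<q'} x *\<^sub>R f x) \<le> norm (B * indicator {p'<..<q'} x)"
        using that B0 by (auto intro!: AE_I2 simp: indicator_def)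
    qed (use that in auto)
    have m1: "(\<lambda>y. k y (fst z)) \<in> borel_measurable borel"
      using measurable_compose[OF _ km, of "\<lambda>y. (y, fst z)" borel] by simp
    have m2: "(\<lambda>t. l t (snd z)) \<in> borel_measurable borel"
      using measurable_compose[OF _ lm, of "\<lambda>y. (y, snd z)" borel] by simp
    have "(LINT x|\<mu>. h x z) = (LINT x|\<mu>. v z * ((indicator {p<..<q} (fst x) * k (fst x) (fst z)) * (indicator {r<..<s} (snd x) * l (snd x) (snd z))))"
      unfolding h_def by (intro Bochner_Integration.integral_cong) (auto simp: indicator_times)
    also have "\<dots> = v z * ((LINT y:{p<..<q}|lborel. k y (fst z)) * (LINT t:{r<..<s}|lborel. l t (snd z)))"
      by (subst integral_mult_right_zero, subst mu_product_integral)
        (use Q z k l m1 m2 in \<open>auto intro!: int\<close>)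
    finally show "(LINT x|\<mu>. h x z) = v z * ((LINT y:{p<..<q}|lborel. k y (fst z)) * (LINT t:{r<..<s}|lborel. l t (snd z)))" .
  qed
  finally show "(LINT x|\<mu>. indicator ({p<..<q} \<times> {r<..<s}) x * (LINT z|\<mu>. k (fst x) (fst z) * l (snd x) (snd z) * v z))
    = (LINT z|\<mu>. v z * ((LINT y:{p<..<q}|lborel. k y (fst z)) * (LINT t:{r<..<s}|lborel. l t (snd z))))" .
qed

section \<open>The continuous representative of a function with two derivatives\<close>

lemma sobolev_L1_bound:
  assumes u: "u \<in> sobolev k R"
  shows "(LINT z|\<mu>. \<bar>u z\<bar>) \<le> sqrt (b * T) * sobolev_norm k R u"
    and "\<And>\<alpha>. \<alpha> \<in> multi_indices k \<Longrightarrow> (LINT z|\<mu>. \<bar>wd \<alpha> u z\<bar>) \<le> sqrt (b * T) * sobolev_norm k R u"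
proof -
  let ?N = "sobolev_norm k R u"
  have L1: "(LINT z|\<mu>. \<bar>w z\<bar>) \<le> sqrt (b * T) * ?N" if "w \<in> L2 \<mu>" "(LINT z|\<mu>. (w z)\<^sup>2) \<le> ?N\<^sup>2" for w
  proof -
    have "(LINT z|\<mu>. \<bar>w z\<bar>) \<le> sqrt (b * T) * sqrt (LINT z|\<mu>. (w z)\<^sup>2)"
      using L1_le_L2[OF that(1)] by (simp add: measure_mu)
    also have "\<dots> \<le> sqrt (b * T) * ?N"
      using b_pos T_pos that(2) by (intro mult_left_mono real_le_lsqrt) auto
    finally show ?thesis .
  qed
  show "(LINT z|\<mu>. \<bar>wd \<alpha> u z\<bar>) \<le> sqrt (b * T) * ?N" if "\<alpha> \<in> multi_indices k" for \<alpha>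
    by (rule L1[OF sobolev_has_weak_deriv(2)[OF u that] wd_norm_le[OF that]])
  have "(LINT z|\<mu>. (u z)\<^sup>2) = (LINT z|\<mu>. (wd (\<lambda>_. 0) u z)\<^sup>2)"
    using sobolev_wd_0[OF u] sobolev_has_weak_deriv(2)[OF u zero_multi_indices]
    by (intro integral_cong_AE) (auto dest: L2_measurable)
  then show "(LINT z|\<mu>. \<bar>u z\<bar>) \<le> sqrt (b * T) * ?N"
    using wd_norm_le[of "\<lambda>_. 0" k u] by (intro L1 sobolev_wd_0(2)[OF u]) simp
qed

text \<open>
  The one-dimensional formula, applied in \<open>y\<close> and in \<open>t\<close>, expresses \<open>u x\<close> for almost all
  \<open>x\<close> as the integral over \<open>z\<close> of this function. The right-hand side involves weak derivatives under the integral only, so it makes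
  sense at every point \<open>x\<close>, is continuous in \<open>x\<close> and bounded by a multiple of the norm of \<open>u\<close>
  in \<open>H\<^sup>2\<close>.
\<close>

definition kernel_integrand :: "(real \<times> real \<Rightarrow> real) \<Rightarrow> real \<times> real \<Rightarrow> real \<times> real \<Rightarrow> real" where
  "kernel_integrand u x z = u z / (b * T) + interval_kernel b (fst x) (fst z) * wd (mixed 1 0) u z / T
     + interval_kernel T (snd x) (snd z) * wd (mixed 0 1) u z / b
     + interval_kernel b (fst x) (fst z) * interval_kernel T (snd x) (snd z) * wd (mixed 1 1) u z"

definition representative :: "(real \<times> real \<Rightarrow> real) \<Rightarrow> real \<times> real \<Rightarrow> real" where
  "representative u x = (LINT z|\<mu>. kernel_integrand u x z)"

definition kernel_majorant :: "(real \<times> real \<Rightarrow> real) \<Rightarrow> real \<times> real \<Rightarrow> real" where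
  "kernel_majorant u z = \<bar>u z\<bar> / (b * T) + \<bar>wd (mixed 1 0) u z\<bar> / T + \<bar>wd (mixed 0 1) u z\<bar> / b + \<bar>wd (mixed 1 1) u z\<bar>"

lemma interval_kernel_measurable [measurable]:
  "(\<lambda>z. interval_kernel L (f z) (g z)) \<in> borel_measurable M"
  if [measurable]: "f \<in> borel_measurable M" "g \<in> borel_measurable M"
  unfolding interval_kernel_def by measurable

lemma kernel_integrand_le:
  assumes "z \<in> R" shows "\<bar>kernel_integrand u x z\<bar> \<le> kernel_majorant u z"
proof -
  let ?k = "interval_kernel b (fst x) (fst z)" and ?l = "interval_kernel T (snd x) (snd z)"
  have k: "\<bar>?k\<bar> \<le> 1" and l: "\<bar>?l\<bar> \<le> 1"
    using assms by (auto intro!: interval_kernel_bound simp: rect_def)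
  then have kl: "\<bar>?k\<bar> * \<bar>?l\<bar> \<le> 1" by (intro mult_le_one) auto
  have "\<bar>kernel_integrand u x z\<bar> \<le> \<bar>u z / (b * T)\<bar> + \<bar>?k * wd (mixed 1 0) u z / T\<bar>
    + \<bar>?l * wd (mixed 0 1) u z / b\<bar> + \<bar>?k * ?l * wd (mixed 1 1) u z\<bar>"
    unfolding kernel_integrand_def by (intro order_trans[OF abs_triangle_ineq] add_mono order_refl)
  also have "\<dots> \<le> kernel_majorant u z"
    unfolding kernel_majorant_def using b_pos T_pos k l kl
    by (intro add_mono) (auto simp: abs_mult intro!: divide_right_mono mult_left_le_one_le)
  finally show ?thesis .
qed

context
  fixes u assumes u: "u \<in> sobolev 2 R"
begin

lemma representative_derivs_L2:
  "u \<in> L2 \<mu>" "wd (mixed 1 0) u \<in> L2 \<mu>" "wd (mixed 0 1) u \<in> L2 \<mu>" "wd (mixed 1 1) u \<in> L2 \<mu>"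
  by (rule sobolev_wd_0[OF u], (rule sobolev_has_weak_deriv[OF u], simp add: mixed_in_multi_indices)+)

lemma kernel_measurable [measurable]:
  "u \<in> borel_measurable \<mu>" "wd (mixed 1 0) u \<in> borel_measurable \<mu>"
  "wd (mixed 0 1) u \<in> borel_measurable \<mu>" "wd (mixed 1 1) u \<in> borel_measurable \<mu>"
  using representative_derivs_L2 by (auto intro: L2_measurable)

lemma kernel_integrand_measurable: "kernel_integrand u x \<in> borel_measurable \<mu>"
  unfolding kernel_integrand_def by measurable

lemma kernel_majorant_integrable: "integrable \<mu> (kernel_majorant u)"
  unfolding kernel_majorant_def using representative_derivs_L2
  by (intro Bochner_Integration.integrable_add integrable_divide integrable_abs L2_integrable)

lemma representative_bound:
  "\<bar>representative u x\<bar> \<le> (1 / (b * T) + 1 / T + 1 / b + 1) * sqrt (b * T) * sobolev_norm 2 R u"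
proof -
  let ?N = "sobolev_norm 2 R u"
  have int: "integrable \<mu> (kernel_integrand u x)"
    by (rule Bochner_Integration.integrable_bound[OF kernel_majorant_integrable kernel_integrand_measurable])
      (rule AE_I2, use kernel_integrand_le in \<open>simp add: order_trans[OF _ abs_ge_self]\<close>)
  note l0 = sobolev_L1_bound(1)[OF u]
  have l1: "(LINT z|\<mu>. \<bar>wd (mixed 1 0) u z\<bar>) \<le> sqrt (b * T) * ?N"
    "(LINT z|\<mu>. \<bar>wd (mixed 0 1) u z\<bar>) \<le> sqrt (b * T) * ?N"
    "(LINT z|\<mu>. \<bar>wd (mixed 1 1) u z\<bar>) \<le> sqrt (b * T) * ?N"
    by (intro sobolev_L1_bound(2)[OF u]; simp add: mixed_in_multi_indices)+
  have "\<bar>representative u x\<bar> \<le> (LINT z|\<mu>. \<bar>kernel_integrand u x z\<bar>)"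
    unfolding representative_def using integral_norm_bound[of \<mu> "kernel_integrand u x"] by simp
  also have "\<dots> \<le> (LINT z|\<mu>. kernel_majorant u z)"
    using int kernel_majorant_integrable kernel_integrand_le by (intro integral_mono) auto
  also have "\<dots> = (LINT z|\<mu>. \<bar>u z\<bar>) / (b * T) + (LINT z|\<mu>. \<bar>wd (mixed 1 0) u z\<bar>) / T
     + (LINT z|\<mu>. \<bar>wd (mixed 0 1) u z\<bar>) / b + (LINT z|\<mu>. \<bar>wd (mixed 1 1) u z\<bar>)"
    unfolding kernel_majorant_def using representative_derivs_L2[THEN L2_integrable] by simp
  also have "\<dots> \<le> (sqrt (b * T) * ?N) / (b * T) + (sqrt (b * T) * ?N) / T
     + (sqrt (b * T) * ?N) / b + (sqrt (b * T) * ?N)"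
    using b_pos T_pos l0 l1 by (intro add_mono divide_right_mono) auto
  also have "\<dots> = (1 / (b * T) + 1 / T + 1 / b + 1) * sqrt (b * T) * ?N"
    by (simp add: algebra_simps)
  finally show ?thesis .
qed

text \<open>
  The kernels jump only where a coordinate of \<open>z\<close> equals that of \<open>x\<close>, which is a null set of points
  \<open>z\<close>; dominated convergence does the rest.
\<close>

lemma representative_continuous: "continuous_on UNIV (representative u)"
  unfolding continuous_on_sequentially
proof (intro allI ballI impI, elim conjE)
  fix X :: "nat \<Rightarrow> real \<times> real" and x assume X: "X \<longlonglongrightarrow> x"
  have null: "AE z in lborel. fst z \<noteq> fst x \<and> snd z \<noteq> snd x"
  proof -
    have "{fst x} \<times> UNIV \<in> null_sets (lborel \<Otimes>\<^sub>M lborel)" "UNIV \<times> {snd x} \<in> null_sets (lborel \<Otimes>\<^sub>M lborel)"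
      by (auto simp: null_sets_def lborel.emeasure_pair_measure_Times)
    then have "({fst x} \<times> UNIV) \<union> (UNIV \<times> {snd x}) \<in> null_sets (lborel :: (real \<times> real) measure)"
      unfolding lborel_prod by (rule null_sets.Un)
    from AE_not_in[OF this] show ?thesis by eventually_elim (auto simp: mem_Times_iff)
  qed
  have k: "(\<lambda>n. interval_kernel L (Y n) s) \<longlonglongrightarrow> interval_kernel L y s" if "Y \<longlonglongrightarrow> y" "s \<noteq> y" for Y y s L
  proof (cases "y < s")
    case True
    have "\<forall>\<^sub>F n in sequentially. Y n < s" using order_tendstoD(2)[OF that(1) True] .
    then have "\<forall>\<^sub>F n in sequentially. interval_kernel L (Y n) s = interval_kernel L y s"
      by eventually_elim (auto simp: interval_kernel_def True)
    then show ?thesis by (rule tendsto_eventually)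
  next
    case False
    then have "s < y" using that by simp
    then have "\<forall>\<^sub>F n in sequentially. s < Y n" using order_tendstoD(1)[OF that(1)] by blast
    then have "\<forall>\<^sub>F n in sequentially. interval_kernel L (Y n) s = interval_kernel L y s"
      by eventually_elim (use \<open>s < y\<close> in \<open>auto simp: interval_kernel_def\<close>)
    then show ?thesis by (rule tendsto_eventually)
  qed
  show "(representative u \<circ> X) \<longlonglongrightarrow> representative u x"
    unfolding representative_def comp_def
  proof (rule integral_dominated_convergence[OF kernel_integrand_measurable kernel_integrand_measurable kernel_majorant_integrable])
    show "AE z in \<mu>. norm (kernel_integrand u (X n) z) \<le> kernel_majorant u z" for n
      using kernel_integrand_le by (intro AE_I2) auto
    have "AE z in \<mu>. fst z \<noteq> fst x \<and> snd z \<noteq> snd x" unfolding AE_mu using null by eventually_elim simp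
    then show "AE z in \<mu>. (\<lambda>n. kernel_integrand u (X n) z) \<longlonglongrightarrow> kernel_integrand u x z"
    proof eventually_elim
      case (elim z)
      have "(\<lambda>n. interval_kernel b (fst (X n)) (fst z)) \<longlonglongrightarrow> interval_kernel b (fst x) (fst z)"
        "(\<lambda>n. interval_kernel T (snd (X n)) (snd z)) \<longlonglongrightarrow> interval_kernel T (snd x) (snd z)"
        using elim by (auto intro!: k tendsto_fst tendsto_snd X)
      then show ?case unfolding kernel_integrand_def divide_inverse
        by (intro tendsto_add tendsto_mult tendsto_const)
    qed
  qed
qed

text \<open>
  Averaged over a box, the kernels become tents, and integration by parts turns the four terms
  into the integral of \<open>u\<close> over the box.
\<close>

lemma representative_box:
  assumes Q: "0 \<le> p" "p < q" "q \<le> b" "0 \<le> r" "r < s" "s \<le> T"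
  shows "(LINT x|\<mu>. indicator ({p<..<q} \<times> {r<..<s}) x * representative u x)
    = (LINT x|\<mu>. indicator ({p<..<q} \<times> {r<..<s}) x * u x)"
proof -
  define cb where "cb = (q - p) / b"
  define cT where "cT = (s - r) / T"
  define \<beta> where "\<beta> z = tent b p q (fst z)" for z :: "real \<times> real"
  define \<tau> where "\<tau> z = tent T r s (snd z)" for z :: "real \<times> real"
  define w10 where "w10 = wd (mixed 1 0) u"
  define w01 where "w01 = wd (mixed 0 1) u"
  define w11 where "w11 = wd (mixed 1 1) u"
  note w = w10_def[symmetric] w01_def[symmetric] w11_def[symmetric]
  note L1 = representative_derivs_L2[THEN L2_integrable, unfolded w]
  let ?Q = "{p<..<q} \<times> {r<..<s}"
  let ?kb = "interval_kernel b" and ?kT = "interval_kernel T"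
  define I1 where "I1 x = (LINT z|\<mu>. 1 / b * (1 / T) * u z)" for x :: "real \<times> real"
  define I2 where "I2 x = (LINT z|\<mu>. ?kb (fst x) (fst z) * (1 / T) * w10 z)" for x :: "real \<times> real"
  define I3 where "I3 x = (LINT z|\<mu>. 1 / b * ?kT (snd x) (snd z) * w01 z)" for x :: "real \<times> real"
  define I4 where "I4 x = (LINT z|\<mu>. ?kb (fst x) (fst z) * ?kT (snd x) (snd z) * w11 z)" for x :: "real \<times> real"
  define B where "B = max 1 (max (1 / b) (1 / T))"
  have B: "\<bar>1 / b\<bar> \<le> B" "\<bar>1 / T\<bar> \<le> B" "\<And>t s. 0 < s \<Longrightarrow> s < b \<Longrightarrow> \<bar>?kb t s\<bar> \<le> B"
    "\<And>t s. 0 < s \<Longrightarrow> s < T \<Longrightarrow> \<bar>?kT t s\<bar> \<le> B"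
    using b_pos T_pos interval_kernel_bound[of _ b] interval_kernel_bound[of _ T]
    by (auto simp: B_def le_max_iff_disj less_imp_le)
  have meas: "(\<lambda>z. interval_kernel L (fst z) (snd z)) \<in> borel_measurable borel" for L
    by (intro interval_kernel_measurable borel_measurable_continuous_onI continuous_intros)
  have const: "(LINT y:{y1<..<y2}|lborel. c) = c * (y2 - y1)" if "y1 < y2" for y1 y2 c :: real
    using that by (simp add: set_lebesgue_integral_def)
  have kernels: "(LINT y:{p<..<q}|lborel. 1 / b) = cb" "(LINT t:{r<..<s}|lborel. 1 / T) = cT"
    "(LINT y:{p<..<q}|lborel. ?kb y (fst z)) = - \<beta> z" "(LINT t:{r<..<s}|lborel. ?kT t (snd z)) = - \<tau> z" for z
    using Q(2,5) by (simp_all add: const interval_kernel_integral cb_def cT_def \<beta>_def \<tau>_def)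
  note Fub = mu_box_Fubini[OF Q(1) less_imp_le[OF Q(2)] Q(3,4) less_imp_le[OF Q(5)] Q(6), where B = B]
  have cm: "(\<lambda>z :: real \<times> real. c :: real) \<in> borel_measurable borel" for c by simp
  note F1 = Fub[OF L1(1), of "\<lambda>_ _. 1 / b" "\<lambda>_ _. 1 / T", OF cm B(1) cm B(2), unfolded kernels]
  note F2 = Fub[OF L1(2), of ?kb "\<lambda>_ _. 1 / T", OF meas B(3) cm B(2), unfolded kernels]
  note F3 = Fub[OF L1(3), of "\<lambda>_ _. 1 / b" ?kT, OF cm B(1) meas B(4), unfolded kernels]
  note F4 = Fub[OF L1(4) meas B(3) meas B(4), unfolded kernels]
  have rep: "representative u x = I1 x + I2 x + I3 x + I4 x" for x
  proof -
    note bd = integrable_bounded_mult[where M = \<mu>]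
    have kb: "\<bar>?kb (fst x) (fst z)\<bar> \<le> B" and kT: "\<bar>?kT (snd x) (snd z)\<bar> \<le> B" if "z \<in> R" for z
      using that B by (auto simp: rect_def)
    have B0: "0 \<le> B" by (simp add: B_def)
    have i1: "integrable \<mu> (\<lambda>z. 1 / b * (1 / T) * u z)" using L1(1) by simp
    have i2: "integrable \<mu> (\<lambda>z. ?kb (fst x) (fst z) * (1 / T) * w10 z)"
      using B(2) kb B0 by (intro bd[OF L1(2), of _ "B * B"]) (auto simp: abs_mult simp del: abs_divide times_divide_eq_right intro!: mult_mono)
    have i3: "integrable \<mu> (\<lambda>z. 1 / b * ?kT (snd x) (snd z) * w01 z)"
      using B(1) kT B0 by (intro bd[OF L1(3), of _ "B * B"]) (auto simp: abs_mult simp del: abs_divide times_divide_eq_left intro!: mult_mono)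
    have i4: "integrable \<mu> (\<lambda>z. ?kb (fst x) (fst z) * ?kT (snd x) (snd z) * w11 z)"
      using kb kT B0 by (intro bd[OF L1(4), of _ "B * B"]) (auto simp: abs_mult intro!: mult_mono)
    have "representative u x = (LINT z|\<mu>. 1 / b * (1 / T) * u z + ?kb (fst x) (fst z) * (1 / T) * w10 z
       + 1 / b * ?kT (snd x) (snd z) * w01 z + ?kb (fst x) (fst z) * ?kT (snd x) (snd z) * w11 z)"
      unfolding representative_def kernel_integrand_def w by (simp add: algebra_simps)
    also have "\<dots> = I1 x + I2 x + I3 x + I4 x"
      unfolding I1_def I2_def I3_def I4_def
      by (simp only: Bochner_Integration.integral_add Bochner_Integration.integrable_add i1 i2 i3 i4)
    finally show ?thesis .
  qed
  have LHS: "(LINT x|\<mu>. indicator ?Q x * representative u x)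
     = (LINT z|\<mu>. u z * (cb * cT)) + (LINT z|\<mu>. w10 z * (- \<beta> z * cT))
       + (LINT z|\<mu>. w01 z * (cb * - \<tau> z)) + (LINT z|\<mu>. w11 z * (- \<beta> z * - \<tau> z))"
  proof -
    have "(LINT x|\<mu>. indicator ?Q x * representative u x)
      = (LINT x|\<mu>. indicator ?Q x * I1 x + indicator ?Q x * I2 x + indicator ?Q x * I3 x + indicator ?Q x * I4 x)"
      by (simp add: rep algebra_simps)
    also have "\<dots> = (LINT x|\<mu>. indicator ?Q x * I1 x) + (LINT x|\<mu>. indicator ?Q x * I2 x)
       + (LINT x|\<mu>. indicator ?Q x * I3 x) + (LINT x|\<mu>. indicator ?Q x * I4 x)"
      unfolding I1_def I2_def I3_def I4_def
      by (simp only: Bochner_Integration.integral_add Bochner_Integration.integrable_add F1(1) F2(1) F3(1) F4(1))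
    also have "(LINT x|\<mu>. indicator ?Q x * I1 x) = (LINT z|\<mu>. u z * (cb * cT))"
      unfolding I1_def by (rule F1(2))
    also have "(LINT x|\<mu>. indicator ?Q x * I2 x) = (LINT z|\<mu>. w10 z * (- \<beta> z * cT))"
      unfolding I2_def by (rule F2(2))
    also have "(LINT x|\<mu>. indicator ?Q x * I3 x) = (LINT z|\<mu>. w01 z * (cb * - \<tau> z))"
      unfolding I3_def by (rule F3(2))
    also have "(LINT x|\<mu>. indicator ?Q x * I4 x) = (LINT z|\<mu>. w11 z * (- \<beta> z * - \<tau> z))"
      unfolding I4_def by (rule F4(2))
    finally show ?thesis .
  qed
  define f' where "f' z = indicator {p<..<q} (fst z) - cb" for z :: "real \<times> real"
  define g' where "g' z = indicator {r<..<s} (snd z) - cT" for z :: "real \<times> real"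
  note hw = sobolev_has_weak_deriv(1)[OF u, of "mixed i j" for i j, unfolded mixed_in_multi_indices]
  note tb = test_limit_tent[OF Q(1-3)] and tT = test_limit_tent[OF Q(4-6)]
  note ib = test_limit_indicator[of 0 b b, simplified] and iT = test_limit_indicator[of 0 T T, simplified]
  have one: "indicator {0<..<b} (fst z) = (1 :: real)" "indicator {0<..<T} (snd z) = (1 :: real)" if "z \<in> R" for z
    using that by (auto simp: rect_def)
  have cong: "(LINT z|\<mu>. h z) = (LINT z|\<mu>. h' z)" if "\<And>z. z \<in> R \<Longrightarrow> h z = h' z" for h h' :: "real \<times> real \<Rightarrow> real"
    using that by (intro Bochner_Integration.integral_cong) auto
  have E10: "(LINT z|\<mu>. u z * f' z) = - (LINT z|\<mu>. w10 z * \<beta> z)"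
  proof -
    have "(LINT z|\<mu>. u z * f' z) = (LINT z|\<mu>. u z * ((indicator {p<..<q} (fst z) - (q - p) / b) * indicator {0<..<T} (snd z)))"
      by (rule cong) (simp add: one f'_def cb_def)
    also have "\<dots> = (-1) ^ (1 + 0) * (LINT z|\<mu>. w10 z * (tent b p q (fst z) * indicator {0<..<T} (snd z)))"
      by (rule weak_deriv_product_formula[OF _ L1(1,2) tb iT]) (simp add: w10_def hw)
    also have "\<dots> = - (LINT z|\<mu>. w10 z * \<beta> z)" by (simp, rule cong) (simp add: one \<beta>_def)
    finally show ?thesis .
  qed
  have E01: "(LINT z|\<mu>. u z * g' z) = - (LINT z|\<mu>. w01 z * \<tau> z)"
  proof -
    have "(LINT z|\<mu>. u z * g' z) = (LINT z|\<mu>. u z * (indicator {0<..<b} (fst z) * (indicator {r<..<s} (snd z) - (s - r) / T)))"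
      by (rule cong) (simp add: one g'_def cT_def)
    also have "\<dots> = (-1) ^ (0 + 1) * (LINT z|\<mu>. w01 z * (indicator {0<..<b} (fst z) * tent T r s (snd z)))"
      by (rule weak_deriv_product_formula[OF _ L1(1,3) ib tT]) (simp add: w01_def hw)
    also have "\<dots> = - (LINT z|\<mu>. w01 z * \<tau> z)" by (simp, rule cong) (simp add: one \<tau>_def)
    finally show ?thesis .
  qed
  have E11: "(LINT z|\<mu>. u z * (f' z * g' z)) = (LINT z|\<mu>. w11 z * (\<beta> z * \<tau> z))"
  proof -
    have "(LINT z|\<mu>. u z * ((indicator {p<..<q} (fst z) - (q - p) / b) * (indicator {r<..<s} (snd z) - (s - r) / T)))
       = (-1) ^ (1 + 1) * (LINT z|\<mu>. w11 z * (tent b p q (fst z) * tent T r s (snd z)))"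
      by (rule weak_deriv_product_formula[OF _ L1(1,4) tb tT]) (simp add: w11_def hw)
    then show ?thesis by (simp add: f'_def g'_def \<beta>_def \<tau>_def cb_def cT_def)
  qed
  have [measurable]: "f' \<in> borel_measurable \<mu>" "g' \<in> borel_measurable \<mu>"
    unfolding f'_def g'_def by measurable
  have cb: "0 \<le> cb" and cT: "0 \<le> cT" using Q b_pos T_pos by (auto simp: cb_def cT_def)
  have bf: "\<bar>f' z\<bar> \<le> 1 + cb" and bg: "\<bar>g' z\<bar> \<le> 1 + cT" for z
    using cb cT by (auto simp: f'_def g'_def indicator_def)
  have if': "integrable \<mu> (\<lambda>z. f' z * u z)" by (rule integrable_bounded_mult[OF L1(1) _ bf]) measurable
  have ig': "integrable \<mu> (\<lambda>z. g' z * u z)" by (rule integrable_bounded_mult[OF L1(1) _ bg]) measurable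
  have ifg: "integrable \<mu> (\<lambda>z. f' z * (g' z * u z))" by (rule integrable_bounded_mult[OF ig' _ bf]) measurable
  have "(LINT x|\<mu>. indicator ?Q x * u x)
     = (LINT z|\<mu>. cb * cT * u z + cT * (f' z * u z) + cb * (g' z * u z) + f' z * (g' z * u z))"
    by (intro cong) (simp add: f'_def g'_def indicator_times algebra_simps)
  also have "\<dots> = cb * cT * (LINT z|\<mu>. u z) + cT * (LINT z|\<mu>. f' z * u z) + cb * (LINT z|\<mu>. g' z * u z)
       + (LINT z|\<mu>. f' z * (g' z * u z))"
    using L1(1) if' ig' ifg by simp
  also have "\<dots> = (LINT x|\<mu>. indicator ?Q x * representative u x)"
  proof -
    have c: "(LINT z|\<mu>. f' z * u z) = (LINT z|\<mu>. u z * f' z)" "(LINT z|\<mu>. g' z * u z) = (LINT z|\<mu>. u z * g' z)"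
      "(LINT z|\<mu>. f' z * (g' z * u z)) = (LINT z|\<mu>. u z * (f' z * g' z))"
      by (simp_all only: mult_ac)
    have d: "(LINT z|\<mu>. u z * (cb * cT)) = cb * cT * (LINT z|\<mu>. u z)"
      "(LINT z|\<mu>. w10 z * (- \<beta> z * cT)) = - cT * (LINT z|\<mu>. w10 z * \<beta> z)"
      "(LINT z|\<mu>. w01 z * (cb * - \<tau> z)) = - cb * (LINT z|\<mu>. w01 z * \<tau> z)"
      "(LINT z|\<mu>. w11 z * (- \<beta> z * - \<tau> z)) = (LINT z|\<mu>. w11 z * (\<beta> z * \<tau> z))"
      by (simp_all add: integral_mult_right_zero[symmetric] mult_ac del: integral_mult_right_zero integral_mult_left_zero)
    show ?thesis unfolding LHS c d E10 E01 E11 by simp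
  qed
  finally show ?thesis ..
qed

lemma representative_AE: "AE x in \<mu>. representative u x = u x"
proof -
  have repm: "representative u \<in> borel_measurable \<mu>"
    by (rule continuous_measurable_mu[OF representative_continuous])
  have repint: "integrable \<mu> (representative u)"
    by (rule L2_integrable[OF L2_bounded[OF repm AE_I2[OF representative_bound]]])
  have uint: "integrable \<mu> u" by (rule L2_integrable[OF representative_derivs_L2(1)])
  have int: "integrable \<mu> (\<lambda>x. representative u x - u x)" using repint uint by simp
  have "AE x in lborel. indicator R x *\<^sub>R (representative u x - u x) = 0"
  proof (rule AE_zero_if_box_integrals_zero)
    show "integrable lborel (\<lambda>x. indicator R x *\<^sub>R (representative u x - u x))"
      using int by (simp add: integrable_restrict_space)
    fix c d :: "real \<times> real"
    define p q r s where "p = max (fst c) 0" "q = min (fst d) b" "r = max (snd c) 0" "s = min (snd d) T"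
    have box: "box c d \<inter> R = {p<..<q} \<times> {r<..<s}"
      by (cases c; cases d) (auto simp: p_q_r_s_def box_Pair_eq rect_def)
    have b0: "0 \<le> p" "q \<le> b" "0 \<le> r" "s \<le> T" by (auto simp: p_q_r_s_def)
    have "(LINT x:box c d|lborel. indicator R x *\<^sub>R (representative u x - u x))
       = (LINT x|lborel. indicator R x *\<^sub>R (indicator ({p<..<q} \<times> {r<..<s}) x * (representative u x - u x)))"
      unfolding set_lebesgue_integral_def
      by (intro Bochner_Integration.integral_cong refl) (simp add: box[symmetric] indicator_def)
    also have "\<dots> = (LINT x|\<mu>. indicator ({p<..<q} \<times> {r<..<s}) x * (representative u x - u x))"
      by (simp add: integral_restrict_space)
    also have "\<dots> = 0"
    proof (cases "p < q \<and> r < s")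
      case True
      have "{p<..<q} \<times> {r<..<s} \<in> sets \<mu>"
        using box by (metis borel_open inf.cobounded2 open_box open_Int open_rect rect_borel sets_lborel sets_restrict_space_iff sets.Int_space_eq2 space_lborel)
      then have i: "integrable \<mu> (\<lambda>x. indicator ({p<..<q} \<times> {r<..<s}) x * h x)" if "integrable \<mu> h" for h :: "real \<times> real \<Rightarrow> real"
        using integrable_mult_indicator[OF _ that] by simp
      have "(LINT x|\<mu>. indicator ({p<..<q} \<times> {r<..<s}) x * (representative u x - u x))
        = (LINT x|\<mu>. indicator ({p<..<q} \<times> {r<..<s}) x * representative u x) - (LINT x|\<mu>. indicator ({p<..<q} \<times> {r<..<s}) x * u x)"
        using i[OF repint] i[OF uint] by (simp add: right_diff_distrib)
      then show ?thesis using representative_box b0 True by simp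
    next
      case False
      then have "indicator ({p<..<q} \<times> {r<..<s}) x = (0 :: real)" for x
        by (cases x) (auto simp: indicator_def)
      then show ?thesis by simp
    qed
    finally show "(LINT x:box c d|lborel. indicator R x *\<^sub>R (representative u x - u x)) = 0" .
  qed
  then show ?thesis unfolding AE_mu by eventually_elim auto
qed

end

section \<open>Uniqueness of the trace on the initial edge\<close>

lemma closure_rect: "closure R = {0..b} \<times> {0..T}"
  using b_pos T_pos by (simp add: rect_def closure_Times)

text \<open>
  The weight \<open>1 - t / T\<close> is \<open>1\<close> on the edge \<open>t = 0\<close> and \<open>0\<close> on the opposite edge, so that integration
  by parts in \<open>t\<close> turns this into the integral of \<open>u\<close> over the segment \<open>(p, q)\<close> of the edge. Only
  \<open>u\<close> and its weak derivative in the rectangle enter.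
\<close>

definition trace_functional :: "real \<Rightarrow> real \<Rightarrow> (real \<times> real \<Rightarrow> real) \<Rightarrow> real" where
  "trace_functional p q u = (LINT z|\<mu>. indicator {p<..<q} (fst z) * (u z / T - (1 - snd z / T) * wd (mixed 0 1) u z))"

definition edge_path :: "real \<Rightarrow> (real \<Rightarrow> real \<times> real) \<Rightarrow> bool" where
  "edge_path L p \<longleftrightarrow> continuous_on {0..L} p \<and> p ` {0..L} \<subseteq> closure R"

lemma continuous_L2_edge_path:
  assumes p: "edge_path L p" and \<phi>: "continuous_on (closure R) \<phi>"
  shows "(\<lambda>s. \<phi> (p s)) \<in> L2 (restrict_space lborel {0<..<L})"
proof -
  interpret E: finite_measure "restrict_space lborel {0<..<L}"
    by (rule finite_measureI) (cases "0 \<le> L"; simp add: emeasure_restrict_space)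
  have c: "continuous_on {0..L} (\<lambda>s. \<phi> (p s))"
    using p by (intro continuous_on_compose2[OF \<phi>]) (auto simp: edge_path_def)
  then have "bounded ((\<lambda>s. \<phi> (p s)) ` {0..L})"
    by (intro compact_imp_bounded compact_continuous_image) auto
  then obtain B where B: "\<And>s. 0 \<le> s \<Longrightarrow> s \<le> L \<Longrightarrow> \<bar>\<phi> (p s)\<bar> \<le> B"
    by (force simp: bounded_iff)
  have "continuous_on {0<..<L} (\<lambda>s. \<phi> (p s))" by (rule continuous_on_subset[OF c]) auto
  then have "(\<lambda>s. \<phi> (p s)) \<in> borel_measurable (restrict_space borel {0<..<L})"
    by (rule borel_measurable_continuous_on_restrict)
  then have "(\<lambda>s. \<phi> (p s)) \<in> borel_measurable (restrict_space lborel {0<..<L})"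
    by (simp add: borel_measurable_restrict_space_iff)
  then show ?thesis using B by (intro E.L2_bounded[of _ B] AE_I2) auto
qed

lemma edge_path_bottom: "edge_path b (\<lambda>y. (y, 0))"
  using T_pos by (auto simp: edge_path_def closure_rect intro!: continuous_intros)

lemma edge_path_side: "0 \<le> a \<Longrightarrow> a \<le> b \<Longrightarrow> edge_path T (\<lambda>t. (a, t))"
  by (auto simp: edge_path_def closure_rect intro!: continuous_intros)

lemmas continuous_L2_edge = continuous_L2_edge_path[OF edge_path_bottom]

lemma continuous_L2:
  fixes \<phi> :: "real \<times> real \<Rightarrow> real"
  assumes c: "continuous_on (closure R) \<phi>" shows "\<phi> \<in> L2 \<mu>"
proof -
  have "bounded (\<phi> ` closure R)"
    by (intro compact_imp_bounded compact_continuous_image c) (auto simp: closure_rect intro: compact_Times)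
  then obtain B where B: "\<And>z. z \<in> closure R \<Longrightarrow> \<bar>\<phi> z\<bar> \<le> B"
    by (force simp: bounded_iff)
  have "continuous_on R \<phi>" by (rule continuous_on_subset[OF c closure_subset])
  then have "\<phi> \<in> borel_measurable (restrict_space borel R)"
    by (rule borel_measurable_continuous_on_restrict)
  then have "\<phi> \<in> borel_measurable \<mu>" by (simp add: borel_measurable_restrict_space_iff)
  then show ?thesis using B closure_subset[of R] by (intro L2_bounded[of _ B] AE_I2) auto
qed

lemma edge_weight_bound: "z \<in> space \<mu> \<Longrightarrow> \<bar>1 - snd z / T\<bar> \<le> 1"
proof -
  assume "z \<in> space \<mu>"
  then have "z \<in> R" by simp
  then have "0 \<le> snd z / T" "snd z / T \<le> 1" using T_pos by (auto simp: rect_def)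
  then show ?thesis by linarith
qed

lemma trace_integrand_integrable:
  assumes "u \<in> sobolev 1 R"
  shows "integrable \<mu> u" "integrable \<mu> (wd (mixed 0 1) u)"
    and "integrable \<mu> (\<lambda>z. indicator {p<..<q} (fst z) * (u z / T - (1 - snd z / T) * wd (mixed 0 1) u z))"
proof -
  show 1: "integrable \<mu> u" by (rule L2_integrable[OF sobolev_wd_0(2)[OF assms]])
  show 2: "integrable \<mu> (wd (mixed 0 1) u)"
    by (rule L2_integrable[OF sobolev_has_weak_deriv(2)[OF assms]]) (simp add: mixed_in_multi_indices)
  have 3: "integrable \<mu> (\<lambda>z. (1 - snd z / T) * wd (mixed 0 1) u z)"
    by (rule integrable_bounded_mult[OF 2 _ edge_weight_bound]) measurable
  show "integrable \<mu> (\<lambda>z. indicator {p<..<q} (fst z) * (u z / T - (1 - snd z / T) * wd (mixed 0 1) u z))"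
    by (rule integrable_bounded_mult[of _ _ _ 1]) (use 1 3 in \<open>auto simp: indicator_def\<close>)
qed

text \<open>
  Testing with the indicator function of an interval in \<open>y\<close> times a tent with peak at \<open>\<delta>\<close>
  computes the average over \<open>0 < t < \<delta>\<close>; as \<open>\<delta> \<rightarrow> 0\<close> this becomes the integral over the edge.
\<close>

lemma trace_formula_continuous:
  assumes \<phi>: "\<phi> \<in> sobolev 1 R" and cont: "continuous_on (closure R) \<phi>" and I: "0 \<le> p" "p < q" "q \<le> b"
  shows "(LINT y:{p<..<q}|lborel. \<phi> (y, 0)) = trace_functional p q \<phi>"
proof -
  define \<delta> where "\<delta> n = T / (real n + 2)" for n
  have \<delta>: "0 < \<delta> n" "\<delta> n < T" for n
    using T_pos by (auto simp: \<delta>_def field_simps add_pos_nonneg)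
  have \<delta>_lim: "\<delta> \<longlonglongrightarrow> 0"
    using LIMSEQ_ignore_initial_segment[OF lim_const_over_n[of T], of 2] by (simp add: \<delta>_def[abs_def] algebra_simps)
  note int = trace_integrand_integrable[OF \<phi>]
  define \<phi>t where "\<phi>t = wd (mixed 0 1) \<phi>"
  have hw: "has_weak_deriv R (mixed 0 1) \<phi> \<phi>t"
    unfolding \<phi>t_def by (rule sobolev_has_weak_deriv[OF \<phi>]) (simp add: mixed_in_multi_indices)
  define ip where "ip z = (indicator {p<..<q} (fst z) :: real)" for z :: "real \<times> real"
  define id where "id n z = (indicator {0<..<\<delta> n} (snd z) :: real)" for n and z :: "real \<times> real"
  define k where "k n z = tent T 0 (\<delta> n) (snd z) / \<delta> n" for n and z :: "real \<times> real"
  have ipm[measurable]: "ip \<in> borel_measurable \<mu>" unfolding ip_def by measurable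
  have idm[measurable]: "id n \<in> borel_measurable \<mu>" for n unfolding id_def by measurable
  have k_eq: "k n z = min (snd z) (\<delta> n) / \<delta> n - snd z / T" if "z \<in> R" for n z
  proof -
    have "{0<..<\<delta> n} \<inter> {..<snd z} = {0<..<min (snd z) (\<delta> n)}" by auto
    moreover have "0 < snd z" using that by (auto simp: rect_def)
    ultimately have "measure lborel ({0<..<\<delta> n} \<inter> {..<snd z}) = min (snd z) (\<delta> n)"
      using \<delta>(1)[of n] by simp
    then show ?thesis using \<delta>(1)[of n] unfolding k_def tent_def by (simp add: diff_divide_distrib)
  qed
  have ip1: "\<bar>ip z\<bar> \<le> 1" "\<bar>id n z\<bar> \<le> 1" for z n by (auto simp: ip_def id_def indicator_def)
  have intp: "integrable \<mu> (\<lambda>z. ip z * \<phi> z)" "integrable \<mu> (\<lambda>z. ip z * \<phi>t z)"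
    by (rule integrable_bounded_mult[OF int(1) ipm ip1(1)],
        rule integrable_bounded_mult[OF int(2)[folded \<phi>t_def] ipm ip1(1)])
  have intpd: "integrable \<mu> (\<lambda>z. id n z * (ip z * \<phi> z))" for n
    by (rule integrable_bounded_mult[OF intp(1) idm ip1(2)])
  have avg: "(LINT z|\<mu>. id n z * (ip z * \<phi> z)) / \<delta> n = (LINT z|\<mu>. ip z * \<phi> z) / T - (LINT z|\<mu>. k n z * (ip z * \<phi>t z))" for n
  proof -
    have "(LINT z|\<mu>. \<phi> z * (indicator {p<..<q} (fst z) * (indicator {0<..<\<delta> n} (snd z) - (\<delta> n - 0) / T)))
      = (-1) ^ (0 + 1) * (LINT z|\<mu>. \<phi>t z * (indicator {p<..<q} (fst z) * tent T 0 (\<delta> n) (snd z)))"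
      by (rule weak_deriv_product_formula[OF hw int(1) int(2)[folded \<phi>t_def] test_limit_indicator test_limit_tent])
        (use I \<delta>[of n] in auto)
    then have "(LINT z|\<mu>. id n z * (ip z * \<phi> z) - \<delta> n / T * (ip z * \<phi> z)) = - (LINT z|\<mu>. \<delta> n * (k n z * (ip z * \<phi>t z)))"
      using \<delta>[of n] by (simp add: id_def ip_def k_def algebra_simps)
    then have "(LINT z|\<mu>. id n z * (ip z * \<phi> z)) - \<delta> n / T * (LINT z|\<mu>. ip z * \<phi> z) = - \<delta> n * (LINT z|\<mu>. k n z * (ip z * \<phi>t z))"
      using intpd[of n] intp(1) by simp
    then show ?thesis using \<delta>[of n] T_pos by (simp add: field_simps)
  qed
  have k_lim: "(\<lambda>n. LINT z|\<mu>. k n z * (ip z * \<phi>t z)) \<longlonglongrightarrow> (LINT z|\<mu>. (1 - snd z / T) * (ip z * \<phi>t z))"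
  proof (rule integral_dominated_convergence[where w = "\<lambda>z. 2 * norm (ip z * \<phi>t z)"])
    have [measurable]: "\<phi>t \<in> borel_measurable \<mu>" using int(2) by (auto simp: \<phi>t_def)
    show "(\<lambda>z. (1 - snd z / T) * (ip z * \<phi>t z)) \<in> borel_measurable \<mu>" by measurable
    show "(\<lambda>z. k n z * (ip z * \<phi>t z)) \<in> borel_measurable \<mu>" for n
    proof (rule measurable_cong[THEN iffD2])
      show "(\<lambda>z. (min (snd z) (\<delta> n) / \<delta> n - snd z / T) * (ip z * \<phi>t z)) \<in> borel_measurable \<mu>" by measurable
    qed (simp add: k_eq)
    show "integrable \<mu> (\<lambda>z. 2 * norm (ip z * \<phi>t z))" using intp(2) by simp
    show "AE z in \<mu>. (\<lambda>n. k n z * (ip z * \<phi>t z)) \<longlonglongrightarrow> (1 - snd z / T) * (ip z * \<phi>t z)"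
    proof (rule AE_I2)
      fix z assume "z \<in> space \<mu>"
      then have z: "z \<in> R" by simp
      then have "0 < snd z" by (auto simp: rect_def)
      then have "\<forall>\<^sub>F n in sequentially. \<delta> n < snd z" using order_tendstoD(2)[OF \<delta>_lim] by blast
      then have "\<forall>\<^sub>F n in sequentially. k n z * (ip z * \<phi>t z) = (1 - snd z / T) * (ip z * \<phi>t z)"
      proof eventually_elim
        case (elim n)
        then show ?case using \<delta>[of n] z by (simp add: k_eq min_def)
      qed
      then show "(\<lambda>n. k n z * (ip z * \<phi>t z)) \<longlonglongrightarrow> (1 - snd z / T) * (ip z * \<phi>t z)"
        by (rule tendsto_eventually)
    qed
    show "AE z in \<mu>. norm (k n z * (ip z * \<phi>t z)) \<le> 2 * norm (ip z * \<phi>t z)" for n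
    proof (rule AE_I2)
      fix z assume "z \<in> space \<mu>"
      then have z: "z \<in> R" by simp
      then have s: "0 < snd z" "snd z < T" by (auto simp: rect_def)
      have "0 \<le> min (snd z) (\<delta> n) / \<delta> n" "min (snd z) (\<delta> n) / \<delta> n \<le> 1" "0 \<le> snd z / T" "snd z / T \<le> 1"
        using s \<delta>[of n] by (auto simp: field_simps)
      then have "\<bar>k n z\<bar> \<le> 2" unfolding k_eq[OF z] by linarith
      then show "norm (k n z * (ip z * \<phi>t z)) \<le> 2 * norm (ip z * \<phi>t z)"
        unfolding real_norm_def abs_mult[of "k n z"] by (intro mult_right_mono) auto
    qed
  qed
  have edge: "set_integrable lborel {p<..<q} (\<lambda>y. \<phi> (y, 0))"
  proof -
    interpret E: finite_measure "restrict_space lborel {0<..<b}"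
      by (rule finite_measureI) (use b_pos in \<open>simp add: emeasure_restrict_space\<close>)
    have "set_integrable lborel {0<..<b} (\<lambda>y. \<phi> (y, 0))"
      using E.L2_integrable[OF continuous_L2_edge[OF cont]] by (simp add: set_integrable_as_restrict)
    then show ?thesis by (rule set_integrable_subset) (use I in auto)
  qed
  have edge_avg: "(LINT z|\<mu>. ip z * \<phi> (fst z, 0) * id n z) = \<delta> n * (LINT y:{p<..<q}|lborel. \<phi> (y, 0))" for n
  proof -
    have "(LINT z|\<mu>. (indicator {p<..<q} (fst z) * \<phi> (fst z, 0)) * (indicator {0<..<\<delta> n} (snd z) * 1))
      = (LINT y:{p<..<q}|lborel. \<phi> (y, 0)) * (LINT t:{0<..<\<delta> n}|lborel. 1)"
      by (rule mu_product_integral[OF I(1,3) order_refl less_imp_le[OF \<delta>(2)] edge])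
        (use \<delta>(1)[of n] in \<open>simp add: set_integrable_def emeasure_lborel_Ioo\<close>)
    also have "(LINT t:{0<..<\<delta> n}|lborel. 1) = \<delta> n"
      using \<delta>(1)[of n] by (simp add: set_lebesgue_integral_def)
    finally show ?thesis by (simp add: ip_def id_def)
  qed
  have edge_int: "integrable \<mu> (\<lambda>z. ip z * \<phi> (fst z, 0) * id n z)" for n
  proof -
    have "continuous_on (closure R) (\<lambda>z. \<phi> (fst z, 0))"
      by (rule continuous_on_compose2[OF cont]) (use T_pos in \<open>auto intro!: continuous_intros simp: closure_rect\<close>)
    from L2_integrable[OF continuous_L2[OF this]] have "integrable \<mu> (\<lambda>z. id n z * (ip z * \<phi> (fst z, 0)))"
      by (intro integrable_bounded_mult[OF integrable_bounded_mult[OF _ ipm ip1(1)] idm ip1(2)])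
    then show ?thesis by (simp add: mult.commute)
  qed
  have avg_lim: "(\<lambda>n. (LINT z|\<mu>. id n z * (ip z * \<phi> z)) / \<delta> n) \<longlonglongrightarrow> (LINT y:{p<..<q}|lborel. \<phi> (y, 0))"
  proof (rule LIMSEQ_I)
    fix e :: real assume e: "e > 0"
    define e' where "e' = e / (2 * b)"
    have e': "e' > 0" using e b_pos by (simp add: e'_def)
    have "uniformly_continuous_on (closure R) \<phi>"
      using cont by (intro compact_uniformly_continuous) (auto simp: closure_rect intro: compact_Times)
    then obtain d where d: "d > 0"
      "\<And>x x'. x \<in> closure R \<Longrightarrow> x' \<in> closure R \<Longrightarrow> dist x' x < d \<Longrightarrow> dist (\<phi> x') (\<phi> x) < e'"
      using e' unfolding uniformly_continuous_on_def by metis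
    obtain N where N: "\<And>n. n \<ge> N \<Longrightarrow> \<delta> n < d"
      using order_tendstoD(2)[OF \<delta>_lim d(1)] by (auto simp: eventually_sequentially)
    have "norm ((LINT z|\<mu>. id n z * (ip z * \<phi> z)) / \<delta> n - (LINT y:{p<..<q}|lborel. \<phi> (y, 0))) < e" if n: "n \<ge> N" for n
    proof -
      have "(LINT z|\<mu>. id n z * (ip z * \<phi> z)) / \<delta> n - (LINT y:{p<..<q}|lborel. \<phi> (y, 0))
        = ((LINT z|\<mu>. id n z * (ip z * \<phi> z)) - (LINT z|\<mu>. ip z * \<phi> (fst z, 0) * id n z)) / \<delta> n"
        unfolding edge_avg using \<delta>[of n] by (simp add: diff_divide_distrib)
      also have "\<dots> = (LINT z|\<mu>. id n z * (ip z * \<phi> z) - ip z * \<phi> (fst z, 0) * id n z) / \<delta> n"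
        using intpd[of n] edge_int[of n] by simp
      finally have eq: "(LINT z|\<mu>. id n z * (ip z * \<phi> z)) / \<delta> n - (LINT y:{p<..<q}|lborel. \<phi> (y, 0))
        = (LINT z|\<mu>. id n z * (ip z * \<phi> z) - ip z * \<phi> (fst z, 0) * id n z) / \<delta> n" .
      have ipid: "integrable \<mu> (\<lambda>z. ip z * id n z)"
        and ipid_val: "(LINT z|\<mu>. ip z * id n z) = (q - p) * \<delta> n"
      proof -
        have "integrable \<mu> (\<lambda>z. ip z * (id n z * 1))"
          by (intro integrable_bounded_mult[OF integrable_bounded_mult[OF _ idm ip1(2)] ipm ip1(1)]) simp
        then show "integrable \<mu> (\<lambda>z. ip z * id n z)" by simp
        have "(LINT z|\<mu>. (indicator {p<..<q} (fst z) * (1::real)) * (indicator {0<..<\<delta> n} (snd z) * 1))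
           = (LINT y:{p<..<q}|lborel. 1) * (LINT t:{0<..<\<delta> n}|lborel. 1)"
          by (rule mu_product_integral[OF I(1,3) order_refl less_imp_le[OF \<delta>(2)],
                where F = "\<lambda>_. 1" and G = "\<lambda>_. 1"])
            (use I \<delta>(1)[of n] in \<open>simp_all add: set_integrable_def emeasure_lborel_Ioo\<close>)
        then show "(LINT z|\<mu>. ip z * id n z) = (q - p) * \<delta> n"
          using I \<delta>(1)[of n] by (simp add: ip_def id_def set_lebesgue_integral_def)
      qed
      have "norm (LINT z|\<mu>. id n z * (ip z * \<phi> z) - ip z * \<phi> (fst z, 0) * id n z) \<le> (LINT z|\<mu>. e' * (ip z * id n z))"
      proof (rule Bochner_Integration.integral_norm_bound_integral)
        show "integrable \<mu> (\<lambda>z. id n z * (ip z * \<phi> z) - ip z * \<phi> (fst z, 0) * id n z)"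
          using intpd[of n] edge_int[of n] by simp
        show "integrable \<mu> (\<lambda>z. e' * (ip z * id n z))" using ipid by simp
        fix z assume "z \<in> space \<mu>"
        then have z: "z \<in> R" by simp
        show "norm (id n z * (ip z * \<phi> z) - ip z * \<phi> (fst z, 0) * id n z) \<le> e' * (ip z * id n z)"
        proof (cases "0 < snd z \<and> snd z < \<delta> n")
          case True
          have "dist z (fst z, 0) < d"
            using True N[OF n] by (cases z) (simp add: dist_Pair_Pair dist_real_def)
          moreover have "z \<in> closure R" "(fst z, 0) \<in> closure R"
            using z unfolding closure_rect by (auto simp: rect_def)
          ultimately have "\<bar>\<phi> z - \<phi> (fst z, 0)\<bar> \<le> e'" using d(2) by (fastforce simp: dist_real_def)
          then show ?thesis using True
            by (auto simp: ip_def id_def indicator_def)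
        next
          case False then show ?thesis by (auto simp: id_def)
        qed
      qed
      also have "\<dots> = e' * ((q - p) * \<delta> n)" by (simp add: ipid_val)
      finally have "norm ((LINT z|\<mu>. id n z * (ip z * \<phi> z)) / \<delta> n - (LINT y:{p<..<q}|lborel. \<phi> (y, 0))) \<le> e' * (q - p)"
        unfolding eq using \<delta>[of n] by (simp add: field_simps)
      also have "\<dots> \<le> e' * b" using I e' by (intro mult_left_mono) auto
      also have "\<dots> < e" using e b_pos by (simp add: e'_def)
      finally show ?thesis .
    qed
    then show "\<exists>N. \<forall>n\<ge>N. norm ((LINT z|\<mu>. id n z * (ip z * \<phi> z)) / \<delta> n - (LINT y:{p<..<q}|lborel. \<phi> (y, 0))) < e" by blast
  qed
  have "(\<lambda>n. (LINT z|\<mu>. id n z * (ip z * \<phi> z)) / \<delta> n) \<longlonglongrightarrow> (LINT z|\<mu>. ip z * \<phi> z) / T - (LINT z|\<mu>. (1 - snd z / T) * (ip z * \<phi>t z))"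
    unfolding avg by (intro tendsto_diff tendsto_const k_lim)
  with avg_lim have "(LINT y:{p<..<q}|lborel. \<phi> (y, 0)) = (LINT z|\<mu>. ip z * \<phi> z) / T - (LINT z|\<mu>. (1 - snd z / T) * (ip z * \<phi>t z))"
    by (rule LIMSEQ_unique)
  also have "\<dots> = (LINT z|\<mu>. ip z * \<phi> z / T - (1 - snd z / T) * (ip z * \<phi>t z))"
  proof (subst Bochner_Integration.integral_diff)
    show "integrable \<mu> (\<lambda>z. (1 - snd z / T) * (ip z * \<phi>t z))"
      by (rule integrable_bounded_mult[OF intp(2) _ edge_weight_bound]) measurable
  qed (use intp in auto)
  also have "\<dots> = trace_functional p q \<phi>"
    unfolding trace_functional_def ip_def \<phi>t_def
    by (intro Bochner_Integration.integral_cong refl) (simp add: algebra_simps)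
  finally show ?thesis .
qed

lemma trace_functional_diff:
  assumes "u \<in> sobolev 1 R" "v \<in> sobolev 1 R"
  shows "trace_functional p q (\<lambda>z. u z - v z) = trace_functional p q u - trace_functional p q v"
proof -
  note d = sobolev_diff[OF assms]
  have "trace_functional p q (\<lambda>z. u z - v z)
    = (LINT z|\<mu>. indicator {p<..<q} (fst z) * (u z / T - (1 - snd z / T) * wd (mixed 0 1) u z)
         - indicator {p<..<q} (fst z) * (v z / T - (1 - snd z / T) * wd (mixed 0 1) v z))"
    unfolding trace_functional_def
  proof (rule integral_cong_AE)
    have "mixed 0 1 \<in> multi_indices 1" by (simp add: mixed_in_multi_indices)
    from wd_diff[OF assms this]
    show "AE z in \<mu>. indicator {p<..<q} (fst z) * ((u z - v z) / T - (1 - snd z / T) * wd (mixed 0 1) (\<lambda>z. u z - v z) z)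
      = indicator {p<..<q} (fst z) * (u z / T - (1 - snd z / T) * wd (mixed 0 1) u z)
         - indicator {p<..<q} (fst z) * (v z / T - (1 - snd z / T) * wd (mixed 0 1) v z)"
    proof eventually_elim
      case (elim z)
      show ?case unfolding elim by (simp add: algebra_simps diff_divide_distrib)
    qed
  qed (use trace_integrand_integrable(3)[OF d] trace_integrand_integrable(3)[OF assms(1)]
      trace_integrand_integrable(3)[OF assms(2)] in \<open>auto intro!: borel_measurable_diff\<close>)
  then show ?thesis
    using trace_integrand_integrable(3)[OF assms(1), of p q] trace_integrand_integrable(3)[OF assms(2), of p q]
    by (simp add: trace_functional_def)
qed

lemma trace_functional_bound:
  assumes "u \<in> sobolev 1 R"
  shows "\<bar>trace_functional p q u\<bar> \<le> (1 / T + 1) * sqrt (b * T) * sobolev_norm 1 R u"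
proof -
  note int = trace_integrand_integrable[OF assms]
  have "norm (trace_functional p q u) \<le> (LINT z|\<mu>. \<bar>u z\<bar> / T + \<bar>wd (mixed 0 1) u z\<bar>)"
    unfolding trace_functional_def
  proof (rule Bochner_Integration.integral_norm_bound_integral[OF int(3)])
    show "integrable \<mu> (\<lambda>z. \<bar>u z\<bar> / T + \<bar>wd (mixed 0 1) u z\<bar>)" using int by simp
    fix z assume z: "z \<in> space \<mu>"
    have "\<bar>u z / T - (1 - snd z / T) * wd (mixed 0 1) u z\<bar> \<le> \<bar>u z / T\<bar> + \<bar>1 - snd z / T\<bar> * \<bar>wd (mixed 0 1) u z\<bar>"
      using abs_triangle_ineq4[of "u z / T" "(1 - snd z / T) * wd (mixed 0 1) u z"] by (simp only: abs_mult)
    also have "\<dots> \<le> \<bar>u z\<bar> / T + 1 * \<bar>wd (mixed 0 1) u z\<bar>"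
      using T_pos by (intro add_mono mult_right_mono edge_weight_bound[OF z]) auto
    finally show "norm (indicator {p<..<q} (fst z) * (u z / T - (1 - snd z / T) * wd (mixed 0 1) u z))
        \<le> \<bar>u z\<bar> / T + \<bar>wd (mixed 0 1) u z\<bar>"
      using T_pos by (auto simp: indicator_def)
  qed
  also have "\<dots> = (LINT z|\<mu>. \<bar>u z\<bar>) / T + (LINT z|\<mu>. \<bar>wd (mixed 0 1) u z\<bar>)" using int by simp
  also have "\<dots> \<le> sqrt (b * T) * sobolev_norm 1 R u / T + sqrt (b * T) * sobolev_norm 1 R u"
    using T_pos sobolev_L1_bound[OF assms]
    by (intro add_mono divide_right_mono) (auto simp: mixed_in_multi_indices)
  finally show ?thesis by (simp add: algebra_simps)
qed

text \<open>
  Both sides are continuous along the sequences that define a trace, so the formula passes from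
  continuous functions to all traces.
\<close>

lemma trace_formula:
  assumes tr: "has_trace R {0<..<b} (\<lambda>y. (y, 0)) u g" and I: "0 \<le> p" "p < q" "q \<le> b"
  shows "(LINT y:{p<..<q}|lborel. g y) = trace_functional p q u"
proof -
  let ?E = "restrict_space lborel {0<..<b}"
  interpret E: finite_measure ?E
    by (rule finite_measureI) (use b_pos in \<open>simp add: emeasure_restrict_space\<close>)
  from tr obtain \<phi> where u: "u \<in> sobolev 1 R" and "square_integrable {0<..<b} g"
    and \<phi>: "\<And>n. \<phi> n \<in> sobolev 1 R" "\<And>n. continuous_on (closure R) (\<phi> n)"
      "(\<lambda>n. sobolev_norm 1 R (\<lambda>x. u x - \<phi> n x)) \<longlonglongrightarrow> 0"
      "(\<lambda>n. LINT s:{0<..<b}|lborel. (\<phi> n (s, 0) - g s)\<^sup>2) \<longlonglongrightarrow> 0"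
    unfolding has_trace_def by blast
  then have g: "g \<in> L2 ?E" by (simp add: square_integrable_iff_L2)
  have d: "(\<lambda>y. \<phi> n (y, 0) - g y) \<in> L2 ?E" for n
    by (rule L2_diff[OF continuous_L2_edge[OF \<phi>(2)] g])
  have sub: "(LINT y:{p<..<q}|lborel. h y) = (LINT y|?E. indicator {p<..<q} y * h y)" for h :: "real \<Rightarrow> real"
    unfolding set_lebesgue_integral_def
    by (subst integral_restrict_space) (use I in \<open>auto intro!: Bochner_Integration.integral_cong simp: indicator_def\<close>)
  have "(\<lambda>n. LINT y:{p<..<q}|lborel. \<phi> n (y, 0)) \<longlonglongrightarrow> (LINT y:{p<..<q}|lborel. g y)"
  proof (rule LIM_zero_cancel, rule Lim_null_comparison[OF always_eventually[OF allI]])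
    fix n
    have ib: "integrable ?E (\<lambda>y. indicator {p<..<q} y * h y)" if "h \<in> L2 ?E" for h
      by (rule integrable_bounded_mult[OF E.L2_integrable[OF that], of _ 1]) (auto simp: indicator_def intro!: measurable_restrict_space1)
    have "(LINT y:{p<..<q}|lborel. \<phi> n (y, 0)) - (LINT y:{p<..<q}|lborel. g y)
       = (LINT y|?E. indicator {p<..<q} y * (\<phi> n (y, 0) - g y))"
      unfolding sub using ib[OF continuous_L2_edge[OF \<phi>(2)[of n]]] ib[OF g] by (simp add: right_diff_distrib)
    moreover have "norm (LINT y|?E. indicator {p<..<q} y * (\<phi> n (y, 0) - g y)) \<le> (LINT y|?E. \<bar>\<phi> n (y, 0) - g y\<bar>)"
      by (rule Bochner_Integration.integral_norm_bound_integral[OF ib[OF d]])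
        (use E.L2_integrable[OF d] in \<open>auto simp: indicator_def\<close>)
    moreover have "\<dots> \<le> sqrt (measure ?E (space ?E)) * sqrt (LINT y|?E. (\<phi> n (y, 0) - g y)\<^sup>2)"
      by (rule E.L1_le_L2[OF d])
    ultimately show "norm ((LINT y:{p<..<q}|lborel. \<phi> n (y, 0)) - (LINT y:{p<..<q}|lborel. g y))
        \<le> sqrt (measure ?E (space ?E)) * sqrt (LINT s:{0<..<b}|lborel. (\<phi> n (s, 0) - g s)\<^sup>2)"
      by (simp add: set_integral_as_restrict)
  next
    show "(\<lambda>n. sqrt (measure ?E (space ?E)) * sqrt (LINT s:{0<..<b}|lborel. (\<phi> n (s, 0) - g s)\<^sup>2)) \<longlonglongrightarrow> 0"
      using tendsto_mult_left[OF tendsto_real_sqrt[OF \<phi>(4)], of "sqrt (measure ?E (space ?E))"] by simp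
  qed
  moreover have "(\<lambda>n. trace_functional p q (\<phi> n)) \<longlonglongrightarrow> trace_functional p q u"
  proof (rule LIM_zero_cancel, rule Lim_null_comparison[OF always_eventually[OF allI]])
    fix n
    have "norm (trace_functional p q (\<phi> n) - trace_functional p q u) = \<bar>trace_functional p q (\<lambda>z. u z - \<phi> n z)\<bar>"
      using trace_functional_diff[OF u \<phi>(1), of p q n] by simp
    also have "\<dots> \<le> (1 / T + 1) * sqrt (b * T) * sobolev_norm 1 R (\<lambda>z. u z - \<phi> n z)"
      by (rule trace_functional_bound[OF sobolev_diff[OF u \<phi>(1)]])
    finally show "norm (trace_functional p q (\<phi> n) - trace_functional p q u)
       \<le> (1 / T + 1) * sqrt (b * T) * sobolev_norm 1 R (\<lambda>z. u z - \<phi> n z)" .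
  next
    show "(\<lambda>n. (1 / T + 1) * sqrt (b * T) * sobolev_norm 1 R (\<lambda>z. u z - \<phi> n z)) \<longlonglongrightarrow> 0"
      using tendsto_mult_left[OF \<phi>(3), of "(1 / T + 1) * sqrt (b * T)"] by simp
  qed
  moreover have "(LINT y:{p<..<q}|lborel. \<phi> n (y, 0)) = trace_functional p q (\<phi> n)" for n
    by (rule trace_formula_continuous[OF \<phi>(1,2) I])
  ultimately show ?thesis by (simp only: LIMSEQ_unique)
qed

text \<open>
  The integrals of a trace over all segments are determined by \<open>u\<close>.
\<close>

lemma trace_unique:
  assumes tr: "has_trace R {0<..<b} (\<lambda>y. (y, 0)) u g" "has_trace R {0<..<b} (\<lambda>y. (y, 0)) u g'"
  shows "AE y in lborel. y \<in> {0<..<b} \<longrightarrow> g y = g' y"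
proof -
  let ?E = "restrict_space lborel {0<..<b}"
  interpret E: finite_measure ?E
    by (rule finite_measureI) (use b_pos in \<open>simp add: emeasure_restrict_space\<close>)
  have L: "g \<in> L2 ?E" "g' \<in> L2 ?E"
    using tr unfolding has_trace_def by (simp_all add: square_integrable_iff_L2)
  then have int: "set_integrable lborel {0<..<b} g" "set_integrable lborel {0<..<b} g'"
    by (auto simp: set_integrable_as_restrict intro: E.L2_integrable)
  have "AE y in lborel. indicator {0<..<b} y *\<^sub>R (g y - g' y) = 0"
  proof (rule AE_zero_if_box_integrals_zero)
    show "integrable lborel (\<lambda>y. indicator {0<..<b} y *\<^sub>R (g y - g' y))"
      using set_integral_diff(1)[OF int] by (simp add: set_integrable_def)
    fix c d :: real
    define p q where "p = max c 0" "q = min d b"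
    have "box c d \<inter> {0<..<b} = {p<..<q}" by (auto simp: p_q_def)
    then have "(LINT y:box c d|lborel. indicator {0<..<b} y *\<^sub>R (g y - g' y)) = (LINT y:{p<..<q}|lborel. g y - g' y)"
      unfolding set_lebesgue_integral_def
      by (intro Bochner_Integration.integral_cong refl) (auto simp: indicator_def)
    also have "\<dots> = 0"
    proof (cases "p < q")
      case True
      have pq: "0 \<le> p" "q \<le> b" by (auto simp: p_q_def)
      have "set_integrable lborel {p<..<q} g" "set_integrable lborel {p<..<q} g'"
        using pq by (auto intro: set_integrable_subset[OF int(1)] set_integrable_subset[OF int(2)])
      then show ?thesis
        using trace_formula[OF tr(1) pq(1) True pq(2)] trace_formula[OF tr(2) pq(1) True pq(2)]
        by (simp add: set_integral_diff(2))
    qed (simp add: set_lebesgue_integral_def)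
    finally show "(LINT y:box c d|lborel. indicator {0<..<b} y *\<^sub>R (g y - g' y)) = 0" .
  qed
  then show ?thesis by eventually_elim auto
qed

end

section \<open>Energies of quadratic residuals\<close>

text \<open>
  A quadratic map \<open>V \<mapsto> A V + B V V\<close> between semi-inner product spaces, linear and bilinear only
  up to elements of norm zero, and the Tikhonov functional of its residual.
\<close>

locale quadratic_residual =
  X: semi_inner_space X ipX + Y: semi_inner_space Y ipY
  for X :: "('a \<Rightarrow> real) set" and ipX and Y :: "('b \<Rightarrow> real) set" and ipY +
  fixes A :: "('a \<Rightarrow> real) \<Rightarrow> 'b \<Rightarrow> real" and B :: "('a \<Rightarrow> real) \<Rightarrow> ('a \<Rightarrow> real) \<Rightarrow> 'b \<Rightarrow> real"
    and C \<gamma> :: real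
  assumes A_mem: "V \<in> X \<Longrightarrow> A V \<in> Y" and B_mem: "V \<in> X \<Longrightarrow> W \<in> X \<Longrightarrow> B V W \<in> Y"
    and A_lincomb: "V \<in> X \<Longrightarrow> W \<in> X \<Longrightarrow> Y.eqv (A (\<lambda>x. V x + c * W x)) (\<lambda>x. A V x + c * A W x)"
    and B_lincomb1: "V \<in> X \<Longrightarrow> W \<in> X \<Longrightarrow> U \<in> X \<Longrightarrow> Y.eqv (B (\<lambda>x. V x + c * W x) U) (\<lambda>x. B V U x + c * B W U x)"
    and B_lincomb2: "V \<in> X \<Longrightarrow> W \<in> X \<Longrightarrow> U \<in> X \<Longrightarrow> Y.eqv (B U (\<lambda>x. V x + c * W x)) (\<lambda>x. B U V x + c * B U W x)"
    and A_bound: "V \<in> X \<Longrightarrow> Y.nrm (A V) \<le> C * X.nrm V"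
    and B_bound: "V \<in> X \<Longrightarrow> W \<in> X \<Longrightarrow> Y.nrm (B V W) \<le> C * (X.nrm V * X.nrm W)"
    and C_nonneg: "0 \<le> C" and \<gamma>_nonneg: "0 \<le> \<gamma>"
begin

definition residual :: "('a \<Rightarrow> real) \<Rightarrow> 'b \<Rightarrow> real" where
  "residual V x = A V x + B V V x"

definition linearization :: "('a \<Rightarrow> real) \<Rightarrow> ('a \<Rightarrow> real) \<Rightarrow> 'b \<Rightarrow> real" where
  "linearization V h x = A h x + (B V h x + B h V x)"

definition energy :: "('a \<Rightarrow> real) \<Rightarrow> real" where
  "energy V = ipY (residual V) (residual V) + \<gamma> * ipX V V"

definition differential :: "('a \<Rightarrow> real) \<Rightarrow> ('a \<Rightarrow> real) \<Rightarrow> real" where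
  "differential V h = 2 * ipY (residual V) (linearization V h) + 2 * \<gamma> * ipX V h"

lemma residual_mem: "V \<in> X \<Longrightarrow> residual V \<in> Y"
  unfolding residual_def[abs_def] by (intro Y.add_mem A_mem B_mem)

lemma linearization_mem: "V \<in> X \<Longrightarrow> h \<in> X \<Longrightarrow> linearization V h \<in> Y"
  unfolding linearization_def[abs_def] by (intro Y.add_mem A_mem B_mem)

lemma A_add: "V \<in> X \<Longrightarrow> W \<in> X \<Longrightarrow> Y.eqv (A (\<lambda>x. V x + W x)) (\<lambda>x. A V x + A W x)"
  using A_lincomb[of V W 1] by simp

lemma B_add1: "V \<in> X \<Longrightarrow> W \<in> X \<Longrightarrow> U \<in> X \<Longrightarrow> Y.eqv (B (\<lambda>x. V x + W x) U) (\<lambda>x. B V U x + B W U x)"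
  using B_lincomb1[of V W U 1] by simp

lemma B_add2: "V \<in> X \<Longrightarrow> W \<in> X \<Longrightarrow> U \<in> X \<Longrightarrow> Y.eqv (B U (\<lambda>x. V x + W x)) (\<lambda>x. B U V x + B U W x)"
  using B_lincomb2[of V W U 1] by simp

lemma residual_add:
  assumes V: "V \<in> X" and h: "h \<in> X"
  shows "Y.eqv (residual (\<lambda>x. V x + h x)) (\<lambda>x. residual V x + (linearization V h x + B h h x))"
proof -
  note Vh = X.add_mem[OF V h]
  have "Y.eqv (B (\<lambda>x. V x + h x) (\<lambda>x. V x + h x)) (\<lambda>x. B V (\<lambda>x. V x + h x) x + B h (\<lambda>x. V x + h x) x)"
    by (rule B_add1[OF V h Vh])
  also have "Y.eqv (\<lambda>x. B V (\<lambda>x. V x + h x) x + B h (\<lambda>x. V x + h x) x)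
      (\<lambda>x. (B V V x + B V h x) + (B h V x + B h h x))"
    by (intro Y.eqv_add B_add2 V h)
  finally have "Y.eqv (residual (\<lambda>x. V x + h x)) (\<lambda>x. (A V x + A h x) + ((B V V x + B V h x) + (B h V x + B h h x)))"
    unfolding residual_def[abs_def] by (intro Y.eqv_add A_add V h)
  moreover have "(\<lambda>x. (A V x + A h x) + ((B V V x + B V h x) + (B h V x + B h h x)))
     = (\<lambda>x. residual V x + (linearization V h x + B h h x))"
    by (auto simp: residual_def linearization_def)
  ultimately show ?thesis by simp
qed

lemma linearization_lincomb:
  assumes V: "V \<in> X" and h: "h \<in> X" and k: "k \<in> X"
  shows "Y.eqv (linearization V (\<lambda>x. h x + c * k x)) (\<lambda>x. linearization V h x + c * linearization V k x)"
proof -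
  have "Y.eqv (linearization V (\<lambda>x. h x + c * k x))
    (\<lambda>x. (A h x + c * A k x) + ((B V h x + c * B V k x) + (B h V x + c * B k V x)))"
    unfolding linearization_def[abs_def] by (intro Y.eqv_add A_lincomb B_lincomb1 B_lincomb2 V h k)
  moreover have "(\<lambda>x. (A h x + c * A k x) + ((B V h x + c * B V k x) + (B h V x + c * B k V x)))
     = (\<lambda>x. linearization V h x + c * linearization V k x)"
    by (auto simp: linearization_def algebra_simps)
  ultimately show ?thesis by simp
qed

lemma residual_bound:
  assumes "V \<in> X" "X.nrm V \<le> M" shows "Y.nrm (residual V) \<le> C * (M + M\<^sup>2)"
proof -
  have "Y.nrm (residual V) \<le> Y.nrm (A V) + Y.nrm (B V V)"
    unfolding residual_def[abs_def] by (intro Y.nrm_triangle A_mem B_mem assms)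
  also have "\<dots> \<le> C * X.nrm V + C * (X.nrm V * X.nrm V)"
    by (intro add_mono A_bound B_bound assms)
  also have "\<dots> \<le> C * M + C * (M * M)"
    using assms X.nrm_nonneg[OF assms(1)] C_nonneg by (intro add_mono mult_left_mono mult_mono) auto
  finally show ?thesis by (simp add: algebra_simps power2_eq_square)
qed

lemma linearization_bound:
  assumes "V \<in> X" "h \<in> X" "X.nrm V \<le> M" shows "Y.nrm (linearization V h) \<le> C * (1 + 2 * M) * X.nrm h"
proof -
  have "Y.nrm (linearization V h) \<le> Y.nrm (A h) + Y.nrm (\<lambda>x. B V h x + B h V x)"
    unfolding linearization_def[abs_def] by (intro Y.nrm_triangle Y.add_mem A_mem B_mem assms)
  also have "Y.nrm (\<lambda>x. B V h x + B h V x) \<le> Y.nrm (B V h) + Y.nrm (B h V)"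
    by (intro Y.nrm_triangle B_mem assms)
  also have "Y.nrm (A h) + (Y.nrm (B V h) + Y.nrm (B h V)) \<le> C * X.nrm h + (C * (X.nrm V * X.nrm h) + C * (X.nrm h * X.nrm V))"
    by (intro add_mono A_bound B_bound assms)
  also have "\<dots> \<le> C * X.nrm h + (C * (M * X.nrm h) + C * (X.nrm h * M))"
    using assms X.nrm_nonneg[OF assms(2)] C_nonneg by (intro add_mono mult_left_mono mult_right_mono) auto
  finally show ?thesis by (simp add: algebra_simps)
qed

text \<open>
  The energy is a polynomial of degree four in \<open>h\<close>; what remains after its constant and
  linear parts is of second order.
\<close>

lemma energy_expansion:
  assumes V: "V \<in> X" and h: "h \<in> X"
  shows "energy (\<lambda>x. V x + h x) - energy V - differential V h
    = 2 * ipY (residual V) (B h h) + (Y.nrm (\<lambda>x. linearization V h x + B h h x))\<^sup>2 + \<gamma> * (X.nrm h)\<^sup>2"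
proof -
  let ?r = "residual V" and ?l = "linearization V h" and ?b = "B h h"
  note r = residual_mem[OF V] and l = linearization_mem[OF V h] and b = B_mem[OF h h]
  have lb: "(\<lambda>x. ?l x + ?b x) \<in> Y" by (rule Y.add_mem[OF l b])
  have e1: "ipY (residual (\<lambda>x. V x + h x)) (residual (\<lambda>x. V x + h x))
      = ipY ?r ?r + 2 * ipY ?r (\<lambda>x. ?l x + ?b x) + ipY (\<lambda>x. ?l x + ?b x) (\<lambda>x. ?l x + ?b x)"
    using Y.eqv_ip_self[OF residual_add[OF V h]] Y.ip_expand[OF r lb, of 1] by simp
  have e2: "ipX (\<lambda>x. V x + h x) (\<lambda>x. V x + h x) = ipX V V + 2 * ipX V h + ipX h h"
    using X.ip_expand[OF V h, of 1] by simp
  show ?thesis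
    unfolding energy_def differential_def e1 e2 Y.ip_add2[OF l b r] Y.nrm_square[OF lb] X.nrm_square[OF h]
    by (simp add: distrib_left)
qed

lemma energy_remainder:
  assumes V: "V \<in> X"
  shows "\<exists>K\<ge>0. \<forall>h\<in>X. X.nrm h \<le> 1 \<longrightarrow> \<bar>energy (\<lambda>x. V x + h x) - energy V - differential V h\<bar> \<le> K * (X.nrm h)\<^sup>2"
proof -
  define M where "M = X.nrm V"
  have M: "0 \<le> M" "X.nrm V \<le> M" using X.nrm_nonneg[OF V] by (auto simp: M_def)
  define K where "K = 2 * (C * (M + M\<^sup>2) * C) + (C * (1 + 2 * M) + C)\<^sup>2 + \<gamma>"
  have "K \<ge> 0" using M C_nonneg \<gamma>_nonneg by (simp add: K_def)
  moreover have "\<bar>energy (\<lambda>x. V x + h x) - energy V - differential V h\<bar> \<le> K * (X.nrm h)\<^sup>2"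
    if h: "h \<in> X" and h1: "X.nrm h \<le> 1" for h
  proof -
    let ?n = "X.nrm h"
    have n: "0 \<le> ?n" by (rule X.nrm_nonneg[OF h])
    have bb: "Y.nrm (B h h) \<le> C * ?n\<^sup>2" using B_bound[OF h h] by (simp add: power2_eq_square)
    have "\<bar>ipY (residual V) (B h h)\<bar> \<le> Y.nrm (residual V) * Y.nrm (B h h)"
      by (intro Y.Cauchy_Schwarz residual_mem B_mem V h)
    also have "\<dots> \<le> C * (M + M\<^sup>2) * (C * ?n\<^sup>2)"
      using M C_nonneg by (intro mult_mono residual_bound V bb Y.nrm_nonneg B_mem h) auto
    finally have 1: "\<bar>ipY (residual V) (B h h)\<bar> \<le> (C * (M + M\<^sup>2) * C) * ?n\<^sup>2" by (simp add: mult_ac)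
    have "Y.nrm (\<lambda>x. linearization V h x + B h h x) \<le> Y.nrm (linearization V h) + Y.nrm (B h h)"
      by (intro Y.nrm_triangle linearization_mem B_mem V h)
    also have "\<dots> \<le> C * (1 + 2 * M) * ?n + C * ?n\<^sup>2"
      by (intro add_mono linearization_bound V h M bb)
    also have "\<dots> \<le> C * (1 + 2 * M) * ?n + C * ?n"
      using h1 n C_nonneg M by (intro add_mono mult_left_mono order_refl) (auto simp: power2_eq_square mult_left_le)
    finally have "Y.nrm (\<lambda>x. linearization V h x + B h h x) \<le> (C * (1 + 2 * M) + C) * ?n" by (simp add: algebra_simps)
    then have 2: "(Y.nrm (\<lambda>x. linearization V h x + B h h x))\<^sup>2 \<le> (C * (1 + 2 * M) + C)\<^sup>2 * ?n\<^sup>2"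
      unfolding power_mult_distrib[symmetric]
      by (intro power_mono Y.nrm_nonneg Y.add_mem linearization_mem B_mem V h)
    have "\<bar>energy (\<lambda>x. V x + h x) - energy V - differential V h\<bar>
       \<le> 2 * \<bar>ipY (residual V) (B h h)\<bar> + (Y.nrm (\<lambda>x. linearization V h x + B h h x))\<^sup>2 + \<gamma> * ?n\<^sup>2"
    proof -
      have "0 \<le> y \<Longrightarrow> 0 \<le> z \<Longrightarrow> \<bar>2 * x + y + z\<bar> \<le> 2 * \<bar>x\<bar> + y + z" for x y z :: real by argo
      then show ?thesis unfolding energy_expansion[OF V h] using \<gamma>_nonneg by simp
    qed
    also have "\<dots> \<le> K * ?n\<^sup>2" using 1 2 by (simp add: K_def algebra_simps)
    finally show ?thesis .
  qed
  ultimately show ?thesis by blast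
qed

lemma differential_lincomb:
  assumes V: "V \<in> X" and h: "h \<in> X" and k: "k \<in> X"
  shows "differential V (\<lambda>x. h x + c * k x) = differential V h + c * differential V k"
proof -
  note r = residual_mem[OF V] and lh = linearization_mem[OF V h] and lk = linearization_mem[OF V k]
  note e = linearization_lincomb[OF V h k, of c]
  have "ipY (residual V) (linearization V (\<lambda>x. h x + c * k x)) = ipY (residual V) (linearization V h) + c * ipY (residual V) (linearization V k)"
    using Y.eqv_ip[OF e r] Y.ip_lincomb[OF lh lk r]
    by (simp add: Y.ip_commute[OF r] linearization_mem[OF V X.lincomb_mem[OF h k]] lh lk)
  then show ?thesis using X.ip_lincomb2[OF h k V] by (simp add: differential_def algebra_simps)
qed

lemma differential_bound:
  assumes V: "V \<in> X" shows "\<exists>D. \<forall>h\<in>X. \<bar>differential V h\<bar> \<le> D * X.nrm h"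
proof -
  define M where "M = X.nrm V"
  have "\<bar>differential V h\<bar> \<le> (2 * Y.nrm (residual V) * (C * (1 + 2 * M)) + 2 * \<gamma> * M) * X.nrm h" if h: "h \<in> X" for h
  proof -
    have "\<bar>ipY (residual V) (linearization V h)\<bar> \<le> Y.nrm (residual V) * Y.nrm (linearization V h)"
      by (intro Y.Cauchy_Schwarz residual_mem linearization_mem V h)
    also have "\<dots> \<le> Y.nrm (residual V) * (C * (1 + 2 * M) * X.nrm h)"
      by (intro mult_left_mono linearization_bound V h Y.nrm_nonneg residual_mem) (simp add: M_def)
    finally have 1: "\<bar>ipY (residual V) (linearization V h)\<bar> \<le> Y.nrm (residual V) * (C * (1 + 2 * M) * X.nrm h)" .
    have 2: "\<bar>\<gamma> * ipX V h\<bar> \<le> \<gamma> * (M * X.nrm h)"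
      using X.Cauchy_Schwarz[OF V h] \<gamma>_nonneg by (simp add: abs_mult M_def mult_left_mono)
    have "\<bar>differential V h\<bar> \<le> 2 * \<bar>ipY (residual V) (linearization V h)\<bar> + 2 * \<bar>\<gamma> * ipX V h\<bar>"
      unfolding differential_def by linarith
    also have "\<dots> \<le> 2 * (Y.nrm (residual V) * (C * (1 + 2 * M) * X.nrm h)) + 2 * (\<gamma> * (M * X.nrm h))"
      using 1 2 by linarith
    finally show ?thesis by (simp add: algebra_simps)
  qed
  then show ?thesis by blast
qed

text \<open>
  On a ball the residual and the linearization are bounded, and both change by at most a multiple of
  the distance; apart from its linear regularising part, the differential is the inner product of the two.
\<close>

lemma differential_Lipschitz:
  "\<exists>L>0. \<forall>V\<in>X. \<forall>W\<in>X. X.nrm V \<le> M \<and> X.nrm W \<le> M \<longrightarrow>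
     (\<forall>h\<in>X. \<bar>differential V h - differential W h\<bar> \<le> L * X.nrm (\<lambda>x. V x - W x) * X.nrm h)"
proof -
  define L where "L = 2 * ((C * (1 + 4 * \<bar>M\<bar>)) * (C * (1 + 2 * \<bar>M\<bar>)) + C * (\<bar>M\<bar> + \<bar>M\<bar>\<^sup>2) * (2 * C)) + 2 * \<gamma> + 1"
  have "L > 0" using C_nonneg \<gamma>_nonneg unfolding L_def by (intro add_nonneg_pos add_nonneg_nonneg mult_nonneg_nonneg) auto
  moreover have "\<bar>differential V h - differential W h\<bar> \<le> L * X.nrm (\<lambda>x. V x - W x) * X.nrm h"
    if V: "V \<in> X" and W: "W \<in> X" and VM: "X.nrm V \<le> M" and WM: "X.nrm W \<le> M" and h: "h \<in> X" for V W h
  proof -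
    have M: "0 \<le> M" "\<bar>M\<bar> = M" using X.nrm_nonneg[OF V] VM by auto
    define d where "d x = V x - W x" for x
    have d: "d \<in> X" unfolding d_def[abs_def] by (rule X.diff_mem[OF V W])
    have V_eq: "V = (\<lambda>x. W x + d x)" by (auto simp: d_def)
    let ?d = "X.nrm d" and ?h = "X.nrm h"
    have dn: "0 \<le> ?d" "?d \<le> 2 * M"
      using X.nrm_nonneg[OF d] X.nrm_diff_le[OF V W] VM WM by (auto simp: d_def[abs_def])
    have hn: "0 \<le> ?h" by (rule X.nrm_nonneg[OF h])
    \<comment> \<open>The residuals at \<open>V\<close> and \<open>W\<close> differ by a term of order \<open>d\<close>.\<close>
    define \<rho> where "\<rho> x = linearization W d x + B d d x" for x
    have \<rho>: "\<rho> \<in> Y" unfolding \<rho>_def[abs_def] by (intro Y.add_mem linearization_mem B_mem W d)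
    have res: "Y.eqv (residual V) (\<lambda>x. residual W x + \<rho> x)"
      using residual_add[OF W d] unfolding V_eq[symmetric] by (simp add: \<rho>_def)
    have \<rho>_bound: "Y.nrm \<rho> \<le> C * (1 + 4 * M) * ?d"
    proof -
      have "Y.nrm \<rho> \<le> Y.nrm (linearization W d) + Y.nrm (B d d)"
        unfolding \<rho>_def[abs_def] by (intro Y.nrm_triangle linearization_mem B_mem W d)
      also have "\<dots> \<le> C * (1 + 2 * M) * ?d + C * (?d * ?d)"
        by (intro add_mono linearization_bound B_bound W d WM)
      also have "\<dots> \<le> C * (1 + 2 * M) * ?d + C * (2 * M * ?d)"
        using dn C_nonneg by (intro add_mono mult_left_mono mult_right_mono) auto
      finally show ?thesis by (simp add: algebra_simps)
    qed
    \<comment> \<open>So do the linearizations.\<close>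
    define \<sigma> where "\<sigma> x = B d h x + B h d x" for x
    have \<sigma>: "\<sigma> \<in> Y" unfolding \<sigma>_def[abs_def] by (intro Y.add_mem B_mem d h)
    have lin: "Y.eqv (linearization V h) (\<lambda>x. linearization W h x + \<sigma> x)"
    proof -
      have "Y.eqv (linearization V h) (\<lambda>x. A h x + ((B W h x + B d h x) + (B h W x + B h d x)))"
        unfolding linearization_def[abs_def] V_eq
        by (intro Y.eqv_add Y.eqv_refl A_mem B_add1 B_add2 W d h)
      moreover have "(\<lambda>x. A h x + ((B W h x + B d h x) + (B h W x + B h d x))) = (\<lambda>x. linearization W h x + \<sigma> x)"
        by (auto simp: linearization_def \<sigma>_def)
      ultimately show ?thesis by simp
    qed
    have \<sigma>_bound: "Y.nrm \<sigma> \<le> 2 * C * ?d * ?h"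
    proof -
      have "Y.nrm \<sigma> \<le> Y.nrm (B d h) + Y.nrm (B h d)"
        unfolding \<sigma>_def[abs_def] by (intro Y.nrm_triangle B_mem d h)
      also have "\<dots> \<le> C * (?d * ?h) + C * (?h * ?d)" by (intro add_mono B_bound d h)
      finally show ?thesis by (simp add: algebra_simps)
    qed
    note rV = residual_mem[OF V] and rW = residual_mem[OF W]
    note lV = linearization_mem[OF V h] and lW = linearization_mem[OF W h]
    have split: "ipY (residual V) (linearization V h) - ipY (residual W) (linearization W h)
       = ipY \<rho> (linearization V h) + ipY (residual W) \<sigma>"
    proof -
      have "ipY (residual V) (linearization V h) = ipY (residual W) (linearization V h) + ipY \<rho> (linearization V h)"
        using Y.eqv_ip[OF res lV] by (simp add: Y.ip_add rW \<rho> lV)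
      moreover have "ipY (residual W) (linearization V h) = ipY (residual W) (linearization W h) + ipY (residual W) \<sigma>"
        using Y.eqv_ip[OF lin rW] by (simp add: Y.ip_add lW \<sigma> rW Y.ip_commute[OF rW] lV)
      ultimately show ?thesis by simp
    qed
    have 1: "\<bar>ipY \<rho> (linearization V h)\<bar> \<le> (C * (1 + 4 * M) * ?d) * (C * (1 + 2 * M) * ?h)"
    proof -
      have "\<bar>ipY \<rho> (linearization V h)\<bar> \<le> Y.nrm \<rho> * Y.nrm (linearization V h)" by (rule Y.Cauchy_Schwarz[OF \<rho> lV])
      also have "\<dots> \<le> (C * (1 + 4 * M) * ?d) * (C * (1 + 2 * M) * ?h)"
        using C_nonneg M dn by (intro mult_mono \<rho>_bound linearization_bound V h VM Y.nrm_nonneg lV) auto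
      finally show ?thesis .
    qed
    have 2: "\<bar>ipY (residual W) \<sigma>\<bar> \<le> C * (M + M\<^sup>2) * (2 * C * ?d * ?h)"
    proof -
      have "\<bar>ipY (residual W) \<sigma>\<bar> \<le> Y.nrm (residual W) * Y.nrm \<sigma>" by (rule Y.Cauchy_Schwarz[OF rW \<sigma>])
      also have "\<dots> \<le> C * (M + M\<^sup>2) * (2 * C * ?d * ?h)"
        using C_nonneg M by (intro mult_mono residual_bound \<sigma>_bound W WM Y.nrm_nonneg \<sigma>) auto
      finally show ?thesis .
    qed
    have 3: "\<bar>\<gamma> * (ipX V h - ipX W h)\<bar> \<le> \<gamma> * (?d * ?h)"
    proof -
      have "ipX V h - ipX W h = ipX d h" unfolding d_def[abs_def] by (rule X.ip_diff[OF V W h, symmetric])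
      then show ?thesis using X.Cauchy_Schwarz[OF d h] \<gamma>_nonneg by (simp add: abs_mult mult_left_mono)
    qed
    have abs_le: "x = 2 * (y + z) + 2 * w \<Longrightarrow> \<bar>x\<bar> \<le> 2 * (\<bar>y\<bar> + \<bar>z\<bar>) + 2 * \<bar>w\<bar>" for x y z w :: real
      by argo
    have "differential V h - differential W h
       = 2 * (ipY \<rho> (linearization V h) + ipY (residual W) \<sigma>) + 2 * (\<gamma> * (ipX V h - ipX W h))"
      unfolding split[symmetric] differential_def by (simp add: algebra_simps)
    then have diff_le: "\<bar>differential V h - differential W h\<bar>
       \<le> 2 * (\<bar>ipY \<rho> (linearization V h)\<bar> + \<bar>ipY (residual W) \<sigma>\<bar>) + 2 * \<bar>\<gamma> * (ipX V h - ipX W h)\<bar>"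
      by (rule abs_le)
    note diff_le
    also have "\<dots> \<le> 2 * ((C * (1 + 4 * M) * ?d) * (C * (1 + 2 * M) * ?h) + C * (M + M\<^sup>2) * (2 * C * ?d * ?h)) + 2 * (\<gamma> * (?d * ?h))"
      by (intro add_mono mult_left_mono 1 2 3) simp_all
    also have "\<dots> = (L - 1) * ?d * ?h" unfolding L_def M(2) by (simp add: algebra_simps)
    also have "\<dots> \<le> L * ?d * ?h" using dn hn by (intro mult_right_mono) auto
    finally show ?thesis unfolding d_def[abs_def] .
  qed
  ultimately show ?thesis by blast
qed

text \<open>
  Gradients along a subspace \<open>H\<close>: the perturbations run through \<open>H\<close> and the gradient lies in \<open>H\<close>,
  while the base point \<open>V\<close> may lie outside of \<open>H\<close>.
\<close>

definition is_gradient :: "('a \<Rightarrow> real) set \<Rightarrow> ('a \<Rightarrow> real) \<Rightarrow> ('a \<Rightarrow> real) \<Rightarrow> bool" where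
  "is_gradient H V g \<longleftrightarrow> g \<in> H \<and> (\<forall>\<epsilon>>0. \<exists>\<delta>>0. \<forall>h\<in>H. X.nrm h < \<delta> \<longrightarrow>
     \<bar>energy (\<lambda>x. V x + h x) - energy V - ipX g h\<bar> \<le> \<epsilon> * X.nrm h)"

lemma is_gradientI:
  assumes V: "V \<in> X" and H: "H \<subseteq> X" and g: "g \<in> H" "\<And>h. h \<in> H \<Longrightarrow> ipX g h = differential V h"
  shows "is_gradient H V g"
  unfolding is_gradient_def
proof (intro conjI allI impI)
  fix \<epsilon> :: real assume \<epsilon>: "0 < \<epsilon>"
  obtain K where K: "K \<ge> 0" "\<And>h. h \<in> X \<Longrightarrow> X.nrm h \<le> 1 \<Longrightarrow>
     \<bar>energy (\<lambda>x. V x + h x) - energy V - differential V h\<bar> \<le> K * (X.nrm h)\<^sup>2"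
    using energy_remainder[OF V] by blast
  define \<delta> where "\<delta> = min 1 (\<epsilon> / (K + 1))"
  have \<delta>: "0 < \<delta>" "\<delta> \<le> 1" using \<epsilon> K(1) by (auto simp: \<delta>_def)
  have "K * \<delta> \<le> \<epsilon>"
  proof -
    have "K * \<delta> \<le> K * (\<epsilon> / (K + 1))" using K(1) by (intro mult_left_mono) (auto simp: \<delta>_def)
    also have "\<dots> \<le> \<epsilon>" using K(1) \<epsilon> by (simp add: field_simps)
    finally show ?thesis .
  qed
  have "\<bar>energy (\<lambda>x. V x + h x) - energy V - ipX g h\<bar> \<le> \<epsilon> * X.nrm h" if h: "h \<in> H" "X.nrm h < \<delta>" for h
  proof -
    have hX: "h \<in> X" using h H by auto
    have n: "0 \<le> X.nrm h" by (rule X.nrm_nonneg[OF hX])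
    have "\<bar>energy (\<lambda>x. V x + h x) - energy V - ipX g h\<bar> \<le> K * (X.nrm h)\<^sup>2"
      using K(2)[OF hX] h \<delta> g(2) by simp
    also have "\<dots> = K * X.nrm h * X.nrm h" by (simp add: power2_eq_square)
    also have "\<dots> \<le> K * \<delta> * X.nrm h" using h n K(1) by (intro mult_right_mono mult_left_mono) auto
    also have "\<dots> \<le> \<epsilon> * X.nrm h" using \<open>K * \<delta> \<le> \<epsilon>\<close> n by (rule mult_right_mono)
    finally show ?thesis .
  qed
  then show "\<exists>\<delta>>0. \<forall>h\<in>H. X.nrm h < \<delta> \<longrightarrow>
     \<bar>energy (\<lambda>x. V x + h x) - energy V - ipX g h\<bar> \<le> \<epsilon> * X.nrm h" using \<delta> by blast
qed (rule g)

text \<open>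
  Two gradients differ by a functional that is \<open>o(\<parallel>h\<parallel>)\<close>; such a linear functional is zero.
\<close>

lemma is_gradient_unique:
  assumes H: "H \<subseteq> X" "\<And>c h. h \<in> H \<Longrightarrow> (\<lambda>x. c * h x) \<in> H"
    and g: "is_gradient H V g" "is_gradient H V g'" and h: "h \<in> H"
  shows "ipX g h = ipX g' h"
proof (rule ccontr)
  assume "ipX g h \<noteq> ipX g' h"
  define a where "a = \<bar>ipX g h - ipX g' h\<bar>"
  have a: "0 < a" using \<open>ipX g h \<noteq> ipX g' h\<close> by (simp add: a_def)
  have X: "g \<in> X" "g' \<in> X" "h \<in> X" using g H(1) h by (auto simp: is_gradient_def)
  define n where "n = X.nrm h"
  have n: "0 \<le> n" using X.nrm_nonneg[OF X(3)] by (simp add: n_def)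
  define \<epsilon> where "\<epsilon> = a / (3 * (n + 1))"
  have \<epsilon>: "0 < \<epsilon>" using a n by (simp add: \<epsilon>_def)
  obtain \<delta> where \<delta>: "0 < \<delta>" "\<And>h. h \<in> H \<Longrightarrow> X.nrm h < \<delta> \<Longrightarrow> \<bar>energy (\<lambda>x. V x + h x) - energy V - ipX g h\<bar> \<le> \<epsilon> * X.nrm h"
    using g(1) \<epsilon> unfolding is_gradient_def by blast
  obtain \<delta>' where \<delta>': "0 < \<delta>'" "\<And>h. h \<in> H \<Longrightarrow> X.nrm h < \<delta>' \<Longrightarrow> \<bar>energy (\<lambda>x. V x + h x) - energy V - ipX g' h\<bar> \<le> \<epsilon> * X.nrm h"
    using g(2) \<epsilon> unfolding is_gradient_def by blast
  define s where "s = min \<delta> \<delta>' / (n + 1)"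
  have s: "0 < s" using \<delta>(1) \<delta>'(1) n by (simp add: s_def)
  define k where "k x = s * h x" for x
  have k: "k \<in> H" unfolding k_def[abs_def] by (rule H(2)[OF h])
  have kn: "X.nrm k = s * n" using X.nrm_cmult[OF X(3), of s] s by (simp add: k_def[abs_def] n_def)
  have "s * n < s * (n + 1)" using s by simp
  also have "\<dots> = min \<delta> \<delta>'" using n by (simp add: s_def)
  finally have small: "X.nrm k < \<delta>" "X.nrm k < \<delta>'" using kn by auto
  have ks: "ipX g k = s * ipX g h" "ipX g' k = s * ipX g' h"
    unfolding k_def[abs_def] using X by (simp_all add: X.ip_cmult2)
  have "\<bar>ipX g k - ipX g' k\<bar> \<le> 2 * (\<epsilon> * (s * n))"
    using \<delta>(2)[OF k small(1)] \<delta>'(2)[OF k small(2)] unfolding kn by linarith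
  moreover have "\<bar>ipX g k - ipX g' k\<bar> = s * a"
    using s unfolding ks a_def by (simp add: right_diff_distrib[symmetric] abs_mult)
  ultimately have "s * a \<le> s * (2 * \<epsilon> * n)" by (simp add: mult_ac)
  then have "a \<le> 2 * \<epsilon> * n" using s by simp
  also have "\<dots> \<le> 2 * a / 3" using a n by (simp add: \<epsilon>_def field_simps)
  finally show False using a by simp
qed

lemma gradient_at_minimum:
  assumes H: "H \<subseteq> X" "\<And>c h. h \<in> H \<Longrightarrow> (\<lambda>x. c * h x) \<in> H"
    and g: "is_gradient H V g"
    and r: "0 < r" "\<And>h. h \<in> H \<Longrightarrow> X.nrm h < r \<Longrightarrow> energy V \<le> energy (\<lambda>x. V x + h x)"
  shows "X.nrm g = 0"
proof (rule ccontr)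
  assume ne: "X.nrm g \<noteq> 0"
  have gH: "g \<in> H" and gX: "g \<in> X" using g H(1) by (auto simp: is_gradient_def)
  define n where "n = X.nrm g"
  have n: "0 < n" using ne X.nrm_nonneg[OF gX] by (simp add: n_def)
  then have "0 < n / 2" by simp
  then obtain \<delta> where \<delta>: "0 < \<delta>" "\<And>h. h \<in> H \<Longrightarrow> X.nrm h < \<delta> \<Longrightarrow> \<bar>energy (\<lambda>x. V x + h x) - energy V - ipX g h\<bar> \<le> n / 2 * X.nrm h"
    using g unfolding is_gradient_def by blast
  define s where "s = min \<delta> r / (2 * n)"
  have s: "0 < s" using \<delta>(1) r(1) n by (simp add: s_def)
  \<comment> \<open>A short step against the gradient would decrease the energy.\<close>
  define k where "k x = (- s) * g x" for x
  have k: "k \<in> H" unfolding k_def[abs_def] by (rule H(2)[OF gH])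
  have kn: "X.nrm k = s * n" using X.nrm_cmult[OF gX, of "- s"] s by (simp add: k_def[abs_def] n_def)
  have "s * n = min \<delta> r / 2" using n by (simp add: s_def)
  then have small: "X.nrm k < \<delta>" "X.nrm k < r" using kn \<delta>(1) r(1) by auto
  have "ipX g k = (- s) * ipX g g" unfolding k_def[abs_def] by (rule X.ip_cmult2[OF gX gX])
  then have "ipX g k = - (s * n\<^sup>2)" using X.nrm_square[OF gX] by (simp add: n_def)
  then have "s * n\<^sup>2 \<le> n / 2 * (s * n)"
    using \<delta>(2)[OF k small(1)] r(2)[OF k small(2)] unfolding kn by linarith
  moreover have "0 < s * n\<^sup>2" using s n by simp
  ultimately show False by (simp add: power2_eq_square mult_ac)
qed

text \<open>
  The differential is a bounded linear functional, so Riesz' theorem in \<open>H\<close> represents it.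
\<close>

lemma gradient_exists:
  assumes H: "semi_inner_space H ipX" "H \<subseteq> X"
    and complete: "\<And>f. (\<And>n. f n \<in> H) \<Longrightarrow>
      (\<And>e. e > 0 \<Longrightarrow> \<exists>N. \<forall>m\<ge>N. \<forall>n\<ge>N. X.nrm (\<lambda>x. f m x - f n x) < e) \<Longrightarrow>
      \<exists>g\<in>H. (\<lambda>n::nat. X.nrm (\<lambda>x. f n x - g x)) \<longlonglongrightarrow> 0"
    and V: "V \<in> X"
  shows "\<exists>g. is_gradient H V g \<and> (\<forall>h\<in>H. ipX g h = differential V h)"
proof -
  interpret H: semi_inner_space H ipX by (rule H(1))
  obtain D where D: "\<And>h. h \<in> X \<Longrightarrow> \<bar>differential V h\<bar> \<le> D * X.nrm h" using differential_bound[OF V] by blast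
  have "\<exists>g\<in>H. \<forall>h\<in>H. ipX g h = differential V h"
  proof (rule H.Riesz[where C = D])
    show "differential V (\<lambda>x. u x + c * v x) = differential V u + c * differential V v"
      if "u \<in> H" "v \<in> H" for u v c using that H(2) by (intro differential_lincomb V) auto
    show "\<bar>differential V u\<bar> \<le> D * H.nrm u" if "u \<in> H" for u
      using D[of u] that H(2) by (auto simp: H.nrm_def X.nrm_def)
  qed (use complete in \<open>simp add: H.nrm_def X.nrm_def\<close>)
  then show ?thesis using is_gradientI[OF V H(2)] by blast
qed

end

section \<open>Linearity and closedness of traces\<close>

context rectangle
begin

lemma sobolev_semi_inner: "semi_inner_space (sobolev k R) (sobolev_inner k R)"
  by unfold_locales
    (auto intro: sobolev_zero sobolev_lincomb sobolev_inner_commute sobolev_inner_nonneg sobolev_inner_lincomb)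

lemma sobolev_nrm: "semi_inner_space.nrm (sobolev_inner k R) = sobolev_norm k R"
  by (rule ext) (simp add: semi_inner_space.nrm_def[OF sobolev_semi_inner] sobolev_norm_def)

lemmas sobolev_norm_triangle = semi_inner_space.nrm_triangle[OF sobolev_semi_inner, unfolded sobolev_nrm]
  and sobolev_norm_cmult = semi_inner_space.nrm_cmult[OF sobolev_semi_inner, unfolded sobolev_nrm]
  and sobolev_norm_commute = semi_inner_space.nrm_minus_commute[OF sobolev_semi_inner, unfolded sobolev_nrm]
  and sobolev_norm_zero = semi_inner_space.nrm_zero[OF sobolev_semi_inner, unfolded sobolev_nrm]
  and sobolev_norm_diff_triangle = semi_inner_space.nrm_diff_triangle[OF sobolev_semi_inner, unfolded sobolev_nrm]

lemma sobolev_norm_AE_eq: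
  assumes "u \<in> sobolev k R" "AE x in \<mu>. u x = v x" "v \<in> borel_measurable \<mu>"
  shows "sobolev_norm k R (\<lambda>x. u x - v x) = 0"
proof -
  have "sobolev_norm k R (\<lambda>x. u x - v x) = sobolev_norm k R (\<lambda>_. 0)"
    using assms sobolev_wd_0(2)[OF assms(1), THEN L2_measurable]
    by (intro sobolev_norm_cong_AE[OF sobolev_zero]) auto
  then show ?thesis by (simp add: sobolev_norm_zero)
qed

lemma has_trace_cong_AE:
  assumes tr: "has_trace R I p u g" and eq: "AE x in \<mu>. u x = u' x" and u': "u' \<in> borel_measurable \<mu>"
  shows "has_trace R I p u' g"
proof -
  from tr obtain \<phi> where u: "u \<in> sobolev 1 R" and g: "square_integrable I g"
    and \<phi>: "\<And>n. \<phi> n \<in> sobolev 1 R \<and> continuous_on (closure R) (\<phi> n)"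
      "(\<lambda>n. sobolev_norm 1 R (\<lambda>x. u x - \<phi> n x)) \<longlonglongrightarrow> 0"
      "(\<lambda>n. LINT s:I|lborel. (\<phi> n (p s) - g s)\<^sup>2) \<longlonglongrightarrow> 0"
    unfolding has_trace_def by blast
  have "sobolev_norm 1 R (\<lambda>x. u' x - \<phi> n x) = sobolev_norm 1 R (\<lambda>x. u x - \<phi> n x)" for n
    using eq u' \<phi>(1)[of n] sobolev_wd_0(2)[of "\<phi> n", THEN L2_measurable]
    by (intro sobolev_norm_cong_AE sobolev_diff u) auto
  then have "(\<lambda>n. sobolev_norm 1 R (\<lambda>x. u' x - \<phi> n x)) \<longlonglongrightarrow> 0" using \<phi>(2) by simp
  then show ?thesis
    unfolding has_trace_def using sobolev_cong_AE(1)[OF u eq u'] g \<phi>(1,3) by blast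
qed

lemma has_trace_lincomb:
  assumes p: "edge_path L p" and tr: "has_trace R {0<..<L} p u g" "has_trace R {0<..<L} p u' g'"
  shows "has_trace R {0<..<L} p (\<lambda>x. u x + c * u' x) (\<lambda>s. g s + c * g' s)"
proof -
  let ?E = "restrict_space lborel {0<..<L}"
  from tr(1) obtain \<phi> where u: "u \<in> sobolev 1 R" and "square_integrable {0<..<L} g"
    and \<phi>: "\<And>n. \<phi> n \<in> sobolev 1 R" "\<And>n. continuous_on (closure R) (\<phi> n)"
      "(\<lambda>n. sobolev_norm 1 R (\<lambda>x. u x - \<phi> n x)) \<longlonglongrightarrow> 0"
      "(\<lambda>n. LINT s:{0<..<L}|lborel. (\<phi> n (p s) - g s)\<^sup>2) \<longlonglongrightarrow> 0"
    unfolding has_trace_def by blast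
  from tr(2) obtain \<phi>' where u': "u' \<in> sobolev 1 R" and "square_integrable {0<..<L} g'"
    and \<phi>': "\<And>n. \<phi>' n \<in> sobolev 1 R" "\<And>n. continuous_on (closure R) (\<phi>' n)"
      "(\<lambda>n. sobolev_norm 1 R (\<lambda>x. u' x - \<phi>' n x)) \<longlonglongrightarrow> 0"
      "(\<lambda>n. LINT s:{0<..<L}|lborel. (\<phi>' n (p s) - g' s)\<^sup>2) \<longlonglongrightarrow> 0"
    unfolding has_trace_def by blast
  have g: "g \<in> L2 ?E" and g': "g' \<in> L2 ?E"
    using \<open>square_integrable {0<..<L} g\<close> \<open>square_integrable {0<..<L} g'\<close> by (simp_all add: square_integrable_iff_L2)
  define \<Phi> where "\<Phi> n x = \<phi> n x + c * \<phi>' n x" for n x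
  have 1: "\<Phi> n \<in> sobolev 1 R" "continuous_on (closure R) (\<Phi> n)" for n
    unfolding \<Phi>_def[abs_def] by (intro sobolev_lincomb \<phi> \<phi>' continuous_intros)+
  have 2: "(\<lambda>n. sobolev_norm 1 R (\<lambda>x. (u x + c * u' x) - \<Phi> n x)) \<longlonglongrightarrow> 0"
  proof (rule Lim_null_comparison[OF always_eventually[OF allI]])
    fix n
    have "(\<lambda>x. (u x + c * u' x) - \<Phi> n x) = (\<lambda>x. (u x - \<phi> n x) + c * (u' x - \<phi>' n x))"
      by (auto simp: \<Phi>_def algebra_simps)
    then show "norm (sobolev_norm 1 R (\<lambda>x. (u x + c * u' x) - \<Phi> n x))
       \<le> sobolev_norm 1 R (\<lambda>x. u x - \<phi> n x) + \<bar>c\<bar> * sobolev_norm 1 R (\<lambda>x. u' x - \<phi>' n x)"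
      using sobolev_norm_triangle[OF sobolev_diff[OF u \<phi>(1)] sobolev_cmult[OF sobolev_diff[OF u' \<phi>'(1)]], of n c n]
        sobolev_norm_cmult[OF sobolev_diff[OF u' \<phi>'(1)], of c n] by simp
  next
    show "(\<lambda>n. sobolev_norm 1 R (\<lambda>x. u x - \<phi> n x) + \<bar>c\<bar> * sobolev_norm 1 R (\<lambda>x. u' x - \<phi>' n x)) \<longlonglongrightarrow> 0"
      using tendsto_add[OF \<phi>(3) tendsto_mult_left[OF \<phi>'(3), of "\<bar>c\<bar>"]] by simp
  qed
  have 3: "(\<lambda>n. LINT s:{0<..<L}|lborel. (\<Phi> n (p s) - (g s + c * g' s))\<^sup>2) \<longlonglongrightarrow> 0"
  proof (rule Lim_null_comparison[OF always_eventually[OF allI]])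
    fix n
    have d: "(\<lambda>s. \<phi> n (p s) - g s) \<in> L2 ?E" "(\<lambda>s. \<phi>' n (p s) - g' s) \<in> L2 ?E"
      "(\<lambda>s. \<Phi> n (p s) - (g s + c * g' s)) \<in> L2 ?E"
      by (intro L2_diff L2_lincomb g g' continuous_L2_edge_path[OF p] \<phi> \<phi>' 1)+
    have "(LINT s|?E. (\<Phi> n (p s) - (g s + c * g' s))\<^sup>2)
       \<le> (LINT s|?E. 2 * (\<phi> n (p s) - g s)\<^sup>2 + 2 * c\<^sup>2 * (\<phi>' n (p s) - g' s)\<^sup>2)"
    proof (rule integral_mono)
      fix s
      have "(x + y)\<^sup>2 \<le> 2 * x\<^sup>2 + 2 * y\<^sup>2" for x y :: real
        using sum_squares_bound[of x y] by (simp add: power2_sum)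
      note this[of "\<phi> n (p s) - g s" "c * (\<phi>' n (p s) - g' s)"]
      also have "(\<phi> n (p s) - g s) + c * (\<phi>' n (p s) - g' s) = \<Phi> n (p s) - (g s + c * g' s)"
        by (simp add: \<Phi>_def algebra_simps)
      finally show "(\<Phi> n (p s) - (g s + c * g' s))\<^sup>2 \<le> 2 * (\<phi> n (p s) - g s)\<^sup>2 + 2 * c\<^sup>2 * (\<phi>' n (p s) - g' s)\<^sup>2"
        by (simp only: power_mult_distrib mult.assoc)
    qed (use d[THEN L2_square] in simp_all)
    also have "\<dots> = 2 * (LINT s|?E. (\<phi> n (p s) - g s)\<^sup>2) + 2 * c\<^sup>2 * (LINT s|?E. (\<phi>' n (p s) - g' s)\<^sup>2)"
      using d[THEN L2_square] by simp
    finally show "norm (LINT s:{0<..<L}|lborel. (\<Phi> n (p s) - (g s + c * g' s))\<^sup>2)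
       \<le> 2 * (LINT s:{0<..<L}|lborel. (\<phi> n (p s) - g s)\<^sup>2) + 2 * c\<^sup>2 * (LINT s:{0<..<L}|lborel. (\<phi>' n (p s) - g' s)\<^sup>2)"
      by (simp add: set_integral_as_restrict)
  next
    show "(\<lambda>n. 2 * (LINT s:{0<..<L}|lborel. (\<phi> n (p s) - g s)\<^sup>2) + 2 * c\<^sup>2 * (LINT s:{0<..<L}|lborel. (\<phi>' n (p s) - g' s)\<^sup>2)) \<longlonglongrightarrow> 0"
      using tendsto_add[OF tendsto_mult_left[OF \<phi>(4), of 2] tendsto_mult_left[OF \<phi>'(4), of "2 * c\<^sup>2"]] by simp
  qed
  have 4: "square_integrable {0<..<L} (\<lambda>s. g s + c * g' s)"
    using L2_lincomb[OF g g'] by (simp add: square_integrable_iff_L2)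
  show ?thesis unfolding has_trace_def using sobolev_lincomb[OF u u'] 1 2 3 4 by blast
qed

lemma has_trace_zero: "has_trace R {0<..<L} p (\<lambda>_. 0) (\<lambda>_. 0)"
  unfolding has_trace_def
  by (intro conjI sobolev_zero exI[of _ "\<lambda>_ _. 0"])
    (auto simp: sobolev_zero sobolev_norm_zero square_integrable_iff_L2 L2_def)

text \<open>The condition of zero trace is closed in \<open>H\<^sup>1\<close>: choose a diagonal sequence.\<close>

lemma has_trace_zero_limit:
  assumes tr: "\<And>n. has_trace R I p (u n) (\<lambda>_. 0)" and U: "U \<in> sobolev 1 R"
    and lim: "(\<lambda>n. sobolev_norm 1 R (\<lambda>x. u n x - U x)) \<longlonglongrightarrow> 0"
  shows "has_trace R I p U (\<lambda>_. 0)"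
proof -
  have u: "u n \<in> sobolev 1 R" for n using tr[of n] by (simp add: has_trace_def)
  have "\<exists>\<phi>. \<phi> \<in> sobolev 1 R \<and> continuous_on (closure R) \<phi> \<and> sobolev_norm 1 R (\<lambda>x. u n x - \<phi> x) < 1 / (real n + 1)
      \<and> (LINT s:I|lborel. (\<phi> (p s) - 0)\<^sup>2) < 1 / (real n + 1)" for n
  proof -
    obtain \<phi> where \<phi>: "\<And>m. \<phi> m \<in> sobolev 1 R \<and> continuous_on (closure R) (\<phi> m)"
      "(\<lambda>m. sobolev_norm 1 R (\<lambda>x. u n x - \<phi> m x)) \<longlonglongrightarrow> 0"
      "(\<lambda>m. LINT s:I|lborel. (\<phi> m (p s) - 0)\<^sup>2) \<longlonglongrightarrow> 0"
      using tr[of n] unfolding has_trace_def by blast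
    have pos: "0 < 1 / (real n + 1)" by simp
    have "\<forall>\<^sub>F m in sequentially. sobolev_norm 1 R (\<lambda>x. u n x - \<phi> m x) < 1 / (real n + 1)
       \<and> (LINT s:I|lborel. (\<phi> m (p s) - 0)\<^sup>2) < 1 / (real n + 1)"
      using order_tendstoD(2)[OF \<phi>(2) pos] order_tendstoD(2)[OF \<phi>(3) pos] by (rule eventually_conj)
    then obtain m where "sobolev_norm 1 R (\<lambda>x. u n x - \<phi> m x) < 1 / (real n + 1)"
       "(LINT s:I|lborel. (\<phi> m (p s) - 0)\<^sup>2) < 1 / (real n + 1)"
      by (auto simp: eventually_sequentially)
    then show ?thesis using \<phi>(1)[of m] by blast
  qed
  then have "\<forall>n. \<exists>\<phi>. \<phi> \<in> sobolev 1 R \<and> continuous_on (closure R) \<phi> \<and> sobolev_norm 1 R (\<lambda>x. u n x - \<phi> x) < 1 / (real n + 1)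
      \<and> (LINT s:I|lborel. (\<phi> (p s) - 0)\<^sup>2) < 1 / (real n + 1)" by blast
  from choice[OF this] obtain \<phi> where \<phi>: "\<And>n. \<phi> n \<in> sobolev 1 R" "\<And>n. continuous_on (closure R) (\<phi> n)"
    "\<And>n. sobolev_norm 1 R (\<lambda>x. u n x - \<phi> n x) < 1 / (real n + 1)"
    "\<And>n. (LINT s:I|lborel. (\<phi> n (p s) - 0)\<^sup>2) < 1 / (real n + 1)" by blast
  have inv: "(\<lambda>n. 1 / (real n + 1)) \<longlonglongrightarrow> 0"
    using LIMSEQ_inverse_real_of_nat by (simp add: inverse_eq_divide add.commute)
  have 1: "(\<lambda>n. sobolev_norm 1 R (\<lambda>x. U x - \<phi> n x)) \<longlonglongrightarrow> 0"
  proof (rule Lim_null_comparison[OF always_eventually[OF allI]])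
    fix n
    show "norm (sobolev_norm 1 R (\<lambda>x. U x - \<phi> n x)) \<le> sobolev_norm 1 R (\<lambda>x. u n x - U x) + 1 / (real n + 1)"
      using sobolev_norm_diff_triangle[OF U u \<phi>(1), of n n] \<phi>(3)[of n] sobolev_norm_commute[OF U u, of n] by simp
  next
    show "(\<lambda>n. sobolev_norm 1 R (\<lambda>x. u n x - U x) + 1 / (real n + 1)) \<longlonglongrightarrow> 0"
      using tendsto_add[OF lim inv] by simp
  qed
  have 2: "(\<lambda>n. LINT s:I|lborel. (\<phi> n (p s) - 0)\<^sup>2) \<longlonglongrightarrow> 0"
  proof (rule Lim_null_comparison[OF always_eventually[OF allI] inv])
    fix n
    have "0 \<le> (LINT s:I|lborel. (\<phi> n (p s) - 0)\<^sup>2)"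
      unfolding set_lebesgue_integral_def by (intro integral_nonneg_AE) auto
    then show "norm (LINT s:I|lborel. (\<phi> n (p s) - 0)\<^sup>2) \<le> 1 / (real n + 1)" using \<phi>(4)[of n] by simp
  qed
  show ?thesis
    unfolding has_trace_def using U \<phi>(1,2) 1 2 tr[of 0] unfolding has_trace_def by blast
qed

text \<open>
  The continuous representative is its own approximating sequence, so its boundary values are a
  trace.
\<close>

lemma representative_trace:
  assumes u: "u \<in> sobolev 2 R"
  shows "has_trace R {0<..<b} (\<lambda>y. (y, 0)) u (\<lambda>y. representative u (y, 0))"
proof -
  have c: "continuous_on (closure R) (representative u)"
    by (rule continuous_on_subset[OF representative_continuous[OF u]]) simp
  have u1: "u \<in> sobolev 1 R" using u sobolev_mono[of 1 2] by auto
  have eq: "AE x in \<mu>. u x = representative u x" using representative_AE[OF u] by auto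
  have m: "representative u \<in> borel_measurable \<mu>"
    by (rule continuous_measurable_mu[OF representative_continuous[OF u]])
  show ?thesis
    unfolding has_trace_def
  proof (intro conjI exI[of _ "\<lambda>_::nat. representative u"] allI)
    show "u \<in> sobolev 1 R" by (rule u1)
    show "square_integrable {0<..<b} (\<lambda>y. representative u (y, 0))"
      using continuous_L2_edge[OF c] by (simp add: square_integrable_iff_L2)
    show "representative u \<in> sobolev 1 R" by (rule sobolev_cong_AE(1)[OF u1 eq m])
    show "continuous_on (closure R) (representative u)" by (rule c)
    show "(\<lambda>n. sobolev_norm 1 R (\<lambda>x. u x - representative u x)) \<longlonglongrightarrow> 0"
      using sobolev_norm_AE_eq[OF u1 eq m] by simp
  qed simp
qed

lemma initial_trace_has_trace:
  assumes "u \<in> sobolev 2 R"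
  shows "has_trace R {0<..<b} (\<lambda>y. (y, 0)) u (initial_trace b T u)"
  unfolding initial_trace_def trace_def
  by (rule someI[of "has_trace R {0<..<b} (\<lambda>y. (y, 0)) u", OF representative_trace[OF assms]])

definition trace_const :: real where
  "trace_const = (1 / (b * T) + 1 / T + 1 / b + 1) * sqrt (b * T)"

lemma trace_const_nonneg: "0 \<le> trace_const"
  using b_pos T_pos by (simp add: trace_const_def)

text \<open>
  Two derivatives control the trace in the supremum norm, not only in \<open>L\<^sup>2\<close>. Applied to \<open>V\<^sub>y\<close>, this
  makes the product \<open>V\<^sub>y(y, 0) V(y, t)\<close> square integrable.
\<close>

lemma initial_trace_bound:
  assumes "u \<in> sobolev 2 R"
  shows "AE y in lborel. y \<in> {0<..<b} \<longrightarrow> \<bar>initial_trace b T u y\<bar> \<le> trace_const * sobolev_norm 2 R u"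
  using trace_unique[OF initial_trace_has_trace[OF assms] representative_trace[OF assms]]
proof eventually_elim
  case (elim y)
  then show ?case using representative_bound[OF assms, of "(y, 0)"] by (simp add: trace_const_def)
qed

lemma initial_trace_lincomb:
  assumes u: "u \<in> sobolev 2 R" and v: "v \<in> sobolev 2 R" and w: "w \<in> sobolev 2 R"
    and eq: "AE x in \<mu>. w x = u x + c * v x"
  shows "AE y in lborel. y \<in> {0<..<b} \<longrightarrow> initial_trace b T w y = initial_trace b T u y + c * initial_trace b T v y"
proof (rule trace_unique[OF initial_trace_has_trace[OF w]])
  have "has_trace R {0<..<b} (\<lambda>y. (y, 0)) (\<lambda>x. u x + c * v x) (\<lambda>y. initial_trace b T u y + c * initial_trace b T v y)"
    by (intro has_trace_lincomb edge_path_bottom initial_trace_has_trace u v)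
  then show "has_trace R {0<..<b} (\<lambda>y. (y, 0)) w (\<lambda>y. initial_trace b T u y + c * initial_trace b T v y)"
    by (rule has_trace_cong_AE) (use eq sobolev_wd_0(2)[OF w, THEN L2_measurable] in auto)
qed

lemma AE_fst:
  assumes "AE y in lborel. y \<in> {0<..<b} \<longrightarrow> P y"
  shows "AE z in \<mu>. P (fst z)"
proof -
  obtain N where N: "{y. \<not> (y \<in> {0<..<b} \<longrightarrow> P y)} \<subseteq> N" "N \<in> null_sets lborel"
    using assms by (auto simp: eventually_ae_filter)
  then have "N \<times> UNIV \<in> null_sets (lborel \<Otimes>\<^sub>M lborel)"
    by (auto simp: null_sets_def lborel.emeasure_pair_measure_Times)
  from AE_not_in[OF this[unfolded lborel_prod]] show ?thesis
    unfolding AE_mu by eventually_elim (use N(1) in \<open>auto simp: rect_def mem_Times_iff\<close>)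
qed

lemma initial_trace_measurable:
  assumes "u \<in> sobolev 2 R" shows "(\<lambda>z. initial_trace b T u (fst z)) \<in> borel_measurable \<mu>"
proof -
  let ?g = "initial_trace b T u"
  have "?g \<in> L2 (restrict_space lborel {0<..<b})"
    using initial_trace_has_trace[OF assms] by (simp add: has_trace_def square_integrable_iff_L2)
  then have "(\<lambda>y. indicator {0<..<b} y *\<^sub>R ?g y) \<in> borel_measurable borel"
    using L2_measurable by (fastforce simp: borel_measurable_restrict_space_iff)
  from measurable_compose[OF fst_mu this]
  have "(\<lambda>z. indicator {0<..<b} (fst z) *\<^sub>R ?g (fst z)) \<in> borel_measurable \<mu>" .
  then show ?thesis
  proof (rule measurable_cong[THEN iffD1, rotated])
    fix z assume "z \<in> space \<mu>"
    then have "z \<in> R" by simp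
    then show "indicator {0<..<b} (fst z) *\<^sub>R ?g (fst z) = ?g (fst z)" by (auto simp: rect_def)
  qed
qed

section \<open>The space of perturbations and the data balls\<close>

abbreviation "dy \<equiv> wd (mixed 1 0)"

lemma pderiv_wd: "pderiv b T i j = wd (mixed i j)"
  by (simp add: pderiv_def mixed_def)

lemma dy_sobolev: "u \<in> sobolev 4 R \<Longrightarrow> dy u \<in> sobolev 3 R"
  and dy_norm: "u \<in> sobolev 4 R \<Longrightarrow> sobolev_norm 3 R (dy u) \<le> sobolev_norm 4 R u"
  using sobolev_deriv[of u 3 1 "mixed 1 0"] by (auto simp: mixed_in_multi_indices)

lemma dy_lincomb:
  "u \<in> sobolev 4 R \<Longrightarrow> v \<in> sobolev 4 R \<Longrightarrow> AE x in \<mu>. dy (\<lambda>x. u x + c * v x) x = dy u x + c * dy v x"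
  by (rule wd_lincomb) (auto simp: mixed_in_multi_indices)

lemma trace_y_lincomb:
  assumes "0 \<le> a" "a \<le> b" "trace_y b T a u g" "trace_y b T a u' g'"
  shows "trace_y b T a (\<lambda>x. u x + c * u' x) (\<lambda>s. g s + c * g' s)"
  using assms unfolding trace_y_def by (intro has_trace_lincomb edge_path_side) auto

lemma trace_y_dy_lincomb:
  assumes a: "0 \<le> a" "a \<le> b" and u: "u \<in> sobolev 4 R" "u' \<in> sobolev 4 R"
    and tr: "trace_y b T a (dy u) g" "trace_y b T a (dy u') g'"
  shows "trace_y b T a (dy (\<lambda>x. u x + c * u' x)) (\<lambda>s. g s + c * g' s)"
  using trace_y_lincomb[OF a tr, of c] unfolding trace_y_def
proof (rule has_trace_cong_AE)
  show "AE x in \<mu>. dy u x + c * dy u' x = dy (\<lambda>x. u x + c * u' x) x"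
    using dy_lincomb[OF u, of c] by eventually_elim simp
  show "dy (\<lambda>x. u x + c * u' x) \<in> borel_measurable \<mu>"
    using sobolev_wd_0(2)[OF dy_sobolev[OF sobolev_lincomb[OF u]], THEN L2_measurable] .
qed

lemma H04_iff: "u \<in> H04 b T \<longleftrightarrow> u \<in> sobolev 4 R \<and> trace_y b T 0 u (\<lambda>_. 0) \<and>
    trace_y b T 0 (dy u) (\<lambda>_. 0) \<and> trace_y b T b (dy u) (\<lambda>_. 0)"
  using sobolev_mono[of 2 4] by (auto simp: H04_def H02_def pderiv_wd)

lemma H04_sobolev: "H04 b T \<subseteq> sobolev 4 R"
  by (auto simp: H04_iff)

lemma H04_lincomb:
  assumes "u \<in> H04 b T" "v \<in> H04 b T" shows "(\<lambda>x. u x + c * v x) \<in> H04 b T"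
  using assms b_pos trace_y_lincomb[of 0 u "\<lambda>_. 0" v "\<lambda>_. 0" c]
    trace_y_dy_lincomb[of 0 u v "\<lambda>_. 0" "\<lambda>_. 0" c] trace_y_dy_lincomb[of b u v "\<lambda>_. 0" "\<lambda>_. 0" c]
  by (auto simp: H04_iff intro: sobolev_lincomb)

lemma H04_zero: "(\<lambda>_. 0) \<in> H04 b T"
proof -
  have z: "(\<lambda>_. 0) \<in> sobolev 4 R" by (rule sobolev_zero)
  have "AE x in \<mu>. 0 = dy (\<lambda>_. 0) x" using wd_lincomb[OF z z, of "mixed 1 0" "-1"]
    by (auto simp: mixed_in_multi_indices)
  moreover have "dy (\<lambda>_. 0) \<in> borel_measurable \<mu>"
    using sobolev_wd_0(2)[OF dy_sobolev[OF z], THEN L2_measurable] .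
  ultimately have "has_trace R {0<..<T} p (dy (\<lambda>_. 0)) (\<lambda>_. 0)" for p
    by (rule has_trace_cong_AE[OF has_trace_zero])
  then show ?thesis using z has_trace_zero by (auto simp: H04_iff trace_y_def)
qed

lemma H04_semi_inner: "semi_inner_space (H04 b T) (H4_inner b T)"
  using H04_sobolev
  by unfold_locales
    (auto intro!: H04_zero H04_lincomb sobolev_inner_commute sobolev_inner_nonneg sobolev_inner_lincomb)

text \<open>
  Convergence in \<open>H\<^sup>4\<close> implies convergence of the function and of its \<open>y\<close>-derivative in \<open>H\<^sup>1\<close>, where
  the conditions of zero trace are closed.
\<close>

lemma H04_complete:
  assumes f: "\<And>n. f n \<in> H04 b T"
    and cauchy: "\<And>e. e > 0 \<Longrightarrow> \<exists>N. \<forall>m\<ge>N. \<forall>n\<ge>N. H4_norm b T (\<lambda>x. f m x - f n x) < e"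
  shows "\<exists>g\<in>H04 b T. (\<lambda>n. H4_norm b T (\<lambda>x. f n x - g x)) \<longlonglongrightarrow> 0"
proof -
  have f4: "f n \<in> sobolev 4 R" for n using f H04_sobolev by auto
  obtain g where g: "g \<in> sobolev 4 R" and lim: "(\<lambda>n. H4_norm b T (\<lambda>x. f n x - g x)) \<longlonglongrightarrow> 0"
    using sobolev_complete[OF f4 cauchy] by blast
  have lim0: "(\<lambda>n. sobolev_norm 1 R (\<lambda>x. f n x - g x)) \<longlonglongrightarrow> 0"
    by (rule Lim_null_comparison[OF always_eventually[OF allI] lim]) (simp add: sobolev_norm_mono)
  have lim1: "(\<lambda>n. sobolev_norm 1 R (\<lambda>x. dy (f n) x - dy g x)) \<longlonglongrightarrow> 0"
  proof (rule Lim_null_comparison[OF always_eventually[OF allI] lim])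
    fix n
    note d = sobolev_diff[OF f4 g, of n]
    have "sobolev_norm 1 R (\<lambda>x. dy (f n) x - dy g x) = sobolev_norm 1 R (dy (\<lambda>x. f n x - g x))"
    proof (rule sobolev_norm_cong_AE)
      show "dy (\<lambda>x. f n x - g x) \<in> sobolev 1 R" using dy_sobolev[OF d] sobolev_mono[of 1 3] by auto
      show "AE x in \<mu>. dy (\<lambda>x. f n x - g x) x = dy (f n) x - dy g x"
        by (rule wd_diff[OF f4 g]) (simp add: mixed_in_multi_indices)
      show "(\<lambda>x. dy (f n) x - dy g x) \<in> borel_measurable \<mu>"
        using sobolev_wd_0(2)[OF sobolev_diff[OF dy_sobolev[OF f4] dy_sobolev[OF g]], THEN L2_measurable] .
    qed
    also have "\<dots> \<le> H4_norm b T (\<lambda>x. f n x - g x)"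
      using dy_norm[OF d] sobolev_norm_mono[of 1 3 "dy (\<lambda>x. f n x - g x)"] by simp
    finally show "norm (sobolev_norm 1 R (\<lambda>x. dy (f n) x - dy g x)) \<le> H4_norm b T (\<lambda>x. f n x - g x)" by simp
  qed
  have g1: "g \<in> sobolev 1 R" "dy g \<in> sobolev 1 R"
    using g dy_sobolev[OF g] sobolev_mono[of 1 4] sobolev_mono[of 1 3] by auto
  have "g \<in> H04 b T"
    unfolding H04_iff trace_y_def
  proof (intro conjI g)
    show "has_trace R {0<..<T} (\<lambda>t. (0, t)) g (\<lambda>_. 0)"
      by (rule has_trace_zero_limit[OF _ g1(1) lim0]) (use f in \<open>auto simp: H04_iff trace_y_def\<close>)
    show "has_trace R {0<..<T} (\<lambda>t. (0, t)) (dy g) (\<lambda>_. 0)"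
      by (rule has_trace_zero_limit[OF _ g1(2) lim1]) (use f in \<open>auto simp: H04_iff trace_y_def\<close>)
    show "has_trace R {0<..<T} (\<lambda>t. (b, t)) (dy g) (\<lambda>_. 0)"
      by (rule has_trace_zero_limit[OF _ g1(2) lim1]) (use f in \<open>auto simp: H04_iff trace_y_def\<close>)
  qed
  then show ?thesis using lim by blast
qed

lemma data_ball_shift:
  assumes V: "V \<in> data_ball b T r q0 q1" and h: "h \<in> H04 b T" and n: "H4_norm b T (\<lambda>x. V x + c * h x) < r'"
  shows "(\<lambda>x. V x + c * h x) \<in> data_ball b T r' q0 q1"
  using assms b_pos trace_y_lincomb[of 0 V q0 h "\<lambda>_. 0" c]
    trace_y_dy_lincomb[of 0 V h q1 "\<lambda>_. 0" c] trace_y_dy_lincomb[of b V h "\<lambda>_. 0" "\<lambda>_. 0" c]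
  by (auto simp: H04_iff data_ball_def pderiv_wd intro: sobolev_lincomb)

lemma data_ball_diff:
  assumes V: "V \<in> data_ball b T r q0 q1" and W: "W \<in> data_ball b T r' q0 q1"
  shows "(\<lambda>x. V x - W x) \<in> H04 b T"
  using assms b_pos trace_y_lincomb[of 0 V q0 W q0 "-1"]
    trace_y_dy_lincomb[of 0 V W q1 q1 "-1"] trace_y_dy_lincomb[of b V W "\<lambda>_. 0" "\<lambda>_. 0" "-1"]
  by (auto simp: H04_iff data_ball_def pderiv_wd intro: sobolev_diff)

lemma data_ball_closed: "data_ball b T r q0 q1 \<subseteq> closed_data_ball b T r q0 q1"
proof
  fix V assume V: "V \<in> data_ball b T r q0 q1"
  have "sobolev_norm 4 R (\<lambda>x. V x - V x) = 0" by (simp add: sobolev_norm_zero)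
  then show "V \<in> closed_data_ball b T r q0 q1"
    using V unfolding closed_data_ball_def sobolev_closure_def
    by (auto simp: data_ball_def intro!: bexI[of _ V])
qed

section \<open>The functional as the energy of a quadratic residual\<close>

definition weighted_inner :: "real \<Rightarrow> real \<Rightarrow> (real \<times> real \<Rightarrow> real) \<Rightarrow> (real \<times> real \<Rightarrow> real) \<Rightarrow> real" where
  "weighted_inner \<beta> lam f g = (LINT z|\<mu>. f z * g z * carleman_weight \<beta> lam z)"

definition lin_part :: "(real \<times> real \<Rightarrow> real) \<Rightarrow> real \<times> real \<Rightarrow> real" where
  "lin_part V z = wd (mixed 2 0) V z - 2 * wd (mixed 1 1) V z"

definition bilin_part :: "(real \<times> real \<Rightarrow> real) \<Rightarrow> (real \<times> real \<Rightarrow> real) \<Rightarrow> real \<times> real \<Rightarrow> real" where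
  "bilin_part V W z = 4 * initial_trace b T (dy V) (fst z) * W z"

lemma carleman_weight_bounds:
  assumes "0 \<le> \<beta>" "0 \<le> lam" "z \<in> R" shows "0 < carleman_weight \<beta> lam z" "carleman_weight \<beta> lam z \<le> 1"
  using assms by (auto simp: carleman_weight_def rect_def)

lemma carleman_weight_measurable [measurable]: "carleman_weight \<beta> lam \<in> borel_measurable \<mu>"
  by (rule continuous_measurable_mu) (auto simp: carleman_weight_def case_prod_beta intro!: continuous_intros)

lemma weighted_integrable:
  assumes "0 \<le> \<beta>" "0 \<le> lam" "f \<in> L2 \<mu>" "g \<in> L2 \<mu>"
  shows "integrable \<mu> (\<lambda>z. f z * g z * carleman_weight \<beta> lam z)"
proof -
  have "integrable \<mu> (\<lambda>z. carleman_weight \<beta> lam z * (f z * g z))"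
  proof (rule integrable_bounded_mult[OF L2_mult_integrable[OF assms(3,4)] carleman_weight_measurable])
    fix z assume "z \<in> space \<mu>"
    then have "z \<in> R" by simp
    from carleman_weight_bounds[OF assms(1,2) this] show "\<bar>carleman_weight \<beta> lam z\<bar> \<le> 1" by simp
  qed
  then show ?thesis by (simp add: mult_ac)
qed

lemma weighted_semi_inner:
  assumes "0 \<le> \<beta>" "0 \<le> lam" shows "semi_inner_space (L2 \<mu>) (weighted_inner \<beta> lam)"
proof
  note int = weighted_integrable[OF assms]
  show "(\<lambda>_. 0) \<in> L2 \<mu>" by (simp add: L2_def)
  show "(\<lambda>x. u x + c * v x) \<in> L2 \<mu>" if "u \<in> L2 \<mu>" "v \<in> L2 \<mu>" for u v c using that by (rule L2_lincomb)
  show "weighted_inner \<beta> lam u v = weighted_inner \<beta> lam v u" for u v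
    by (simp add: weighted_inner_def mult_ac)
  show "0 \<le> weighted_inner \<beta> lam u u" for u
    unfolding weighted_inner_def
  proof (rule integral_nonneg_AE, rule AE_I2)
    fix z assume "z \<in> space \<mu>"
    then have "z \<in> R" by simp
    from carleman_weight_bounds[OF assms this] show "0 \<le> u z * u z * carleman_weight \<beta> lam z" by simp
  qed
  show "weighted_inner \<beta> lam (\<lambda>x. u x + c * v x) w = weighted_inner \<beta> lam u w + c * weighted_inner \<beta> lam v w"
    if "u \<in> L2 \<mu>" "v \<in> L2 \<mu>" "w \<in> L2 \<mu>" for u v w c
    using int[OF that(1,3)] int[OF that(2,3)] by (simp add: weighted_inner_def algebra_simps)
qed

lemma weighted_nrm_le:
  assumes "0 \<le> \<beta>" "0 \<le> lam" "f \<in> L2 \<mu>"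
  shows "semi_inner_space.nrm (weighted_inner \<beta> lam) f \<le> sqrt (LINT z|\<mu>. (f z)\<^sup>2)"
proof -
  have "weighted_inner \<beta> lam f f \<le> (LINT z|\<mu>. (f z)\<^sup>2)"
    unfolding weighted_inner_def
  proof (rule integral_mono[OF weighted_integrable[OF assms(1,2,3,3)] L2_square[OF assms(3)]])
    fix z assume "z \<in> space \<mu>"
    then have "z \<in> R" by simp
    from carleman_weight_bounds[OF assms(1,2) this]
    show "f z * f z * carleman_weight \<beta> lam z \<le> (f z)\<^sup>2" by (simp add: power2_eq_square mult_left_le)
  qed
  then show ?thesis by (simp add: semi_inner_space.nrm_def[OF weighted_semi_inner[OF assms(1,2)]])
qed

lemma weighted_eqv_AE:
  assumes "0 \<le> \<beta>" "0 \<le> lam" "f \<in> L2 \<mu>" "g \<in> L2 \<mu>" "AE z in \<mu>. f z = g z"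
  shows "semi_inner_space.eqv (L2 \<mu>) (weighted_inner \<beta> lam) f g"
proof -
  interpret Y: semi_inner_space "L2 \<mu>" "weighted_inner \<beta> lam" by (rule weighted_semi_inner[OF assms(1,2)])
  have d: "(\<lambda>z. f z - g z) \<in> L2 \<mu>" by (rule L2_diff[OF assms(3,4)])
  have "(LINT z|\<mu>. (f z - g z)\<^sup>2) = (LINT z|\<mu>. 0)"
    using assms(5) d[THEN L2_measurable] by (intro integral_cong_AE) auto
  then have "Y.nrm (\<lambda>z. f z - g z) \<le> 0" using weighted_nrm_le[OF assms(1,2) d] by simp
  then show ?thesis using Y.nrm_nonneg[OF d] assms(3,4) by (auto simp: Y.eqv_def)
qed

lemma lin_part_L2: "V \<in> sobolev 4 R \<Longrightarrow> lin_part V \<in> L2 \<mu>"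
  unfolding lin_part_def[abs_def]
  by (intro L2_diff L2_cmult sobolev_has_weak_deriv(2)) (auto simp: mixed_in_multi_indices)

lemma dy_sobolev2: "V \<in> sobolev 4 R \<Longrightarrow> dy V \<in> sobolev 2 R"
  using dy_sobolev[of V] sobolev_mono[of 2 3] by auto

lemma bilin_factor_bound:
  assumes V: "V \<in> sobolev 4 R"
  shows "AE z in \<mu>. \<bar>4 * initial_trace b T (dy V) (fst z)\<bar> \<le> 4 * trace_const * H4_norm b T V"
  using AE_fst[OF initial_trace_bound[OF dy_sobolev2[OF V]]]
proof eventually_elim
  case (elim z)
  have "sobolev_norm 2 R (dy V) \<le> H4_norm b T V"
    using dy_norm[OF V] sobolev_norm_mono[of 2 3 "dy V"] by simp
  then have "trace_const * sobolev_norm 2 R (dy V) \<le> trace_const * H4_norm b T V"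
    by (rule mult_left_mono[OF _ trace_const_nonneg])
  then show ?case using elim by (simp add: abs_mult)
qed

lemma bilin_part_L2:
  assumes V: "V \<in> sobolev 4 R" and W: "W \<in> L2 \<mu>" shows "bilin_part V W \<in> L2 \<mu>"
  unfolding bilin_part_def[abs_def]
  using initial_trace_measurable[OF dy_sobolev2[OF V]] by (intro L2_bounded_mult[OF W _ bilin_factor_bound[OF V]]) auto

text \<open>
  The operator \<open>S\<close> is a linear part plus a bilinear part on the diagonal. Weak derivatives and traces
  are linear only almost everywhere, that is, up to elements of norm zero in the weighted space.
\<close>

lemma quadratic_residual_J:
  assumes \<beta>: "0 \<le> \<beta>" and lam: "0 \<le> lam" and \<gamma>: "0 \<le> \<gamma>"
  shows "quadratic_residual (sobolev 4 R) (H4_inner b T) (L2 \<mu>) (weighted_inner \<beta> lam)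
    lin_part bilin_part (3 + 4 * trace_const) \<gamma>"
proof -
  interpret X: semi_inner_space "sobolev 4 R" "H4_inner b T" by (rule sobolev_semi_inner)
  interpret Y: semi_inner_space "L2 \<mu>" "weighted_inner \<beta> lam" by (rule weighted_semi_inner[OF \<beta> lam])
  note nrm_le = weighted_nrm_le[OF \<beta> lam] and eqv = weighted_eqv_AE[OF \<beta> lam]
  note L2 = sobolev_wd_0(2)
  have wd_nrm: "Y.nrm (wd \<alpha> V) \<le> H4_norm b T V" and wd_L2: "wd \<alpha> V \<in> L2 \<mu>"
    if V: "V \<in> sobolev 4 R" and \<alpha>: "\<alpha> \<in> multi_indices 4" for V \<alpha>
  proof -
    show D: "wd \<alpha> V \<in> L2 \<mu>" by (rule sobolev_has_weak_deriv[OF V \<alpha>])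
    have "sqrt (LINT z|\<mu>. (wd \<alpha> V z)\<^sup>2) \<le> H4_norm b T V"
      using wd_norm_le[OF \<alpha>, of V] by (intro real_le_lsqrt) auto
    with nrm_le[OF D] show "Y.nrm (wd \<alpha> V) \<le> H4_norm b T V" by linarith
  qed
  have mi: "mixed 2 0 \<in> multi_indices 4" "mixed 1 1 \<in> multi_indices 4" by (auto simp: mixed_in_multi_indices)
  show ?thesis
  proof
    fix V assume V: "V \<in> sobolev 4 R"
    show "lin_part V \<in> L2 \<mu>" by (rule lin_part_L2[OF V])
    have "Y.nrm (lin_part V) \<le> Y.nrm (wd (mixed 2 0) V) + Y.nrm (\<lambda>z. 2 * wd (mixed 1 1) V z)"
      unfolding lin_part_def[abs_def] by (intro Y.nrm_diff_le Y.cmult_mem wd_L2 V mi)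
    also have "Y.nrm (\<lambda>z. 2 * wd (mixed 1 1) V z) = 2 * Y.nrm (wd (mixed 1 1) V)"
      using Y.nrm_cmult[OF wd_L2[OF V mi(2)], of 2] by simp
    also have "Y.nrm (wd (mixed 2 0) V) + 2 * Y.nrm (wd (mixed 1 1) V) \<le> 3 * H4_norm b T V"
      using wd_nrm[OF V mi(1)] wd_nrm[OF V mi(2)] by linarith
    also have "\<dots> \<le> (3 + 4 * trace_const) * H4_norm b T V"
      using trace_const_nonneg by (intro mult_right_mono) auto
    finally show "Y.nrm (lin_part V) \<le> (3 + 4 * trace_const) * X.nrm V" by (simp add: sobolev_nrm)
  next
    fix V W assume V: "V \<in> sobolev 4 R" and W: "W \<in> sobolev 4 R"
    show B: "bilin_part V W \<in> L2 \<mu>" by (rule bilin_part_L2[OF V L2[OF W]])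
    let ?N = "H4_norm b T"
    let ?k = "4 * trace_const * ?N V"
    have k0: "0 \<le> ?k" using trace_const_nonneg by simp
    have "(LINT z|\<mu>. (bilin_part V W z)\<^sup>2) \<le> (LINT z|\<mu>. ?k\<^sup>2 * (W z)\<^sup>2)"
    proof (rule integral_mono_AE[OF L2_square[OF B]])
      show "integrable \<mu> (\<lambda>z. ?k\<^sup>2 * (W z)\<^sup>2)" using L2_square[OF L2[OF W]] by simp
      show "AE z in \<mu>. (bilin_part V W z)\<^sup>2 \<le> ?k\<^sup>2 * (W z)\<^sup>2"
        using bilin_factor_bound[OF V]
      proof eventually_elim
        case (elim z)
        then have "(4 * initial_trace b T (dy V) (fst z))\<^sup>2 \<le> ?k\<^sup>2"
          using power_mono[OF elim, of 2] by simp
        from mult_right_mono[OF this, of "(W z)\<^sup>2"]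
        show ?case by (simp add: bilin_part_def power_mult_distrib)
      qed
    qed
    also have "\<dots> = ?k\<^sup>2 * (LINT z|\<mu>. (W z)\<^sup>2)" by simp
    also have "\<dots> \<le> ?k\<^sup>2 * (?N W)\<^sup>2"
    proof -
      have "(LINT z|\<mu>. (W z)\<^sup>2) = (LINT z|\<mu>. (wd (\<lambda>_. 0) W z)\<^sup>2)"
        using sobolev_wd_0[OF W] sobolev_has_weak_deriv(2)[OF W zero_multi_indices]
        by (intro integral_cong_AE) (auto dest: L2_measurable)
      then show ?thesis using wd_norm_le[of "\<lambda>_. 0" 4 W] by (simp add: mult_left_mono)
    qed
    finally have "sqrt (LINT z|\<mu>. (bilin_part V W z)\<^sup>2) \<le> ?k * ?N W"
      using k0 by (intro real_le_lsqrt) (auto simp: power_mult_distrib)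
    also have "\<dots> \<le> (3 + 4 * trace_const) * (?N V * ?N W)"
      by (simp add: algebra_simps)
    finally show "Y.nrm (bilin_part V W) \<le> (3 + 4 * trace_const) * (X.nrm V * X.nrm W)"
      using nrm_le[OF B] by (simp add: sobolev_nrm)
  next
    fix V W c assume V: "V \<in> sobolev 4 R" and W: "W \<in> sobolev 4 R"
    note S = sobolev_lincomb[OF V W, of c]
    show "Y.eqv (lin_part (\<lambda>x. V x + c * W x)) (\<lambda>x. lin_part V x + c * lin_part W x)"
    proof (rule eqv)
      show "AE z in \<mu>. lin_part (\<lambda>x. V x + c * W x) z = lin_part V z + c * lin_part W z"
        using wd_lincomb[OF V W mi(1), of c] wd_lincomb[OF V W mi(2), of c]
        by eventually_elim (simp add: lin_part_def algebra_simps)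
    qed (intro lin_part_L2 L2_lincomb V W S)+
    fix U assume U: "U \<in> sobolev 4 R"
    show "Y.eqv (bilin_part (\<lambda>x. V x + c * W x) U) (\<lambda>x. bilin_part V U x + c * bilin_part W U x)"
    proof (rule eqv)
      have "AE z in \<mu>. initial_trace b T (dy (\<lambda>x. V x + c * W x)) (fst z)
          = initial_trace b T (dy V) (fst z) + c * initial_trace b T (dy W) (fst z)"
        by (intro AE_fst initial_trace_lincomb dy_sobolev2 dy_lincomb V W S)
      then show "AE z in \<mu>. bilin_part (\<lambda>x. V x + c * W x) U z = bilin_part V U z + c * bilin_part W U z"
        by eventually_elim (simp add: bilin_part_def algebra_simps)
    qed (intro bilin_part_L2 L2_lincomb V W S L2[OF U])+
    show "Y.eqv (bilin_part U (\<lambda>x. V x + c * W x)) (\<lambda>x. bilin_part U V x + c * bilin_part U W x)"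
    proof (rule eqv)
      show "AE z in \<mu>. bilin_part U (\<lambda>x. V x + c * W x) z = bilin_part U V z + c * bilin_part U W z"
        by (intro AE_I2) (simp add: bilin_part_def algebra_simps)
    qed (intro bilin_part_L2 L2_lincomb U L2[OF V] L2[OF W] L2[OF S])+
  qed (use trace_const_nonneg \<gamma> in auto)
qed

end

context rectangle
begin

section \<open>Gradient descent\<close>

context
  fixes \<beta> lam \<gamma> :: real
  assumes pos: "0 \<le> \<beta>" "0 \<le> lam" "0 \<le> \<gamma>"
begin

abbreviation "J \<equiv> J_fun b T \<beta> lam \<gamma>"
abbreviation "G \<equiv> J_gradient b T \<beta> lam \<gamma>"

interpretation Q: quadratic_residual "sobolev 4 R" "H4_inner b T" "L2 \<mu>" "weighted_inner \<beta> lam"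
    lin_part bilin_part "3 + 4 * trace_const" \<gamma>
  by (rule quadratic_residual_J[OF pos])

lemma J_fun_energy: "J V = Q.energy V"
proof -
  have "S_op b T V = Q.residual V"
    by (rule ext) (auto simp: S_op_def Q.residual_def lin_part_def bilin_part_def pderiv_wd)
  moreover have "(H4_norm b T V)\<^sup>2 = H4_inner b T V V"
    by (simp add: sobolev_norm_def sobolev_inner_nonneg)
  ultimately show ?thesis
    unfolding J_fun_def Q.energy_def weighted_inner_def by (simp add: set_integral_as_restrict power2_eq_square)
qed

lemma has_J_gradient_iff: "has_J_gradient b T \<beta> lam \<gamma> V g \<longleftrightarrow> Q.is_gradient (H04 b T) V g"
  unfolding has_J_gradient_def Q.is_gradient_def J_fun_energy sobolev_nrm ..

lemma H04_cmult: "h \<in> H04 b T \<Longrightarrow> (\<lambda>x. c * h x) \<in> H04 b T"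
  using H04_lincomb[OF H04_zero, of h c] by simp

text \<open>
  The gradient is defined by a choice, but any two gradients have the same inner products with the
  perturbations, and these inner products are given by the differential.
\<close>

lemma J_gradient:
  assumes "V \<in> sobolev 4 R"
  shows "Q.is_gradient (H04 b T) V (G V)" and "G V \<in> H04 b T"
    and "\<And>h. h \<in> H04 b T \<Longrightarrow> H4_inner b T (G V) h = Q.differential V h"
proof -
  obtain g where g: "Q.is_gradient (H04 b T) V g" "\<And>h. h \<in> H04 b T \<Longrightarrow> H4_inner b T g h = Q.differential V h"
    using Q.gradient_exists[unfolded sobolev_nrm, OF H04_semi_inner H04_sobolev H04_complete assms] by blast
  then show G: "Q.is_gradient (H04 b T) V (G V)"
    unfolding J_gradient_def has_J_gradient_iff by (intro someI[of "Q.is_gradient (H04 b T) V"])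
  then show "G V \<in> H04 b T" by (simp add: Q.is_gradient_def)
  show "H4_inner b T (G V) h = Q.differential V h" if "h \<in> H04 b T" for h
    using Q.is_gradient_unique[OF H04_sobolev H04_cmult G g(1) that] g(2)[OF that] by simp
qed

text \<open>
  At an interior minimiser the gradient has norm zero. Adding the strict convexity inequality to
  itself with the two points exchanged shows that the gradient is strongly monotone between an
  iterate and the minimiser, so every step contracts the distance between them. The iterates stay in the ball of radius
  \<open>M\<close>: their distance to the minimiser never exceeds the initial one, which is less than \<open>2 r\<close>, and
  the minimiser has norm less than \<open>r\<close>.
\<close>

lemma descent_converges:
  assumes \<gamma>: "0 < \<gamma>" "\<gamma> < 1" and M: "3 * r \<le> M"
    and conv: "\<And>V W. V \<in> data_ball b T M q0 q1 \<Longrightarrow> W \<in> data_ball b T M q0 q1 \<Longrightarrow>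
       \<gamma> / 2 * (H4_norm b T (\<lambda>x. W x - V x))\<^sup>2 \<le> J W - J V - H4_inner b T (G V) (\<lambda>x. W x - V x)"
    and min: "\<And>W. W \<in> data_ball b T M q0 q1 \<Longrightarrow> J Vmin \<le> J W"
    and Vmin: "Vmin \<in> data_ball b T r q0 q1" and V0: "V0 \<in> data_ball b T r q0 q1"
  shows "\<exists>\<kappa>0. 0 < \<kappa>0 \<and> \<kappa>0 < 1 \<and>
    (\<forall>\<kappa>. 0 < \<kappa> \<and> \<kappa> < \<kappa>0 \<longrightarrow>
       (\<forall>n. descent b T \<beta> lam \<gamma> \<kappa> V0 n \<in> data_ball b T M q0 q1) \<and>
       (\<exists>\<theta>. 0 < \<theta> \<and> \<theta> < 1 \<and>
          (\<forall>n\<ge>1. H4_norm b T (\<lambda>x. Vmin x - descent b T \<beta> lam \<gamma> \<kappa> V0 n x)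
                  \<le> \<theta> ^ n * H4_norm b T (\<lambda>x. Vmin x - V0 x))))"
proof -
  let ?N = "H4_norm b T" and ?ip = "H4_inner b T" and ?B = "data_ball b T M q0 q1"
  interpret H: semi_inner_space "H04 b T" ?ip by (rule H04_semi_inner)
  have Hn: "H.nrm = ?N" by (rule sobolev_nrm)
  have ball4: "V \<in> sobolev 4 R" "?N V < s" if "V \<in> data_ball b T s q0 q1" for V s
    using that by (auto simp: data_ball_def)
  note V4 = ball4(1)[OF Vmin]
  have r: "0 < r" using ball4(2)[OF Vmin] sobolev_norm_nonneg[of 4 Vmin] by linarith
  have VminB: "Vmin \<in> ?B" using Vmin M r by (auto simp: data_ball_def)
  obtain L where L: "0 < L" "\<And>V W h. V \<in> sobolev 4 R \<Longrightarrow> W \<in> sobolev 4 R \<Longrightarrow> ?N V \<le> M \<Longrightarrow> ?N W \<le> M \<Longrightarrow>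
      h \<in> sobolev 4 R \<Longrightarrow> \<bar>Q.differential V h - Q.differential W h\<bar> \<le> L * ?N (\<lambda>x. V x - W x) * ?N h"
    using Q.differential_Lipschitz[of M] unfolding sobolev_nrm by blast
  \<comment> \<open>The minimiser lies in the interior of the ball, so the gradient vanishes there.\<close>
  have "?N (G Vmin) = 0"
    unfolding sobolev_nrm[symmetric]
  proof (rule Q.gradient_at_minimum[OF H04_sobolev H04_cmult J_gradient(1)[OF V4]])
    show "0 < M - r" using M r by linarith
    fix h assume h: "h \<in> H04 b T" and "semi_inner_space.nrm ?ip h < M - r"
    then have "?N h < M - r" by (simp add: sobolev_nrm)
    moreover have "?N (\<lambda>x. Vmin x + h x) \<le> ?N Vmin + ?N h"
      using h H04_sobolev by (intro sobolev_norm_triangle V4) auto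
    ultimately have "?N (\<lambda>x. Vmin x + 1 * h x) < M" using ball4(2)[OF Vmin] by simp
    from min[OF data_ball_shift[OF Vmin h this]]
    show "Q.energy Vmin \<le> Q.energy (\<lambda>x. Vmin x + h x)" by (simp add: J_fun_energy)
  qed
  then have zero: "?ip (G Vmin) h = 0" if "h \<in> H04 b T" for h
    using H.Cauchy_Schwarz[OF J_gradient(2)[OF V4] that] by (simp add: Hn)
  have step: "?N (\<lambda>x. (V x - \<kappa> * G V x) - Vmin x) \<le> sqrt (1 - \<kappa> * \<gamma>) * ?N (\<lambda>x. V x - Vmin x)"
    if V: "V \<in> ?B" and \<kappa>: "0 < \<kappa>" "\<kappa> * L\<^sup>2 \<le> \<gamma>" "\<kappa> * \<gamma> \<le> 1" for V \<kappa>
  proof -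
    note V4' = ball4(1)[OF V]
    define e where "e x = V x - Vmin x" for x
    have e: "e \<in> H04 b T" unfolding e_def[abs_def] by (rule data_ball_diff[OF V Vmin])
    have GH: "G V \<in> H04 b T" by (rule J_gradient(2)[OF V4'])
    \<comment> \<open>Add the strict convexity inequalities for the two orders of the pair.\<close>
    have neg: "(\<lambda>x. Vmin x - V x) = (\<lambda>x. - 1 * e x)" by (auto simp: e_def)
    have "?N (\<lambda>x. Vmin x - V x) = ?N e" unfolding neg using H.nrm_cmult[OF e, of "- 1"] by (simp add: Hn)
    moreover have "?ip (G V) (\<lambda>x. Vmin x - V x) = - ?ip (G V) e"
      unfolding neg using H.ip_cmult2[OF e GH, of "- 1"] by simp
    ultimately have "\<gamma> / 2 * (?N e)\<^sup>2 \<le> J Vmin - J V + ?ip (G V) e" using conv[OF V VminB] by simp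
    moreover have "\<gamma> / 2 * (?N e)\<^sup>2 \<le> J V - J Vmin"
      using conv[OF VminB V] zero[OF e] by (simp add: e_def[abs_def])
    ultimately have mono: "\<gamma> * (H.nrm e)\<^sup>2 \<le> ?ip (G V) e" by (simp add: Hn)
    have Lip: "H.nrm (G V) \<le> L * H.nrm e"
    proof (cases "H.nrm (G V) = 0")
      case False
      then have pos: "0 < H.nrm (G V)" using H.nrm_nonneg[OF GH] by simp
      have "(H.nrm (G V))\<^sup>2 = Q.differential V (G V) - Q.differential Vmin (G V)"
        using H.nrm_square[OF GH] J_gradient(3)[OF V4' GH] J_gradient(3)[OF V4 GH] zero[OF GH] by simp
      also have "\<dots> \<le> L * ?N e * ?N (G V)"
        using L(2)[OF V4' V4 _ _ subsetD[OF H04_sobolev GH]] ball4(2)[OF V] ball4(2)[OF VminB]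
        by (auto simp: e_def[abs_def])
      finally show ?thesis using pos by (simp add: Hn power2_eq_square)
    qed (use L(1) H.nrm_nonneg[OF e] in simp)
    have "(\<lambda>x. (V x - \<kappa> * G V x) - Vmin x) = (\<lambda>x. e x - \<kappa> * G V x)" by (auto simp: e_def)
    then show ?thesis
      using H.descent_step[OF e GH mono Lip \<kappa>] by (simp add: Hn e_def[abs_def])
  qed
  define \<kappa>0 where "\<kappa>0 = min (1 / 2) (\<gamma> / L\<^sup>2)"
  have \<kappa>0: "0 < \<kappa>0" "\<kappa>0 < 1" using \<gamma> L(1) by (auto simp: \<kappa>0_def)
  show ?thesis
  proof (rule exI[of _ \<kappa>0], intro conjI allI impI \<kappa>0)
    fix \<kappa> assume \<kappa>': "0 < \<kappa> \<and> \<kappa> < \<kappa>0"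
    then have \<kappa>: "0 < \<kappa>" "\<kappa> < 1 / 2" "\<kappa> * L\<^sup>2 \<le> \<gamma>"
      using L(1) by (auto simp: \<kappa>0_def field_simps)
    have \<kappa>\<gamma>: "0 < \<kappa> * \<gamma>" "\<kappa> * \<gamma> < 1"
      using \<kappa> \<gamma> mult_strict_mono[of \<kappa> 1 \<gamma> 1] by auto
    define \<theta> where "\<theta> = sqrt (1 - \<kappa> * \<gamma>)"
    have \<theta>: "0 < \<theta>" "\<theta> < 1" using \<kappa>\<gamma> by (auto simp: \<theta>_def)
    let ?V = "descent b T \<beta> lam \<gamma> \<kappa> V0"
    have VV0: "?N (\<lambda>x. V0 x - Vmin x) < 2 * r"
      using semi_inner_space.nrm_diff_le[OF sobolev_semi_inner ball4(1)[OF V0] V4] ball4(2)[OF V0] ball4(2)[OF Vmin]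
      by (simp add: sobolev_nrm)
    have main: "?V n \<in> ?B \<and> ?N (\<lambda>x. ?V n x - Vmin x) \<le> \<theta> ^ n * ?N (\<lambda>x. V0 x - Vmin x)" for n
    proof (induction n)
      case 0
      then show ?case using V0 M r by (auto simp: data_ball_def)
    next
      case (Suc n)
      then have VB: "?V n \<in> ?B" by simp
      have "?N (\<lambda>x. ?V (Suc n) x - Vmin x) \<le> \<theta> * ?N (\<lambda>x. ?V n x - Vmin x)"
        using step[OF VB \<kappa>(1,3)] \<kappa>\<gamma> by (simp add: \<theta>_def)
      also have "\<dots> \<le> \<theta> * (\<theta> ^ n * ?N (\<lambda>x. V0 x - Vmin x))"
        using Suc \<theta> by (intro mult_left_mono) auto
      finally have bound: "?N (\<lambda>x. ?V (Suc n) x - Vmin x) \<le> \<theta> ^ Suc n * ?N (\<lambda>x. V0 x - Vmin x)"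
        by (simp add: mult_ac)
      have "\<theta> ^ Suc n \<le> 1" using \<theta> by (intro power_le_one) auto
      then have "\<theta> ^ Suc n * ?N (\<lambda>x. V0 x - Vmin x) \<le> ?N (\<lambda>x. V0 x - Vmin x)"
        by (rule mult_left_le_one_le[rotated 2]) (use \<theta> in auto)
      with bound VV0 have close: "?N (\<lambda>x. ?V (Suc n) x - Vmin x) < 2 * r" by linarith
      have GH: "G (?V n) \<in> H04 b T" by (rule J_gradient(2)[OF ball4(1)[OF VB]])
      have eq: "?V (Suc n) = (\<lambda>x. ?V n x + (- \<kappa>) * G (?V n) x)" by auto
      have in4: "?V (Suc n) \<in> sobolev 4 R"
        unfolding eq using GH H04_sobolev by (intro sobolev_lincomb ball4(1)[OF VB]) auto
      have "?N (?V (Suc n)) \<le> ?N (\<lambda>x. ?V (Suc n) x - Vmin x) + ?N Vmin"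
        using sobolev_norm_triangle[OF sobolev_diff[OF in4 V4] V4] by simp
      then have "?N (?V (Suc n)) < M" using close ball4(2)[OF Vmin] M by linarith
      then have "?V (Suc n) \<in> ?B" unfolding eq by (intro data_ball_shift[OF VB GH]) simp
      then show ?case using bound by blast
    qed
    show "?V n \<in> ?B" for n using main by blast
    have sym: "?N (\<lambda>x. Vmin x - ?V n x) = ?N (\<lambda>x. ?V n x - Vmin x)" for n
      using main[of n] ball4(1) by (intro sobolev_norm_commute V4) blast
    show "\<exists>\<theta>. 0 < \<theta> \<and> \<theta> < 1 \<and> (\<forall>n\<ge>1. ?N (\<lambda>x. Vmin x - ?V n x) \<le> \<theta> ^ n * ?N (\<lambda>x. Vmin x - V0 x))"
      using \<theta> main sym[of 0] by (intro exI[of _ \<theta>]) (simp add: sym)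
  qed
qed

end

end

theorem theorem4p12:
  fixes c b \<beta> \<mu> T M lam1 lam \<gamma> \<theta>0 :: real
    and q0 q1 :: "real \<Rightarrow> real"
    and Vmin V0 :: "real \<times> real \<Rightarrow> real"
  assumes "c > 1" and "b \<ge> sqrt c"
    and "0 < \<beta>" and "\<beta> < 1 / 2"
    and "0 < \<mu>" and "\<mu> < 2 * \<beta> * b"
    and "T \<ge> 2 * b" and "M > 0"
    and "convexity_threshold b T \<beta> \<mu> M lam1"
    and "0 < \<theta>0" and "\<theta>0 < 1 / 3"
    and "lam \<ge> lam1"
    and "2 * exp (- lam * \<beta> * T) \<le> \<gamma>" and "\<gamma> < 1"
    and "unique_minimizer b T \<beta> M lam \<gamma> q0 q1 Vmin"
    and "Vmin \<in> data_ball b T (\<theta>0 * M) q0 q1"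
    and "V0 \<in> data_ball b T (\<theta>0 * M) q0 q1"
  shows "\<exists>\<kappa>0. 0 < \<kappa>0 \<and> \<kappa>0 < 1 \<and>
    (\<forall>\<kappa>. 0 < \<kappa> \<and> \<kappa> < \<kappa>0 \<longrightarrow>
       (\<forall>n. descent b T \<beta> lam \<gamma> \<kappa> V0 n \<in> data_ball b T M q0 q1) \<and>
       (\<exists>\<theta>. 0 < \<theta> \<and> \<theta> < 1 \<and>
          (\<forall>n\<ge>1. H4_norm b T (\<lambda>x. Vmin x - descent b T \<beta> lam \<gamma> \<kappa> V0 n x)
                  \<le> \<theta> ^ n * H4_norm b T (\<lambda>x. Vmin x - V0 x))))"
proof -
  have "0 < sqrt c" using assms(1) by simp
  then have b: "0 < b" using assms(2) by linarith
  then interpret rectangle b T by unfold_locales (use assms(7) in auto)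
  have \<gamma>: "0 < \<gamma>" using assms(13) by (smt (verit) exp_gt_zero)
  have lam: "1 \<le> lam" using assms(9,12) by (auto simp: convexity_threshold_def)
  let ?J = "J_fun b T \<beta> lam \<gamma>" and ?B = "data_ball b T M q0 q1"
  obtain K where K: "0 < K" and convex: "\<And>V W. V \<in> closed_data_ball b T M q0 q1 \<Longrightarrow> W \<in> closed_data_ball b T M q0 q1 \<Longrightarrow>
      ?J W - ?J V - H4_inner b T (J_gradient b T \<beta> lam \<gamma> V) (\<lambda>x. W x - V x)
          \<ge> K * exp (- 2 * lam * (2 * \<beta> * b - \<mu>)) *
              ((sobolev_norm 1 (subdomain \<beta> \<mu> b) (\<lambda>x. W x - V x))\<^sup>2
               + (sobolev_norm 1 {0<..<2 * \<beta> * b - \<mu>}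
                    (\<lambda>y. initial_trace b T W y - initial_trace b T V y))\<^sup>2)
            + \<gamma> / 2 * (H4_norm b T (\<lambda>x. W x - V x))\<^sup>2"
    using assms(9,12-14) unfolding convexity_threshold_def by blast
  show ?thesis
  proof (rule descent_converges[where r = "\<theta>0 * M"])
    show "\<gamma> / 2 * (H4_norm b T (\<lambda>x. W x - V x))\<^sup>2 \<le> ?J W - ?J V - H4_inner b T (J_gradient b T \<beta> lam \<gamma> V) (\<lambda>x. W x - V x)"
      if "V \<in> ?B" "W \<in> ?B" for V W
    proof -
      have "0 \<le> K * exp (- 2 * lam * (2 * \<beta> * b - \<mu>)) *
              ((sobolev_norm 1 (subdomain \<beta> \<mu> b) (\<lambda>x. W x - V x))\<^sup>2
               + (sobolev_norm 1 {0<..<2 * \<beta> * b - \<mu>}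
                    (\<lambda>y. initial_trace b T W y - initial_trace b T V y))\<^sup>2)"
        using K by (intro mult_nonneg_nonneg add_nonneg_nonneg) auto
      with convex[of V W] that data_ball_closed[of M q0 q1] show ?thesis by (smt (verit) subsetD)
    qed
    show "?J Vmin \<le> ?J W" if "W \<in> ?B" for W
      using assms(15) that data_ball_closed[of M q0 q1]
      by (auto simp: unique_minimizer_def is_arg_min_def not_less)
    show "3 * (\<theta>0 * M) \<le> M" using assms(8,11) mult_right_mono[of "3 * \<theta>0" 1 M] by simp
  qed (use assms(3,14,16,17) lam \<gamma> in auto)
qed

end
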